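(* Let $\eta>0$ and let $\{x_i^t\}_{t\ge 0}$, $\{y_i^t\}_{t\ge0}$ ($i\in V$) be the sequences generated by the DRGFMD algorithm (described in the context, with $X$ compact) with stepsizes $\alpha_t=\frac{\eta}{\sqrt{t+1}}$, $t\ge 0$. For $l\in V$ let $\widehat{x}_l^T=\frac1T\sum_{t=1}^T x_l^t$. Then for every $l\in V$, every optimal point $x^\star$ and every $T\ge 1$, $$\mathbb E[f(\widehat{x}_l^T)]-f(x^\star)\le \sqrt n\,\widehat L\cdot\frac1N\sum_{i=1}^N\mu_i+\frac{C_1}{\sqrt T},$$ where $$C_1=\frac{\sqrt2\,d_\phi^2}{\eta}+\frac{9\sqrt2\,(n+4)^2\widehat L^2\eta}{\sigma_\phi}+\frac{4\sqrt2\,N(n+4)^2\Gamma\widehat L^2\eta}{\sigma_\phi(1-\gamma)}.$$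
   Context: Network. There are $N$ agents $V=\{1,\dots,N\}$. At each time $t=0,1,2,\dots$ communication is described by a directed graph $G_t=(V,E^t,P^t)$ with communication matrix $P^t\in\mathbb R^{N\times N}$. Network assumption: each $P^t$ is doubly stochastic; there is a positive integer $B$ such that $(V,\bigcup_{s=0}^{B-1}E^{t+s})$ is strongly connected for every $t$; there is $0<\zeta<1$ with $[P^t]_{ii}\ge\zeta$ for all $i,t$ and $[P^t]_{ij}\ge\zeta$ whenever $(j,i)\in E^t$. Set $\Gamma=(1-\frac{\zeta}{4N^2})^{-2}$ and $\gamma=(1-\frac{\zeta}{4N^2})^{1/B}$. Problem. $X\subset\mathbb R^n$ is a nonempty compact convex set; each $f_i:\mathbb R^n\to\mathbb R$ is convex (not necessarily smooth) and $L_i$-Lipschitz on $X$ with respect to the Euclidean norm $\|\cdot\|$; $\widehat L=\max_i L_i$; $f=\frac1N\sum_{i=1}^N f_i$; an optimal point $x^\star$ is a minimizer of $f$ over $X$. Bregman divergence. $\phi$ is a real function defined on an open set containing $X$, three times continuously differentiable and $\sigma_\phi$-strongly convex with $\sigma_\phi>0$, i.e. $\phi(\theta x+(1-\theta)y)\le\theta\phi(x)+(1-\theta)\phi(y)-\frac{\sigma_\phi\theta(1-\theta)}2\|x-y\|^2$ for $x,y\in X$, $\theta\in[0,1]$; with $H=\nabla^2\phi$, the matrices $H(y)$ and $H(y)+\nabla H(y)(y-x)$ are positive semidefinite for all $x,y\in X$ (here $\nabla H(y)(v)$ is the directional derivative of $H$ at $y$ in direction $v$). $D_\phi(x,y)=\phi(x)-\phi(y)-\langle\nabla\phi(y),x-y\rangle$.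 The constant $d_\phi$ satisfies $\sup_{x,y\in X}D_\phi(x,y)\le d_\phi^2$. DRGFMD algorithm. Smoothing parameters $\mu_i>0$ and stepsizes $\alpha_t$ are given. $\xi_i^t$ ($i\in V$, $t\ge0$) are independent standard Gaussian vectors in $\mathbb R^n$. Starting from $x_i^0=0\in X$ for all $i$, for $t\ge 0$: $$y_i^t=\sum_{j=1}^N[P^t]_{ij}x_j^t,\qquad x_i^{t+1}=\arg\min_{x\in X}\Big\{\alpha_t\Big\langle \frac{f_i(y_i^t+\mu_i\xi_i^t)-f_i(y_i^t)}{\mu_i}\xi_i^t,\,x\Big\rangle+D_\phi(x,y_i^t)\Big\}.$$
   Formalization: Each f_i is assumed L_i-Lipschitz on all of R^n, not only on X: the algorithm queries f_i at unbounded Gaussian-perturbed points, and with Lipschitz continuity on X alone the bound fails (X=[-1,0], f(u)=max(-u,200u), μ=1/2). *)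

theory Defs
  imports "HOL-Probability.Probability"
begin

definition doubly_stochastic :: "real ^ 'v ^ 'v \<Rightarrow> bool" where
  "doubly_stochastic A \<longleftrightarrow>
     (\<forall>i j. 0 \<le> A $ i $ j) \<and> (\<forall>i. (\<Sum>j\<in>UNIV. A $ i $ j) = 1) \<and> (\<forall>j. (\<Sum>i\<in>UNIV. A $ i $ j) = 1)"

text \<open>
  The agents are the elements of the finite type \<open>'v\<close>. A pair \<open>(j, i)\<close> in \<open>E t\<close> is an
  arc from \<open>j\<close> to \<open>i\<close>; the weight that \<open>i\<close> puts on it is \<open>P t $ i $ j\<close>. Entries of \<open>P t\<close>
  outside \<open>E t\<close> and the diagonal are not required to vanish.
\<close>

definition network ::
  "(nat \<Rightarrow> ('v \<times> 'v) set) \<Rightarrow> (nat \<Rightarrow> real ^ 'v ^ 'v) \<Rightarrow> nat \<Rightarrow> real \<Rightarrow> bool" where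
  "network E P B \<zeta> \<longleftrightarrow>
     (\<forall>t. doubly_stochastic (P t)) \<and>
     1 \<le> B \<and> (\<forall>t u v. (u, v) \<in> (\<Union>s<B. E (t + s))\<^sup>*) \<and>
     0 < \<zeta> \<and> \<zeta> < 1 \<and>
     (\<forall>t i. \<zeta> \<le> P t $ i $ i) \<and>
     (\<forall>t i j. (j, i) \<in> E t \<longrightarrow> \<zeta> \<le> P t $ i $ j)"

definition grad :: "(real ^ 'n \<Rightarrow> real) \<Rightarrow> real ^ 'n \<Rightarrow> real ^ 'n" where
  "grad \<phi> y = (\<chi> k. frechet_derivative \<phi> (at y) (axis k 1))"

definition hess :: "(real ^ 'n \<Rightarrow> real) \<Rightarrow> real ^ 'n \<Rightarrow> real ^ 'n ^ 'n" where
  "hess \<phi> y = jacobian (grad \<phi>) (at y)"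

definition hess_deriv :: "(real ^ 'n \<Rightarrow> real) \<Rightarrow> real ^ 'n \<Rightarrow> real ^ 'n \<Rightarrow> real ^ 'n ^ 'n" where
  "hess_deriv \<phi> y v = frechet_derivative (hess \<phi>) (at y) v"

text \<open>
  Meant for open \<open>U\<close>. Only the third derivative needs an explicit continuity condition, since
  the lower ones are differentiable.
\<close>

definition C3_on :: "(real ^ 'n) set \<Rightarrow> (real ^ 'n \<Rightarrow> real) \<Rightarrow> bool" where
  "C3_on U \<phi> \<longleftrightarrow>
     (\<forall>y\<in>U. \<phi> differentiable (at y)) \<and>
     (\<forall>y\<in>U. grad \<phi> differentiable (at y)) \<and>
     (\<forall>y\<in>U. hess \<phi> differentiable (at y)) \<and>
     (\<forall>v. continuous_on U (\<lambda>y. hess_deriv \<phi> y v))"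

definition strongly_convex_on :: "'a::real_normed_vector set \<Rightarrow> real \<Rightarrow> ('a \<Rightarrow> real) \<Rightarrow> bool" where
  "strongly_convex_on X \<sigma> \<phi> \<longleftrightarrow>
     (\<forall>x\<in>X. \<forall>y\<in>X. \<forall>\<theta>\<in>{0..1}.
        \<phi> (\<theta> *\<^sub>R x + (1 - \<theta>) *\<^sub>R y)
          \<le> \<theta> * \<phi> x + (1 - \<theta>) * \<phi> y - \<sigma> * \<theta> * (1 - \<theta>) / 2 * (norm (x - y))\<^sup>2)"

definition psd :: "real ^ 'n ^ 'n \<Rightarrow> bool" where
  "psd A \<longleftrightarrow> transpose A = A \<and> (\<forall>v. 0 \<le> v \<bullet> (A *v v))"

definition bregman :: "(real ^ 'n \<Rightarrow> real) \<Rightarrow> real ^ 'n \<Rightarrow> real ^ 'n \<Rightarrow> real" where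
  "bregman \<phi> x y = \<phi> x - \<phi> y - grad \<phi> y \<bullet> (x - y)"

definition std_gaussian :: "'w measure \<Rightarrow> ('w \<Rightarrow> real ^ 'n) \<Rightarrow> bool" where
  "std_gaussian M Z \<longleftrightarrow>
     distributed M lborel Z (\<lambda>z. ennreal (\<Prod>k\<in>UNIV. std_normal_density (z $ k)))"

text \<open>The randomized gradient-free oracle at \<open>y\<close>, with \<open>z\<close> the sampled direction.\<close>

definition oracle_grad :: "(real ^ 'n \<Rightarrow> real) \<Rightarrow> real \<Rightarrow> real ^ 'n \<Rightarrow> real ^ 'n \<Rightarrow> real ^ 'n" where
  "oracle_grad g m z y = ((g (y + m *\<^sub>R z) - g y) / m) *\<^sub>R z"

text \<open>
  The iterates \<open>x\<close>, \<open>y\<close> produced along one realization \<open>z\<close> of the random directions.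
  All families are indexed by agent first and time second.
\<close>

definition drgfmd ::
  "(real ^ 'n) set \<Rightarrow> (real ^ 'n \<Rightarrow> real) \<Rightarrow> (nat \<Rightarrow> real ^ 'v ^ 'v) \<Rightarrow> ('v \<Rightarrow> real ^ 'n \<Rightarrow> real) \<Rightarrow>
   ('v \<Rightarrow> real) \<Rightarrow> (nat \<Rightarrow> real) \<Rightarrow> ('v \<Rightarrow> nat \<Rightarrow> real ^ 'n) \<Rightarrow>
   ('v \<Rightarrow> nat \<Rightarrow> real ^ 'n) \<Rightarrow> ('v \<Rightarrow> nat \<Rightarrow> real ^ 'n) \<Rightarrow> bool" where
  "drgfmd X \<phi> P f \<mu> \<alpha> z x y \<longleftrightarrow>
     (\<forall>i. x i 0 = 0) \<and>
     (\<forall>i t. y i t = (\<Sum>j\<in>UNIV. P t $ i $ j *\<^sub>R x j t)) \<and>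
     (\<forall>i t. is_arg_min
        (\<lambda>u. \<alpha> t * (oracle_grad (f i) (\<mu> i) (z i t) (y i t) \<bullet> u) + bregman \<phi> u (y i t))
        (\<lambda>u. u \<in> X) (x i (Suc t)))"

definition avg_fun :: "('v::finite \<Rightarrow> 'a \<Rightarrow> real) \<Rightarrow> 'a \<Rightarrow> real" where
  "avg_fun f u = (1 / real CARD('v)) * (\<Sum>i\<in>UNIV. f i u)"

end

theory Submission
  imports Defs
begin

text \<open>
  Each agent averages with its neighbours and then takes a mirror step along a noisy gradient.
  The optimality gap splits into three parts.

  \<^item> \<^emph>\<open>Regret.\<close> Along every realization, one mirror step satisfies the three-point inequality
  \<open>\<alpha> \<langle>g, y - u\<rangle> \<le> D(u, y) - D(u, x') + \<alpha>\<^sup>2 |g|\<^sup>2 / (2 \<sigma>)\<close> (\<open>mirror_step_progress\<close>). The positivity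
  of \<open>H(y) + \<nabla>H(y)(y - u)\<close> makes \<open>D(u, \<cdot>)\<close> convex (\<open>bregman_convex\<close>), so averaging with a doubly
  stochastic matrix cannot increase the sum of \<open>D(u, x\<^sub>i)\<close> over the agents. The divergences
  therefore telescope (\<open>regret_bound\<close>).

  \<^item> \<^emph>\<open>Consensus.\<close> An agent's iterate differs from the network mean by what the mirror steps
  inject and the averaging has not yet removed. Over a window of \<open>B\<close> steps averaging contracts the
  dispersion by the factor \<open>q = 1 - \<zeta> / (4 N\<^sup>2)\<close> (\<open>network_contraction\<close>); summing the resulting
  recursion over time gives the factor \<open>B / (1 - q) \<le> \<Gamma> / (1 - \<gamma>)\<close>.

  \<^item> \<^emph>\<open>Bias.\<close> The expected gradient estimate is the gradient of the Gaussian smoothing of \<open>f\<^sub>i\<close>,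
  which lies between \<open>f\<^sub>i\<close> and \<open>f\<^sub>i + \<mu>\<^sub>i L\<^sub>i sqrt n\<close>. As the smoothing is convex, the
  expected inner product of the estimate with \<open>y - u\<close> is at least
  \<open>f\<^sub>i(y) - f\<^sub>i(u) - \<mu>\<^sub>i L\<^sub>i sqrt n\<close> (\<open>oracle_grad_expected_progress\<close>). It applies at the random
  point \<open>y\<^sub>i\<^sup>t\<close> because that point depends only on directions drawn before time \<open>t\<close>.

  The contraction is obtained for a whole window at once. The transition matrix \<open>\<Phi>\<close> of the window
  is doubly stochastic, and the energy \<open>\<Sum> x\<^sub>i\<^sup>2\<close> lost under \<open>\<Phi>\<close> is a nonnegative combination of
  the squares \<open>(x\<^sub>i - x\<^sub>j)\<^sup>2\<close>. Such a form is controlled from below by its values on the indicators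
  of proper nonempty sets of agents (\<open>spread_le_drop\<close>). For an indicator the loss is
  \<open>\<Sum> u\<^sub>i (1 - u\<^sub>i)\<close>, where \<open>u\<close> is the vector reached at the end of the window. Either some entry
  has reached the middle of \<open>[0, 1]\<close> at some time, which makes this sum large, or the entries stay
  near \<open>0\<close> and \<open>1\<close>; then an arc of the window, or an agent that changes sides, produces a single
  averaging step with loss at least \<open>\<zeta> / 4\<close> (\<open>cut_drop\<close>).
\<close>

section \<open>Averaging with doubly stochastic matrices\<close>

definition mix :: "real ^ 'v ^ 'v \<Rightarrow> ('v::finite \<Rightarrow> 'a::real_vector) \<Rightarrow> 'v \<Rightarrow> 'a" where
  "mix A x i = (\<Sum>j\<in>UNIV. A $ i $ j *\<^sub>R x j)"

lemma doubly_stochasticD: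
  assumes "doubly_stochastic A"
  shows "0 \<le> A $ i $ j" "(\<Sum>j\<in>UNIV. A $ i $ j) = 1" "(\<Sum>i\<in>UNIV. A $ i $ j) = 1"
  using assms unfolding doubly_stochastic_def by auto

lemma doubly_stochastic_mult:
  fixes A C :: "real ^ 'v::finite ^ 'v"
  assumes A: "doubly_stochastic A" and C: "doubly_stochastic C"
  shows "doubly_stochastic (A ** C)"
proof -
  have "0 \<le> (A ** C) $ i $ j" for i j
    unfolding matrix_matrix_mult_def using doubly_stochasticD(1)[OF A] doubly_stochasticD(1)[OF C]
    by (auto intro!: sum_nonneg mult_nonneg_nonneg)
  moreover have "(\<Sum>j\<in>UNIV. (A ** C) $ i $ j) = 1" for i
  proof -
    have "(\<Sum>j\<in>UNIV. (A ** C) $ i $ j) = (\<Sum>k\<in>UNIV. \<Sum>j\<in>UNIV. A $ i $ k * C $ k $ j)"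
      unfolding matrix_matrix_mult_def by simp (rule sum.swap)
    also have "\<dots> = 1"
      by (simp add: sum_distrib_left[symmetric] doubly_stochasticD[OF A] doubly_stochasticD[OF C])
    finally show ?thesis .
  qed
  moreover have "(\<Sum>i\<in>UNIV. (A ** C) $ i $ j) = 1" for j
  proof -
    have "(\<Sum>i\<in>UNIV. (A ** C) $ i $ j) = (\<Sum>k\<in>UNIV. \<Sum>i\<in>UNIV. A $ i $ k * C $ k $ j)"
      unfolding matrix_matrix_mult_def by simp (rule sum.swap)
    also have "\<dots> = 1"
      by (simp add: sum_distrib_right[symmetric] doubly_stochasticD[OF A] doubly_stochasticD[OF C])
    finally show ?thesis .
  qed
  ultimately show ?thesis unfolding doubly_stochastic_def by blast
qed

lemma doubly_stochastic_one: "doubly_stochastic (mat 1 :: real ^ 'v::finite ^ 'v)"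
  unfolding doubly_stochastic_def by (auto simp: mat_def)

lemma mix_mult: "mix (A ** C) x = mix A (mix C x)"
proof
  fix i
  have "mix (A ** C) x i = (\<Sum>j\<in>UNIV. \<Sum>k\<in>UNIV. (A $ i $ k * C $ k $ j) *\<^sub>R x j)"
    unfolding mix_def matrix_matrix_mult_def by (simp add: scaleR_sum_left)
  also have "\<dots> = (\<Sum>k\<in>UNIV. \<Sum>j\<in>UNIV. (A $ i $ k * C $ k $ j) *\<^sub>R x j)"
    by (rule sum.swap)
  also have "\<dots> = mix A (mix C x) i"
    unfolding mix_def by (simp add: scaleR_sum_right)
  finally show "mix (A ** C) x i = mix A (mix C x) i" .
qed

lemma mix_one: "mix (mat 1) x = x"
proof
  fix i
  have "mix (mat 1) x i = (\<Sum>j\<in>UNIV. if i = j then x j else 0)"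
    unfolding mix_def by (intro sum.cong refl) (auto simp: mat_def)
  then show "mix (mat 1) x i = x i" by simp
qed

lemma mix_diff: "mix A (\<lambda>i. x i - z i) i = mix A x i - mix A z i"
  unfolding mix_def by (simp add: scaleR_diff_right sum_subtractf)

lemma mix_const:
  assumes "doubly_stochastic A"
  shows "mix A (\<lambda>_. c) i = c"
  unfolding mix_def
  by (simp add: scaleR_sum_left[symmetric] doubly_stochasticD[OF assms])

lemma sum_mix:
  assumes "doubly_stochastic A"
  shows "(\<Sum>i\<in>UNIV. mix A x i) = (\<Sum>i\<in>UNIV. x i)"
proof -
  have "(\<Sum>i\<in>UNIV. mix A x i) = (\<Sum>j\<in>UNIV. \<Sum>i\<in>UNIV. A $ i $ j *\<^sub>R x j)"
    unfolding mix_def by (rule sum.swap)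
  then show ?thesis
    by (simp add: scaleR_sum_left[symmetric] doubly_stochasticD[OF assms])
qed

text \<open>
  Column sums equal to one turn a bound by the neighbours' average into a bound for the network total.
\<close>

lemma sum_mix_le:
  fixes h :: "'v::finite \<Rightarrow> real"
  assumes "doubly_stochastic A" "\<And>i. z i \<le> mix A h i"
  shows "(\<Sum>i\<in>UNIV. z i) \<le> (\<Sum>i\<in>UNIV. h i)"
  using sum_mono[of UNIV z "mix A h"] assms sum_mix[OF assms(1), of h] by simp

definition energy :: "('v::finite \<Rightarrow> 'a::real_inner) \<Rightarrow> real" where
  "energy x = (\<Sum>i\<in>UNIV. (norm (x i))\<^sup>2)"

text \<open>
  Row by row, the loss is the variance of the values seen by agent \<open>i\<close> around their weighted mean. In this form the contribution of a single arc is visible.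
\<close>

lemma energy_drop_step:
  fixes x :: "'v::finite \<Rightarrow> 'a::real_inner"
  assumes A: "doubly_stochastic A"
  shows "energy x - energy (mix A x) = (\<Sum>i\<in>UNIV. \<Sum>j\<in>UNIV. A $ i $ j * (norm (x j - mix A x i))\<^sup>2)"
proof -
  have row: "(\<Sum>j\<in>UNIV. A $ i $ j * (norm (x j - mix A x i))\<^sup>2)
      = (\<Sum>j\<in>UNIV. A $ i $ j * (norm (x j))\<^sup>2) - (norm (mix A x i))\<^sup>2" for i
  proof -
    let ?y = "mix A x i"
    have "(\<Sum>j\<in>UNIV. A $ i $ j * (norm (x j - ?y))\<^sup>2)
      = (\<Sum>j\<in>UNIV. A $ i $ j * (norm (x j))\<^sup>2 - 2 * ((A $ i $ j *\<^sub>R x j) \<bullet> ?y) + A $ i $ j * (norm ?y)\<^sup>2)"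
      by (intro sum.cong refl) (simp add: power2_norm_eq_inner inner_diff inner_commute algebra_simps)
    also have "\<dots> = (\<Sum>j\<in>UNIV. A $ i $ j * (norm (x j))\<^sup>2) - 2 * ((\<Sum>j\<in>UNIV. A $ i $ j *\<^sub>R x j) \<bullet> ?y)
        + (\<Sum>j\<in>UNIV. A $ i $ j) * (norm ?y)\<^sup>2"
      by (simp add: sum.distrib sum_subtractf sum_distrib_left sum_distrib_right inner_sum_left)
    also have "\<dots> = (\<Sum>j\<in>UNIV. A $ i $ j * (norm (x j))\<^sup>2) - (norm ?y)\<^sup>2"
      by (simp add: doubly_stochasticD[OF A] mix_def[symmetric] power2_norm_eq_inner)
    finally show ?thesis .
  qed
  have "(\<Sum>i\<in>UNIV. \<Sum>j\<in>UNIV. A $ i $ j * (norm (x j))\<^sup>2) = energy x"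
    using sum_mix[OF A, of "\<lambda>j. (norm (x j))\<^sup>2"] unfolding mix_def energy_def by simp
  then show ?thesis unfolding row by (simp add: sum_subtractf energy_def)
qed

lemma energy_mix_le:
  assumes "doubly_stochastic A"
  shows "energy (mix A x) \<le> energy x"
proof -
  have "0 \<le> energy x - energy (mix A x)"
    unfolding energy_drop_step[OF assms]
    by (intro sum_nonneg mult_nonneg_nonneg) (auto simp: doubly_stochasticD[OF assms])
  then show ?thesis by simp
qed

text \<open>
  Twice the energy lost by averaging, as a form in pairwise differences (see \<open>energy_drop_pairs\<close>). Unlike the row-wise formula it does not mention the averaged vector, so it can be compared on different vectors.
\<close>

definition drop_form :: "real ^ 'v ^ 'v \<Rightarrow> ('v::finite \<Rightarrow> real) \<Rightarrow> real" where
  "drop_form A x = (\<Sum>k\<in>UNIV. \<Sum>i\<in>UNIV. \<Sum>j\<in>UNIV. A $ k $ i * A $ k $ j * (x i - x j)\<^sup>2)"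

lemma energy_drop_pairs:
  fixes x :: "'v::finite \<Rightarrow> real"
  assumes A: "doubly_stochastic A"
  shows "2 * (energy x - energy (mix A x)) = drop_form A x"
proof -
  have row: "(\<Sum>i\<in>UNIV. \<Sum>j\<in>UNIV. A $ k $ i * A $ k $ j * (x i - x j)\<^sup>2)
     = 2 * (\<Sum>i\<in>UNIV. A $ k $ i * (x i)\<^sup>2) - 2 * (mix A x k)\<^sup>2" for k
  proof -
    let ?a = "\<lambda>i. A $ k $ i"
    have "(\<Sum>i\<in>UNIV. \<Sum>j\<in>UNIV. ?a i * ?a j * (x i - x j)\<^sup>2)
      = (\<Sum>i\<in>UNIV. \<Sum>j\<in>UNIV. (?a i * (x i)\<^sup>2) * ?a j + ?a i * (?a j * (x j)\<^sup>2) - 2 * ((?a i * x i) * (?a j * x j)))"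
      by (intro sum.cong refl) (simp add: power2_eq_square algebra_simps)
    also have "\<dots> = (\<Sum>i\<in>UNIV. ?a i * (x i)\<^sup>2) * (\<Sum>j\<in>UNIV. ?a j) + (\<Sum>i\<in>UNIV. ?a i) * (\<Sum>j\<in>UNIV. ?a j * (x j)\<^sup>2)
        - 2 * ((\<Sum>i\<in>UNIV. ?a i * x i) * (\<Sum>j\<in>UNIV. ?a j * x j))"
      by (simp only: sum.distrib sum_subtractf sum_product) (simp only: sum_distrib_left)
    also have "\<dots> = 2 * (\<Sum>i\<in>UNIV. ?a i * (x i)\<^sup>2) - 2 * (mix A x k)\<^sup>2"
      by (simp add: doubly_stochasticD[OF A] mix_def power2_eq_square)
    finally show ?thesis .
  qed
  have "(\<Sum>k\<in>UNIV. \<Sum>i\<in>UNIV. A $ k $ i * (x i)\<^sup>2) = energy x"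
    using sum_mix[OF A, of "\<lambda>j. (x j)\<^sup>2"] unfolding mix_def energy_def by simp
  then show ?thesis
    unfolding drop_form_def row by (simp add: sum_subtractf sum_distrib_left[symmetric] energy_def)
qed

text \<open>
  When two vectors are ordered alike, the cross terms \<open>(x\<^sub>i - x\<^sub>j) (b\<^sub>i - b\<^sub>j)\<close> are nonnegative.
\<close>

lemma drop_form_superadditive:
  assumes A: "doubly_stochastic A" and "\<And>i j. 0 \<le> (x i - x j) * (b i - b j)"
  shows "drop_form A x + drop_form A b \<le> drop_form A (\<lambda>i. x i + b i)"
proof -
  have "A $ k $ i * A $ k $ j * (x i - x j)\<^sup>2 + A $ k $ i * A $ k $ j * (b i - b j)\<^sup>2
      \<le> A $ k $ i * A $ k $ j * (x i + b i - (x j + b j))\<^sup>2" for k i j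
  proof -
    have "(x i - x j)\<^sup>2 + (b i - b j)\<^sup>2 \<le> (x i + b i - (x j + b j))\<^sup>2"
      using assms(2)[of i j] by (simp add: power2_eq_square algebra_simps)
    from mult_left_mono[OF this, of "A $ k $ i * A $ k $ j"] doubly_stochasticD(1)[OF A]
    show ?thesis by (simp add: distrib_left)
  qed
  then show ?thesis
    unfolding drop_form_def sum.distrib[symmetric] by (intro sum_mono) auto
qed

lemma drop_form_scale: "drop_form A (\<lambda>i. c * b i) = c\<^sup>2 * drop_form A b"
  unfolding drop_form_def sum_distrib_left
  by (intro sum.cong refl) (simp add: power2_eq_square algebra_simps)

lemma drop_form_nonneg:
  assumes "doubly_stochastic A"
  shows "0 \<le> drop_form A x"
  unfolding drop_form_def
  by (intro sum_nonneg mult_nonneg_nonneg) (auto simp: doubly_stochasticD[OF assms])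

text \<open>
  The Cauchy-Schwarz inequality for \<open>m\<close> gaps of total length \<open>a\<close> and one more gap of length \<open>b\<close>, in the form of an induction step.
\<close>

lemma cauchy_two_gaps:
  fixes a b p q m :: real
  assumes "0 \<le> m" "a\<^sup>2 \<le> m * p" "b\<^sup>2 \<le> q"  "0 \<le> p"
  shows "(a + b)\<^sup>2 \<le> (m + 1) * (p + q)"
proof -
  have "2 * a * b \<le> p + m * q"
  proof (cases "m = 0")
    case True
    then show ?thesis using assms by simp
  next
    case False
    then have m: "0 < m" using assms by simp
    have "0 \<le> (a - m * b)\<^sup>2 / m" using m by simp
    also have "\<dots> = a\<^sup>2 / m - 2 * a * b + m * b\<^sup>2"
      using m by (simp add: power2_eq_square field_simps)
    also have "a\<^sup>2 / m \<le> p" using assms(2) m by (simp add: divide_le_eq mult.commute)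
    also have "m * b\<^sup>2 \<le> m * q" using assms(3) m by simp
    finally show ?thesis by simp
  qed
  then show ?thesis using assms by (simp add: power2_eq_square algebra_simps)
qed

text \<open>
  Peel off the top level set: lower the largest value of \<open>x\<close> to the second largest one. The
  removed part is a multiple of an indicator and is ordered like the remainder, so the loss is at
  least that of the remainder plus \<open>\<kappa>\<close> times the squared gap. After all levels are peeled off, the
  loss is at least \<open>\<kappa>\<close> times the sum of the squared gaps between consecutive values, and these gaps
  add up to the spread. The number of gaps enters through the Cauchy-Schwarz inequality.
\<close>

lemma spread_le_drop_aux:
  fixes x :: "'v::finite \<Rightarrow> real"
  assumes A: "doubly_stochastic A"
    and cut: "\<And>S :: 'v set. S \<noteq> {} \<Longrightarrow> S \<noteq> UNIV \<Longrightarrow> \<kappa> \<le> drop_form A (indicator S)"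
    and "0 < \<kappa>"
    and "card (range x) = Suc m"
  shows "\<kappa> * (Max (range x) - Min (range x))\<^sup>2 \<le> real m * drop_form A x"
  using assms(4)
proof (induction m arbitrary: x)
  case 0
  then obtain c where "range x = {c}" using card_1_singletonE by (metis One_nat_def)
  then show ?case by simp
next
  case (Suc m)
  define top where "top = Max (range x)"
  define c where "c = Max (range x - {top})"
  define \<delta> where "\<delta> = top - c"
  define S where "S = {i. x i = top}"
  define x' where "x' i = min (x i) c" for i
  have top_in: "top \<in> range x" unfolding top_def by (intro Max_in) auto
  have card': "card (range x - {top}) = Suc m"
    using top_in Suc.prems by simp
  then have ne: "range x - {top} \<noteq> {}" by force
  have c_in: "c \<in> range x - {top}" unfolding c_def using ne by (intro Max_in) auto
  have le_top: "x i \<le> top" for i unfolding top_def by (intro Max_ge) auto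
  have c_less: "c < top"
  proof -
    obtain i where "c = x i" "c \<noteq> top" using c_in by auto
    then show ?thesis using le_top[of i] by simp
  qed
  have le_c: "x i \<le> c" if "x i \<noteq> top" for i unfolding c_def using that by (intro Max_ge) auto
  have x'_eq: "x' i = (if i \<in> S then c else x i)" for i
    unfolding x'_def S_def using le_c[of i] c_less by auto
  have range': "range x' = range x - {top}"
  proof
    show "range x' \<subseteq> range x - {top}"
      using x'_eq c_in unfolding S_def by (auto split: if_splits)
    show "range x - {top} \<subseteq> range x'"
    proof
      fix v assume "v \<in> range x - {top}"
      then obtain i where "x i = v" "v \<noteq> top" by auto
      then have "x' i = v" using x'_eq[of i] unfolding S_def by auto
      then show "v \<in> range x'" by auto
    qed
  qed
  have IH: "\<kappa> * (Max (range x') - Min (range x'))\<^sup>2 \<le> real m * drop_form A x'"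
    by (rule Suc.IH) (simp add: range' card')
  have Max': "Max (range x') = c" unfolding range' c_def ..
  have Min': "Min (range x') = Min (range x)"
  proof -
    have "Min (range x) \<in> range x" by (intro Min_in) auto
    moreover have "Min (range x) \<le> c" using c_in by (intro Min_le) auto
    ultimately have "Min (range x) \<in> range x - {top}" using c_less by auto
    then show ?thesis unfolding range' by (intro Min_eqI) (auto intro: Min_le)
  qed
  obtain ic where "c = x ic" using c_in by auto
  then have "ic \<notin> S" using c_less unfolding S_def by simp
  then have S: "S \<noteq> {}" "S \<noteq> UNIV" using top_in unfolding S_def by auto
  have x_eq: "x = (\<lambda>i. x' i + \<delta> * indicator S i)"
    by (auto simp: x'_eq S_def \<delta>_def indicator_def)
  have "drop_form A x' + drop_form A (\<lambda>i. \<delta> * indicator S i) \<le> drop_form A x"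
    unfolding x_eq[THEN arg_cong, of "drop_form A"]
  proof (rule drop_form_superadditive[OF A])
    fix i j
    show "0 \<le> (x' i - x' j) * (\<delta> * indicator S i - \<delta> * indicator S j)"
      using c_less le_c[of i] le_c[of j] unfolding x'_eq \<delta>_def S_def indicator_def
      by (auto intro: mult_nonneg_nonneg mult_nonpos_nonpos)
  qed
  then have step: "drop_form A x' + \<delta>\<^sup>2 * drop_form A (indicator S) \<le> drop_form A x"
    unfolding drop_form_scale .
  have gap: "\<delta>\<^sup>2 * \<kappa> \<le> \<delta>\<^sup>2 * drop_form A (indicator S)"
    by (intro mult_left_mono cut S) auto
  have "((c - Min (range x)) + \<delta>)\<^sup>2 \<le> (real m + 1) * (drop_form A x' / \<kappa> + \<delta>\<^sup>2)"
    using IH \<open>0 < \<kappa>\<close> drop_form_nonneg[OF A, of x']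
    by (intro cauchy_two_gaps) (auto simp: Max' Min' field_simps)
  then have "\<kappa> * (top - Min (range x))\<^sup>2 \<le> \<kappa> * ((real m + 1) * (drop_form A x' / \<kappa> + \<delta>\<^sup>2))"
    using \<open>0 < \<kappa>\<close> unfolding \<delta>_def by (simp only: mult_le_cancel_left_pos) (simp add: algebra_simps)
  also have "\<dots> = (real m + 1) * (drop_form A x' + \<delta>\<^sup>2 * \<kappa>)"
    using \<open>0 < \<kappa>\<close> by (simp add: field_simps)
  also have "\<dots> \<le> (real m + 1) * drop_form A x"
    using step gap by (intro mult_left_mono) auto
  finally show ?case unfolding top_def by (simp add: add.commute)
qed

lemma spread_le_drop:
  fixes x :: "'v::finite \<Rightarrow> real"
  assumes A: "doubly_stochastic A"
    and cut: "\<And>S :: 'v set. S \<noteq> {} \<Longrightarrow> S \<noteq> UNIV \<Longrightarrow> \<kappa> \<le> drop_form A (indicator S)"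
    and "0 < \<kappa>"
  shows "\<kappa> * (Max (range x) - Min (range x))\<^sup>2 \<le> real CARD('v) * drop_form A x"
proof -
  have "card (range x) \<noteq> 0" by simp
  then obtain m where m: "card (range x) = Suc m" using not0_implies_Suc by blast
  have "card (range x) \<le> CARD('v)" by (rule card_image_le) simp
  then have "real m \<le> real CARD('v)" using m by simp
  then have "real m * drop_form A x \<le> real CARD('v) * drop_form A x"
    using drop_form_nonneg[OF A, of x] by (rule mult_right_mono)
  with spread_le_drop_aux[OF A cut \<open>0 < \<kappa>\<close> m] show ?thesis by linarith
qed

section \<open>Contraction of the dispersion\<close>

definition mean :: "('v::finite \<Rightarrow> 'a::real_vector) \<Rightarrow> 'a" where
  "mean x = (1 / real CARD('v)) *\<^sub>R (\<Sum>i\<in>UNIV. x i)"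

definition dispersion :: "('v::finite \<Rightarrow> 'a::real_inner) \<Rightarrow> real" where
  "dispersion x = sqrt (energy (\<lambda>i. x i - mean x))"

lemma energy_nonneg: "0 \<le> energy x" unfolding energy_def by (intro sum_nonneg) auto

lemma dispersion_sq: "(dispersion x)\<^sup>2 = energy (\<lambda>i. x i - mean x)"
  unfolding dispersion_def by (simp add: energy_nonneg)

lemma dispersion_nonneg: "0 \<le> dispersion x"
  unfolding dispersion_def by (simp add: energy_nonneg)

lemma mean_mix: "doubly_stochastic A \<Longrightarrow> mean (mix A x) = mean x"
  unfolding mean_def by (simp add: sum_mix)

lemma energy_around:
  fixes x :: "'v::finite \<Rightarrow> 'a::real_inner"
  shows "energy (\<lambda>i. x i - c) = energy (\<lambda>i. x i - mean x) + real CARD('v) * (norm (mean x - c))\<^sup>2"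
proof -
  have sum: "(\<Sum>i\<in>UNIV. x i) = real CARD('v) *\<^sub>R mean x" unfolding mean_def by simp
  have "energy (\<lambda>i. x i - c) = (\<Sum>i\<in>UNIV. (norm (x i - mean x))\<^sup>2 + 2 * ((x i - mean x) \<bullet> (mean x - c)) + (norm (mean x - c))\<^sup>2)"
    unfolding energy_def
    by (intro sum.cong refl) (simp add: power2_norm_eq_inner inner_diff inner_commute algebra_simps)
  also have "\<dots> = energy (\<lambda>i. x i - mean x) + 2 * ((\<Sum>i\<in>UNIV. x i - mean x) \<bullet> (mean x - c)) + real CARD('v) * (norm (mean x - c))\<^sup>2"
    by (simp add: sum.distrib energy_def inner_sum_left sum_distrib_left)
  also have "(\<Sum>i\<in>UNIV. x i - mean x) = 0" by (simp add: sum_subtractf sum sum_constant_scaleR)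
  finally show ?thesis by simp
qed

lemma energy_centred_le: "energy (\<lambda>i. x i - mean x) \<le> energy (\<lambda>i. x i - c)"
  unfolding energy_around[of x c] by simp

lemma dispersion_triangle: "dispersion (\<lambda>i. x i + e i) \<le> dispersion x + dispersion e"
proof -
  have L2: "dispersion x = L2_set (\<lambda>i. norm (x i - mean x)) UNIV" for x :: "'a \<Rightarrow> 'b"
    unfolding dispersion_def energy_def L2_set_def ..
  have m: "mean (\<lambda>i. x i + e i) = mean x + mean e"
    unfolding mean_def by (simp add: sum.distrib scaleR_add_right)
  have "dispersion (\<lambda>i. x i + e i) \<le> L2_set (\<lambda>i. norm (x i - mean x) + norm (e i - mean e)) UNIV"
    unfolding L2 m by (intro L2_set_mono) (auto simp: add_diff_add norm_triangle_ineq)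
  also have "\<dots> \<le> dispersion x + dispersion e" unfolding L2 by (rule L2_set_triangle_ineq)
  finally show ?thesis .
qed

lemma dispersion_le_sum: "dispersion e \<le> (\<Sum>i\<in>UNIV. norm (e i))"
proof -
  have "dispersion e \<le> sqrt (energy e)"
    unfolding dispersion_def using energy_centred_le[of e 0] by simp
  also have "\<dots> = L2_set (\<lambda>i. norm (e i)) UNIV" unfolding energy_def L2_set_def ..
  also have "\<dots> \<le> (\<Sum>i\<in>UNIV. norm (e i))" by (rule L2_set_le_sum) simp
  finally show ?thesis .
qed

lemma norm_centred_le_dispersion: "norm (x i - mean x) \<le> dispersion x"
proof -
  have "dispersion x = L2_set (\<lambda>i. norm (x i - mean x)) UNIV"
    unfolding dispersion_def energy_def L2_set_def ..
  then show ?thesis using member_le_L2_set[of UNIV i "\<lambda>i. norm (x i - mean x)"] by simp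
qed

lemma energy_centred_drop:
  assumes A: "doubly_stochastic A"
  shows "energy (\<lambda>i. x i - mean x) - energy (\<lambda>i. mix A x i - mean (mix A x)) = energy x - energy (mix A x)"
  using energy_around[of x 0] energy_around[of "mix A x" 0] by (simp add: mean_mix[OF A])

lemma dispersion_mix_le:
  assumes A: "doubly_stochastic A"
  shows "dispersion (mix A x) \<le> dispersion x"
  unfolding dispersion_def using energy_centred_drop[OF A, of x] energy_mix_le[OF A, of x] by simp

text \<open>
  Centring at the mean gives the least energy, so the midpoint of the range can be used instead.
\<close>

lemma energy_centred_le_spread:
  fixes x :: "'v::finite \<Rightarrow> real"
  shows "energy (\<lambda>i. x i - mean x) \<le> real CARD('v) * (Max (range x) - Min (range x))\<^sup>2 / 4"
proof -
  let ?r = "(Max (range x) - Min (range x)) / 2" and ?c = "(Max (range x) + Min (range x)) / 2"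
  have "\<bar>x i - ?c\<bar> \<le> ?r" for i
  proof -
    have "x i \<le> Max (range x)" "Min (range x) \<le> x i" by auto
    then show ?thesis unfolding abs_le_iff by (intro conjI) (simp_all add: field_simps)
  qed
  then have "(norm (x i - ?c))\<^sup>2 \<le> ?r\<^sup>2" for i
    by (metis abs_ge_zero power_mono real_norm_def)
  then have "energy (\<lambda>i. x i - ?c) \<le> (\<Sum>i\<in>(UNIV::'v set). ?r\<^sup>2)"
    unfolding energy_def by (intro sum_mono)
  with energy_centred_le[of x ?c] show ?thesis by (simp add: power_divide)
qed

lemma energy_coordinates:
  fixes x :: "'v::finite \<Rightarrow> 'a::euclidean_space"
  shows "energy x = (\<Sum>b\<in>Basis. energy (\<lambda>i. x i \<bullet> b))"
proof -
  have "(norm v)\<^sup>2 = (\<Sum>b\<in>Basis. (v \<bullet> b)\<^sup>2)" for v :: 'a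
    unfolding power2_norm_eq_inner by (subst euclidean_inner) (simp add: power2_eq_square)
  then show ?thesis unfolding energy_def by simp (rule sum.swap)
qed

text \<open>
  The energy loss under averaging does not depend on the mean, so it is a loss of dispersion. Vectors are treated coordinate by coordinate.
\<close>

lemma dispersion_contracts:
  fixes x :: "'v::finite \<Rightarrow> 'a::euclidean_space"
  assumes A: "doubly_stochastic A"
    and cut: "\<And>S :: 'v set. S \<noteq> {} \<Longrightarrow> S \<noteq> UNIV \<Longrightarrow> \<kappa> \<le> drop_form A (indicator S)"
    and "0 < \<kappa>"
  shows "(dispersion (mix A x))\<^sup>2 \<le> (1 - 2 * \<kappa> / (real CARD('v))\<^sup>2) * (dispersion x)\<^sup>2"
proof -
  let ?N = "real CARD('v)"
  have scalar: "2 * \<kappa> / ?N\<^sup>2 * energy (\<lambda>i. u i - mean u) \<le> energy u - energy (mix A u)" for u :: "'v \<Rightarrow> real"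
  proof -
    have "2 * \<kappa> / ?N\<^sup>2 * energy (\<lambda>i. u i - mean u) \<le> 2 * \<kappa> / ?N\<^sup>2 * (?N * (Max (range u) - Min (range u))\<^sup>2 / 4)"
      using \<open>0 < \<kappa>\<close> by (intro mult_left_mono energy_centred_le_spread) auto
    also have "\<dots> = \<kappa> * (Max (range u) - Min (range u))\<^sup>2 / ?N / 2"
      by (simp add: power2_eq_square)
    also have "\<dots> \<le> ?N * drop_form A u / ?N / 2"
      by (intro divide_right_mono spread_le_drop[OF A cut \<open>0 < \<kappa>\<close>]) auto
    also have "\<dots> = energy u - energy (mix A u)"
      using energy_drop_pairs[OF A, of u] by simp
    finally show ?thesis .
  qed
  have m: "(x i - mean x) \<bullet> b = x i \<bullet> b - mean (\<lambda>i. x i \<bullet> b)" for i b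
    unfolding mean_def by (simp add: inner_diff_left inner_sum_left)
  have mx: "mix A x i \<bullet> b = mix A (\<lambda>i. x i \<bullet> b) i" for i b
    unfolding mix_def by (simp add: inner_sum_left)
  have "2 * \<kappa> / ?N\<^sup>2 * (dispersion x)\<^sup>2 = (\<Sum>b\<in>Basis. 2 * \<kappa> / ?N\<^sup>2 * energy (\<lambda>i. x i \<bullet> b - mean (\<lambda>i. x i \<bullet> b)))"
    unfolding dispersion_sq energy_coordinates[of "\<lambda>i. x i - mean x"] m by (simp add: sum_distrib_left)
  also have "\<dots> \<le> (\<Sum>b\<in>Basis. energy (\<lambda>i. x i \<bullet> b) - energy (mix A (\<lambda>i. x i \<bullet> b)))"
    by (intro sum_mono scalar)
  also have "\<dots> = energy x - energy (mix A x)"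
    unfolding energy_coordinates[of x] energy_coordinates[of "mix A x"] mx by (simp add: sum_subtractf)
  also have "\<dots> = (dispersion x)\<^sup>2 - (dispersion (mix A x))\<^sup>2"
    unfolding dispersion_sq energy_centred_drop[OF A] ..
  finally show ?thesis by (simp add: algebra_simps)
qed

section \<open>The communication network\<close>

primrec transition :: "(nat \<Rightarrow> real ^ 'v ^ 'v) \<Rightarrow> nat \<Rightarrow> nat \<Rightarrow> real ^ 'v::finite ^ 'v" where
  "transition P s 0 = mat 1"
| "transition P s (Suc k) = P (s + k) ** transition P s k"

lemma doubly_stochastic_transition:
  assumes "\<And>t. doubly_stochastic (P t)"
  shows "doubly_stochastic (transition P s k)"
proof (induction k)
  case 0
  show ?case by (simp add: doubly_stochastic_one)
next
  case (Suc k)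
  show ?case unfolding transition.simps by (rule doubly_stochastic_mult[OF assms Suc])
qed

lemma networkD:
  assumes "network E P B \<zeta>"
  shows "doubly_stochastic (P t)" "1 \<le> B" "(u, v) \<in> (\<Union>k<B. E (s + k))\<^sup>*" "0 < \<zeta>" "\<zeta> < 1"
    "\<zeta> \<le> P t $ i $ i" "(j, i) \<in> E t \<Longrightarrow> \<zeta> \<le> P t $ i $ j"
proof -
  note n = assms[unfolded network_def]
  note n2 = n[THEN conjunct2] note n3 = n2[THEN conjunct2] note n4 = n3[THEN conjunct2]
  note n5 = n4[THEN conjunct2] note n6 = n5[THEN conjunct2] note n7 = n6[THEN conjunct2]
  show "doubly_stochastic (P t)" by (rule n[THEN conjunct1, rule_format])
  show "1 \<le> B" by (rule n2[THEN conjunct1])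
  show "(u, v) \<in> (\<Union>k<B. E (s + k))\<^sup>*" by (rule n3[THEN conjunct1, rule_format])
  show "0 < \<zeta>" by (rule n4[THEN conjunct1])
  show "\<zeta> < 1" by (rule n5[THEN conjunct1])
  show "\<zeta> \<le> P t $ i $ i" by (rule n6[THEN conjunct1, rule_format])
  show "\<zeta> \<le> P t $ i $ j" if "(j, i) \<in> E t" by (rule n7[rule_format, OF that])
qed

lemma rtrancl_leaves_set:
  assumes "(u, v) \<in> R\<^sup>*" "u \<in> S" "v \<notin> S"
  shows "\<exists>a b. (a, b) \<in> R \<and> a \<in> S \<and> b \<notin> S"
  using assms by (induction rule: rtrancl_induct) blast+

text \<open>
  The estimate starts from an indicator, so all later values lie in \<open>[0, 1]\<close> and the loss has a
  closed form. This also covers small weights that are not attached to an arc: through them a value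
  can only drift away from \<open>0\<close> or \<open>1\<close>, and drifting to the middle is itself a loss. With
  \<open>[1/4, 3/4]\<close> as the middle, values on different sides are at least \<open>1/2\<close> apart.
\<close>

lemma cut_drop:
  fixes S :: "'v::finite set"
  assumes net: "network E P B \<zeta>" and S: "S \<noteq> {}" "S \<noteq> UNIV"
  shows "\<zeta> / 4 \<le> drop_form (transition P s B) (indicator S)"
proof -
  have ds: "doubly_stochastic (P t)" for t by (rule networkD[OF net])
  have z: "0 < \<zeta>" "\<zeta> < 1" by (rule networkD[OF net])+
  note dst = doubly_stochastic_transition[of P, OF ds]
  define u where "u k = mix (transition P s k) (indicator S :: 'v \<Rightarrow> real)" for k
  have u0: "u 0 = indicator S" unfolding u_def by (simp add: mix_one)
  have uS: "u (Suc k) = mix (P (s + k)) (u k)" for k unfolding u_def by (simp add: mix_mult)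
  have anti: "energy (u k) \<le> energy (u m)" if "m \<le> k" for m k
    using that
  proof (induction rule: dec_induct)
    case (step n)
    then show ?case using energy_mix_le[OF ds, of "s + n" "u n"] by (simp add: uS)
  qed simp
  have u01: "0 \<le> u k i" "u k i \<le> 1" for k i
  proof -
    have "0 \<le> u k i" for k i
      unfolding u_def mix_def by (auto intro!: sum_nonneg simp: doubly_stochasticD[OF dst] indicator_def)
    then show "0 \<le> u k i" .
    have "u k i \<le> mix (transition P s k) (\<lambda>_. 1) i"
      unfolding u_def mix_def by (intro sum_mono) (auto simp: doubly_stochasticD[OF dst] indicator_def)
    then show "u k i \<le> 1" by (simp add: mix_const[OF dst])
  qed
  \<comment> \<open>Mixing preserves the sum of the entries, and the initial entries equal their squares.\<close>
  have lost: "energy (u 0) - energy (u k) = (\<Sum>i\<in>UNIV. u k i * (1 - u k i))" for k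
  proof -
    have "energy (u 0) = (\<Sum>i\<in>UNIV. u 0 i)"
      unfolding energy_def u0 by (intro sum.cong) (auto simp: indicator_def)
    also have "\<dots> = (\<Sum>i\<in>UNIV. u k i)"
      unfolding u0 u_def[of k] by (rule sum_mix[OF dst, symmetric])
    finally show ?thesis unfolding energy_def by (simp add: sum_subtractf power2_eq_square algebra_simps)
  qed
  have jump: "\<zeta> / 8 \<le> energy (u 0) - energy (u B)"
    if "k < B" "\<zeta> \<le> P (s + k) $ i $ j" "1 / 2 \<le> \<bar>u k j - u (Suc k) i\<bar>" for k i j
  proof -
    let ?c = "\<lambda>i j. P (s + k) $ i $ j * (norm (u k j - u (Suc k) i))\<^sup>2"
    have c0: "0 \<le> ?c i j" for i j by (simp add: doubly_stochasticD[OF ds])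
    have "(1 / 2)\<^sup>2 \<le> \<bar>u k j - u (Suc k) i\<bar>\<^sup>2" by (intro power_mono that(3)) auto
    then have "\<zeta> * (1 / 4) \<le> ?c i j"
      using that(2) z by (intro mult_mono) (auto simp: power2_eq_square)
    also have "\<dots> \<le> (\<Sum>j\<in>UNIV. ?c i j)" by (rule member_le_sum) (auto simp: c0 simp del: real_norm_def)
    also have "\<dots> \<le> (\<Sum>i\<in>UNIV. \<Sum>j\<in>UNIV. ?c i j)"
      by (rule member_le_sum) (auto intro!: sum_nonneg c0 simp del: real_norm_def)
    also have "\<dots> = energy (u k) - energy (u (Suc k))"
      unfolding uS by (rule energy_drop_step[OF ds, symmetric])
    also have "\<dots> \<le> energy (u 0) - energy (u B)"
      using anti[of 0 k] anti[of "Suc k" B] \<open>k < B\<close> by simp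
    finally show ?thesis using z by simp
  qed
  have "\<zeta> / 8 \<le> energy (u 0) - energy (u B)"
  proof (cases "\<exists>k\<le>B. \<exists>i. u k i \<in> {1/4..3/4}")
    case True
    then obtain k i where k: "k \<le> B" and i: "u k i \<in> {1/4..3/4}" by blast
    have "0 \<le> (u k i - 1/4) * (3/4 - u k i)" using i by (intro mult_nonneg_nonneg) auto
    then have "3 / 16 \<le> u k i * (1 - u k i)" by (simp add: algebra_simps)
    also have "\<dots> \<le> (\<Sum>i\<in>UNIV. u k i * (1 - u k i))"
      by (rule member_le_sum) (auto simp: u01)
    also have "\<dots> \<le> energy (u 0) - energy (u B)" using lost[of k] anti[OF k] by simp
    finally show ?thesis using z by simp
  next
    case False
    then have out: "u k i < 1/4 \<or> 3/4 < u k i" if "k \<le> B" for k i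
      using False that unfolding atLeastAtMost_iff by (metis not_less)
    show ?thesis
    proof (cases "\<exists>k<B. \<exists>i. (u k i < 1/4) \<noteq> (u (Suc k) i < 1/4)")
      case True
      then obtain k i where k: "k < B" and i: "(u k i < 1/4) \<noteq> (u (Suc k) i < 1/4)" by blast
      have "1 / 2 \<le> \<bar>u k i - u (Suc k) i\<bar>"
        using out[of k i] out[of "Suc k" i] k i by (cases "u k i < 1/4") auto
      moreover have "\<zeta> \<le> P (s + k) $ i $ i" by (rule networkD[OF net])
      ultimately show ?thesis using jump k by blast
    next
      case False
      have side: "k \<le> B \<Longrightarrow> (u k i < 1/4) = (i \<notin> S)" for k i
      proof (induction k)
        case 0
        then show ?case by (simp add: u0 indicator_def)
      next
        case (Suc k)
        then show ?case using False by auto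
      qed
      obtain a b where "a \<in> S" "b \<notin> S" using S by auto
      moreover have "(a, b) \<in> (\<Union>k<B. E (s + k))\<^sup>*" by (rule networkD[OF net])
      ultimately obtain j i where "(j, i) \<in> (\<Union>k<B. E (s + k))" "j \<in> S" "i \<notin> S"
        using rtrancl_leaves_set[of a b _ S] by blast
      then obtain k where k: "k < B" "(j, i) \<in> E (s + k)" by auto
      have "u (Suc k) i < 1/4" "\<not> u k j < 1/4"
        using side[of "Suc k" i] side[of k j] k \<open>j \<in> S\<close> \<open>i \<notin> S\<close> by auto
      then have "1 / 2 \<le> \<bar>u k j - u (Suc k) i\<bar>" using out[of k j] k by auto
      moreover have "\<zeta> \<le> P (s + k) $ i $ j" by (rule networkD(7)[OF net k(2)])
      ultimately show ?thesis using jump k by blast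
    qed
  qed
  then have "\<zeta> / 4 \<le> 2 * (energy (u 0) - energy (u B))" by simp
  also have "\<dots> = drop_form (transition P s B) (indicator S)"
    unfolding u0 u_def[of B] by (rule energy_drop_pairs[OF dst])
  finally show ?thesis .
qed

text \<open>
  The square root of \<open>1 - \<zeta> / (2 N\<^sup>2)\<close> is at most \<open>1 - \<zeta> / (4 N\<^sup>2)\<close>.
\<close>

lemma network_contraction:
  fixes x :: "'v::finite \<Rightarrow> 'a::euclidean_space"
  assumes net: "network E P B \<zeta>"
  shows "dispersion (mix (transition P s B) x) \<le> (1 - \<zeta> / (4 * (real CARD('v))\<^sup>2)) * dispersion x"
proof -
  let ?N = "real CARD('v)"
  have ds: "\<And>t. doubly_stochastic (P t)" and z: "0 < \<zeta>" "\<zeta> < 1" by (rule networkD[OF net])+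
  have N: "1 \<le> ?N" by (simp add: Suc_leI)
  have "\<zeta> * 1 \<le> 4 * ?N\<^sup>2" using N z by (intro mult_mono) (auto simp: self_le_power)
  then have q: "0 \<le> 1 - \<zeta> / (4 * ?N\<^sup>2)" by simp
  have "(dispersion (mix (transition P s B) x))\<^sup>2 \<le> (1 - 2 * (\<zeta> / 4) / ?N\<^sup>2) * (dispersion x)\<^sup>2"
    using z by (intro dispersion_contracts doubly_stochastic_transition ds cut_drop[OF net]) auto
  also have "\<dots> \<le> (1 - \<zeta> / (4 * ?N\<^sup>2))\<^sup>2 * (dispersion x)\<^sup>2"
  proof (rule mult_right_mono)
    have "(1 - \<zeta> / (4 * ?N\<^sup>2))\<^sup>2 = 1 - 2 * (\<zeta> / 4) / ?N\<^sup>2 + (\<zeta> / (4 * ?N\<^sup>2))\<^sup>2"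
      by (simp add: power2_eq_square field_simps)
    then show "1 - 2 * (\<zeta> / 4) / ?N\<^sup>2 \<le> (1 - \<zeta> / (4 * ?N\<^sup>2))\<^sup>2" by simp
  qed simp
  finally have "(dispersion (mix (transition P s B) x))\<^sup>2 \<le> ((1 - \<zeta> / (4 * ?N\<^sup>2)) * dispersion x)\<^sup>2"
    by (simp add: power_mult_distrib)
  then show ?thesis by (rule power2_le_imp_le) (intro mult_nonneg_nonneg q dispersion_nonneg)
qed

text \<open>
  Averaging is linear, so the perturbations can be tracked separately from the averaged start vector; later averaging does not increase their dispersion.
\<close>

lemma perturbed_mixing:
  fixes x e :: "nat \<Rightarrow> 'v::finite \<Rightarrow> 'a::euclidean_space"
  assumes ds: "\<And>t. doubly_stochastic (P t)"
    and step: "\<And>t i. x (Suc t) i = mix (P t) (x t) i + e t i"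
  shows "dispersion (x (t + k)) \<le> dispersion (mix (transition P t k) (x t)) + (\<Sum>s=t..<t+k. dispersion (e s))"
proof -
  define r where "r k i = x (t + k) i - mix (transition P t k) (x t) i" for k i
  have "dispersion (r k) \<le> (\<Sum>s=t..<t+k. dispersion (e s))"
  proof (induction k)
    case 0
    have "r 0 = (\<lambda>i. 0)" unfolding r_def by (simp add: mix_one)
    then show ?case by (simp add: dispersion_def energy_def mean_def)
  next
    case (Suc k)
    have "r (Suc k) = (\<lambda>i. mix (P (t + k)) (r k) i + e (t + k) i)"
      unfolding r_def by (auto simp: step mix_mult mix_diff)
    then have "dispersion (r (Suc k)) \<le> dispersion (mix (P (t + k)) (r k)) + dispersion (e (t + k))"
      using dispersion_triangle[of "mix (P (t + k)) (r k)" "e (t + k)"] by simp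
    also have "\<dots> \<le> dispersion (r k) + dispersion (e (t + k))"
      using dispersion_mix_le[OF ds, of "t + k" "r k"] by simp
    finally show ?case using Suc.IH by simp
  qed
  moreover have "x (t + k) = (\<lambda>i. mix (transition P t k) (x t) i + r k i)" unfolding r_def by simp
  ultimately show ?thesis using dispersion_triangle[of "mix (transition P t k) (x t)" "r k"] by simp
qed

lemma sum_windows_le:
  fixes w :: "nat \<Rightarrow> real"
  assumes "\<And>s. 0 \<le> w s"
  shows "(\<Sum>t\<le>T. \<Sum>s=t-B..<t. w s) \<le> real B * (\<Sum>s<T. w s)"
proof -
  have window: "(\<Sum>s=t-B..<t. w s) = (\<Sum>s<T. if s \<in> {t-B..<t} then w s else 0)" if "t \<le> T" for t
    using that by (subst sum.inter_restrict[symmetric]) (auto intro!: sum.cong)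
  have "(\<Sum>t\<le>T. \<Sum>s=t-B..<t. w s) = (\<Sum>t\<le>T. \<Sum>s<T. if s \<in> {t-B..<t} then w s else 0)"
    by (rule sum.cong[OF refl]) (simp only: window atMost_iff)
  also have "\<dots> = (\<Sum>s<T. \<Sum>t\<le>T. if s \<in> {t-B..<t} then w s else 0)" by (rule sum.swap)
  also have "\<dots> \<le> (\<Sum>s<T. real B * w s)"
  proof (rule sum_mono)
    fix s
    have "(\<Sum>t\<le>T. if s \<in> {t-B..<t} then w s else 0) = (\<Sum>t\<in>{..T} \<inter> {t. s \<in> {t-B..<t}}. w s)"
      by (subst sum.inter_restrict) auto
    also have "\<dots> \<le> (\<Sum>t\<in>{s<..s+B}. w s)"
      using assms by (intro sum_mono2) auto
    finally show "(\<Sum>t\<le>T. if s \<in> {t-B..<t} then w s else 0) \<le> real B * w s" by simp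
  qed
  finally show ?thesis by (simp add: sum_distrib_left)
qed

text \<open>
  One window gives \<open>W\<^sub>t \<le> q W\<^sub>t\<^sub>-\<^sub>B + (perturbations in the window)\<close>. Summed over \<open>t\<close>, every
  perturbation is counted at most \<open>B\<close> times, and the term with \<open>q\<close> is absorbed on the left.
\<close>

lemma sum_dispersion_le:
  fixes x e :: "nat \<Rightarrow> 'v::finite \<Rightarrow> 'a::euclidean_space"
  assumes net: "network E P B \<zeta>"
    and step: "\<And>t i. x (Suc t) i = mix (P t) (x t) i + e t i"
    and x0: "\<And>i. x 0 i = 0"
  shows "\<zeta> / (4 * (real CARD('v))\<^sup>2) * (\<Sum>t\<le>T. dispersion (x t)) \<le> real B * (\<Sum>s<T. dispersion (e s))"
proof -
  define q where "q = 1 - \<zeta> / (4 * (real CARD('v))\<^sup>2)"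
  have ds: "\<And>t. doubly_stochastic (P t)" and z: "0 < \<zeta>" "\<zeta> < 1" and B: "1 \<le> B"
    by (rule networkD[OF net])+
  let ?W = "\<lambda>t. dispersion (x t)"
  have "\<zeta> * 1 \<le> 4 * (real CARD('v))\<^sup>2" using z by (intro mult_mono) (auto simp: self_le_power Suc_leI)
  then have q: "0 \<le> q" unfolding q_def by simp
  have W0: "?W 0 = 0"
    unfolding dispersion_def energy_def mean_def by (simp add: x0)
  have bound: "?W t \<le> q * (if B \<le> t then ?W (t - B) else 0) + (\<Sum>s=t-B..<t. dispersion (e s))" for t
  proof (cases "B \<le> t")
    case True
    then show ?thesis
      using perturbed_mixing[where P = P and x = x and e = e and t = "t - B" and k = B, OF ds step] network_contraction[OF net, of "t - B" "x (t - B)"]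
      unfolding q_def by simp
  next
    case False
    then show ?thesis
      using perturbed_mixing[where P = P and x = x and e = e and t = 0 and k = t, OF ds step]
        dispersion_mix_le[OF doubly_stochastic_transition[of P 0 t, OF ds], of "x 0"] W0 by simp
  qed
  have "(\<Sum>t\<le>T. if B \<le> t then ?W (t - B) else 0) = (\<Sum>t\<in>{..T} \<inter> {B..}. ?W (t - B))"
    by (subst sum.inter_restrict) auto
  also have "\<dots> = (\<Sum>t\<in>(\<lambda>t. t - B) ` ({..T} \<inter> {B..}). ?W t)"
    by (subst sum.reindex) (auto intro!: inj_onI)
  also have "\<dots> \<le> (\<Sum>t\<le>T. ?W t)"
    by (intro sum_mono2) (auto simp: dispersion_nonneg)
  finally have shift: "(\<Sum>t\<le>T. if B \<le> t then ?W (t - B) else 0) \<le> (\<Sum>t\<le>T. ?W t)" .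
  have "(\<Sum>t\<le>T. ?W t) \<le> q * (\<Sum>t\<le>T. if B \<le> t then ?W (t - B) else 0) + (\<Sum>t\<le>T. \<Sum>s=t-B..<t. dispersion (e s))"
    using sum_mono[of "{..T}" ?W, OF bound] by (simp add: sum.distrib sum_distrib_left)
  also have "\<dots> \<le> q * (\<Sum>t\<le>T. ?W t) + real B * (\<Sum>s<T. dispersion (e s))"
    by (intro add_mono mult_left_mono shift q sum_windows_le dispersion_nonneg)
  finally show ?thesis unfolding q_def by (simp add: algebra_simps)
qed

text \<open>
  With \<open>g = q powr (1 / B)\<close>, the quotient \<open>(1 - q) / (1 - g)\<close> is a sum of \<open>B\<close> powers of \<open>g\<close>, all at least \<open>q\<close>.
\<close>

lemma geometric_constant_bound:
  fixes q :: real
  assumes q: "0 < q" "q < 1" and B: "1 \<le> B"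
  shows "q powr (1 / real B) < 1"
    and "real B / (1 - q) \<le> q powi (-2) / (1 - q powr (1 / real B))"
proof -
  define g where "g = q powr (1 / real B)"
  have g0: "0 < g" unfolding g_def using q by simp
  have gB: "g ^ B = q" unfolding g_def using q B by (simp add: powr_realpow[symmetric] powr_powr)
  show "q powr (1 / real B) < 1"
    using power_less_imp_less_base[of g B 1] gB q unfolding g_def by simp
  then have g1: "g < 1" unfolding g_def .
  have "real B * q \<le> (\<Sum>k<B. g ^ k)"
  proof -
    have "q \<le> g ^ k" if "k < B" for k
      using power_decreasing[of k B g] that g0 g1 gB by simp
    then have "(\<Sum>k<B. q) \<le> (\<Sum>k<B. g ^ k)" by (intro sum_mono) auto
    then show ?thesis by simp
  qed
  also have "(\<Sum>k<B. g ^ k) = (1 - q) / (1 - g)"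
    using sum_gp_strict[of g B] g1 gB by simp
  finally have 1: "real B * q * (1 - g) \<le> 1 - q" using g1 by (simp add: field_simps)
  have "real B * (1 - g) * q\<^sup>2 \<le> real B * (1 - g) * q"
    using q g1 by (intro mult_left_mono) (auto simp: power2_eq_square)
  also have "\<dots> \<le> 1 - q" using 1 by (simp add: mult_ac)
  finally have "real B / (1 - q) \<le> 1 / (q\<^sup>2 * (1 - g))"
    using q g1 by (simp add: field_simps)
  then show "real B / (1 - q) \<le> q powi (-2) / (1 - q powr (1 / real B))"
    unfolding g_def by (simp add: power_int_minus divide_simps)
qed

section \<open>Symmetry of second derivatives\<close>

lemma derivative_nonpos_if_max_at_left_end:
  fixes p :: "real \<Rightarrow> real"
  assumes "(p has_real_derivative D) (at 0)" and "\<And>s. 0 < s \<Longrightarrow> s \<le> 1 \<Longrightarrow> p s \<le> p 0"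
  shows "D \<le> 0"
proof (rule ccontr)
  assume "\<not> D \<le> 0"
  then obtain d where d: "0 < d" "\<forall>h>0. h < d \<longrightarrow> p 0 < p (0 + h)"
    using DERIV_pos_inc_right[OF assms(1)] by auto
  have m: "0 < min (d / 2) 1" "min (d / 2) 1 < d" using d(1) by auto
  have "p 0 < p (min (d / 2) 1)" using d(2)[rule_format, OF m] by simp
  with assms(2)[OF m(1)] show False by simp
qed

text \<open>
  The mean value theorem in direction \<open>v\<close> reduces the mixed difference to a difference of two values
  of the derivative in direction \<open>v\<close>. Both are evaluated near \<open>y\<close>, where that derivative is
  approximated by its linearization at \<open>y\<close>.
\<close>

lemma mixed_difference_asymptotics:
  fixes g :: "'a::real_normed_vector \<Rightarrow> real"
  assumes U: "open U" "y \<in> U"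
    and G: "\<And>z. z \<in> U \<Longrightarrow> (g has_derivative G z) (at z)"
    and A: "((\<lambda>z. G z v) has_derivative A) (at y)"
    and "0 < \<epsilon>"
  shows "\<exists>\<delta>>0. \<forall>t. 0 < t \<and> t < \<delta> \<longrightarrow>
    \<bar>(g (y + t *\<^sub>R v + t *\<^sub>R w) - g (y + t *\<^sub>R v) - g (y + t *\<^sub>R w) + g y) - t\<^sup>2 * A w\<bar> \<le> \<epsilon> * t\<^sup>2"
proof -
  interpret A: bounded_linear A using A by (rule has_derivative_bounded_linear)
  define K where "K = norm v + norm w + 1"
  have K: "0 < K" unfolding K_def by (simp add: add_nonneg_pos)
  define \<epsilon>' where "\<epsilon>' = \<epsilon> / (2 * K)"
  have e': "0 < \<epsilon>'" unfolding \<epsilon>'_def using K \<open>0 < \<epsilon>\<close> by simp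
  obtain d1 where d1: "0 < d1" "ball y d1 \<subseteq> U" using U openE by blast
  obtain d2 where d2: "0 < d2" "\<And>z. norm (z - y) < d2 \<Longrightarrow> \<bar>G z v - G y v - A (z - y)\<bar> \<le> \<epsilon>' * norm (z - y)"
    using A e' unfolding has_derivative_at_alt by (auto simp: real_norm_def)
  define \<delta> where "\<delta> = min d1 d2 / K"
  have \<delta>: "0 < \<delta>" unfolding \<delta>_def using d1 d2 K by simp
  show ?thesis
  proof (intro exI[of _ \<delta>] conjI \<delta> allI impI)
    fix t :: real assume t: "0 < t \<and> t < \<delta>"
    have small: "norm (s *\<^sub>R v + r *\<^sub>R w) \<le> t * K" "norm (s *\<^sub>R v + r *\<^sub>R w) < min d1 d2"
      if "0 \<le> s" "s \<le> t" "0 \<le> r" "r \<le> t" for s r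
    proof -
      have "norm (s *\<^sub>R v + r *\<^sub>R w) \<le> s * norm v + r * norm w"
        using norm_triangle_ineq[of "s *\<^sub>R v" "r *\<^sub>R w"] that by simp
      also have "\<dots> \<le> t * norm v + t * norm w"
        using that by (intro add_mono mult_right_mono) auto
      also have "\<dots> \<le> t * K" unfolding K_def using t by (simp add: algebra_simps)
      finally show 1: "norm (s *\<^sub>R v + r *\<^sub>R w) \<le> t * K" .
      have "t * K < min d1 d2" using t K unfolding \<delta>_def by (simp add: pos_less_divide_eq)
      with 1 show "norm (s *\<^sub>R v + r *\<^sub>R w) < min d1 d2" by simp
    qed
    have inU: "y + (s *\<^sub>R v + r *\<^sub>R w) \<in> U" if "0 \<le> s" "s \<le> t" "0 \<le> r" "r \<le> t" for s r
    proof -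
      have "dist (y + (s *\<^sub>R v + r *\<^sub>R w)) y < d1"
        using small(2)[OF that] unfolding dist_norm by simp
      then have "y + (s *\<^sub>R v + r *\<^sub>R w) \<in> ball y d1" by (simp only: mem_ball dist_commute)
      then show ?thesis using d1(2) by blast
    qed
    define p where "p s = g (y + (s *\<^sub>R v + t *\<^sub>R w)) - g (y + (s *\<^sub>R v + 0 *\<^sub>R w))" for s
    define p' where "p' s = G (y + (s *\<^sub>R v + t *\<^sub>R w)) v - G (y + (s *\<^sub>R v + 0 *\<^sub>R w)) v" for s
    have gd: "((\<lambda>s. g (y + (s *\<^sub>R v + r *\<^sub>R w))) has_real_derivative G (y + (s *\<^sub>R v + r *\<^sub>R w)) v) (at s)"
      if "0 \<le> s" "s \<le> t" "0 \<le> r" "r \<le> t" for s r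
    proof -
      interpret G: bounded_linear "G (y + (s *\<^sub>R v + r *\<^sub>R w))"
        using G[OF inU[OF that]] by (rule has_derivative_bounded_linear)
      have "((\<lambda>s. y + (s *\<^sub>R v + r *\<^sub>R w)) has_derivative (\<lambda>h. h *\<^sub>R v)) (at s)"
        by (auto intro!: derivative_eq_intros)
      from has_derivative_compose[OF this G[OF inU[OF that]]]
      have "((\<lambda>s. g (y + (s *\<^sub>R v + r *\<^sub>R w))) has_derivative (\<lambda>h. G (y + (s *\<^sub>R v + r *\<^sub>R w)) (h *\<^sub>R v))) (at s)" .
      moreover have "(\<lambda>h. G (y + (s *\<^sub>R v + r *\<^sub>R w)) (h *\<^sub>R v)) = (*) (G (y + (s *\<^sub>R v + r *\<^sub>R w)) v)"
        by (rule ext) (simp add: G.scaleR)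
      ultimately show ?thesis unfolding has_field_derivative_def by (simp only:)
    qed
    have "\<exists>s>0. s < t \<and> p t - p 0 = (t - 0) * p' s"
    proof (rule MVT2)
      fix s assume "0 \<le> s" "s \<le> t"
      then show "(p has_real_derivative p' s) (at s)"
        unfolding p_def p'_def using t by (intro DERIV_diff gd) auto
    qed (use t in simp)
    then obtain s where s: "0 < s" "s < t" and mvt: "p t - p 0 = t * p' s" by auto
    let ?a = "s *\<^sub>R v + t *\<^sub>R w" and ?b = "s *\<^sub>R v + 0 *\<^sub>R w"
    have na: "norm ?a \<le> t * K" "norm ?a < d2" and nb: "norm ?b \<le> t * K" "norm ?b < d2"
      using small[of s t] small[of s 0] s by auto
    have near: "\<bar>G (y + h) v - G y v - A h\<bar> \<le> \<epsilon>' * (t * K)" if "norm h \<le> t * K" "norm h < d2" for h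
    proof -
      have "\<bar>G (y + h) v - G y v - A h\<bar> \<le> \<epsilon>' * norm h" using d2(2)[of "y + h"] that(2) by simp
      also have "\<dots> \<le> \<epsilon>' * (t * K)" using that(1) e' by (intro mult_left_mono) auto
      finally show ?thesis .
    qed
    note near[OF na] near[OF nb]
    moreover have "A ?a - A ?b = t * A w" by (simp add: A.add A.scaleR A.zero)
    ultimately have "\<bar>p' s - t * A w\<bar> \<le> 2 * (\<epsilon>' * (t * K))" unfolding p'_def by linarith
    also have "\<dots> = \<epsilon> * t" unfolding \<epsilon>'_def using K by simp
    finally have "t * \<bar>p' s - t * A w\<bar> \<le> t * (\<epsilon> * t)" using t by (intro mult_left_mono) auto
    then have "\<bar>t * (p' s - t * A w)\<bar> \<le> \<epsilon> * t\<^sup>2" using t by (simp add: abs_mult power2_eq_square mult_ac)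
    moreover have "t * (p' s - t * A w) = p t - p 0 - t\<^sup>2 * A w"
      unfolding mvt by (simp add: power2_eq_square algebra_simps)
    moreover have "p t - p 0 = g (y + t *\<^sub>R v + t *\<^sub>R w) - g (y + t *\<^sub>R v) - g (y + t *\<^sub>R w) + g y"
      unfolding p_def by (simp add: add.assoc)
    ultimately show "\<bar>(g (y + t *\<^sub>R v + t *\<^sub>R w) - g (y + t *\<^sub>R v) - g (y + t *\<^sub>R w) + g y) - t\<^sup>2 * A w\<bar> \<le> \<epsilon> * t\<^sup>2"
      by simp
  qed
qed

text \<open>
  The mixed difference is symmetric in \<open>v\<close> and \<open>w\<close>, and so is its leading coefficient.
\<close>

lemma second_derivative_symmetric:
  fixes g :: "'a::real_normed_vector \<Rightarrow> real"
  assumes U: "open U" "y \<in> U"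
    and G: "\<And>z. z \<in> U \<Longrightarrow> (g has_derivative G z) (at z)"
    and Av: "((\<lambda>z. G z v) has_derivative Av) (at y)"
    and Aw: "((\<lambda>z. G z w) has_derivative Aw) (at y)"
  shows "Av w = Aw v"
proof -
  have "\<bar>Av w - Aw v\<bar> \<le> 2 * \<epsilon>" if \<epsilon>: "0 < \<epsilon>" for \<epsilon>
  proof -
    let ?D = "\<lambda>t. g (y + t *\<^sub>R v + t *\<^sub>R w) - g (y + t *\<^sub>R v) - g (y + t *\<^sub>R w) + g y"
    obtain d1 where d1: "0 < d1" "\<And>t. 0 < t \<Longrightarrow> t < d1 \<Longrightarrow> \<bar>?D t - t\<^sup>2 * Av w\<bar> \<le> \<epsilon> * t\<^sup>2"
      using mixed_difference_asymptotics[OF U G Av \<epsilon>, of w] by metis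
    obtain d2 where d2: "0 < d2" "\<And>t. 0 < t \<Longrightarrow> t < d2 \<Longrightarrow>
       \<bar>(g (y + t *\<^sub>R w + t *\<^sub>R v) - g (y + t *\<^sub>R w) - g (y + t *\<^sub>R v) + g y) - t\<^sup>2 * Aw v\<bar> \<le> \<epsilon> * t\<^sup>2"
      using mixed_difference_asymptotics[OF U G Aw \<epsilon>, of v] by metis
    define t where "t = min d1 d2 / 2"
    have t: "0 < t" "t < d1" "t < d2" unfolding t_def using d1(1) d2(1) by auto
    have comm: "y + t *\<^sub>R w + t *\<^sub>R v = y + t *\<^sub>R v + t *\<^sub>R w" by (simp add: algebra_simps)
    have "\<bar>t\<^sup>2 * Av w - t\<^sup>2 * Aw v\<bar> \<le> 2 * \<epsilon> * t\<^sup>2"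
      using d1(2)[OF t(1,2)] d2(2)[OF t(1,3)] unfolding comm by linarith
    moreover have "t\<^sup>2 * \<bar>Av w - Aw v\<bar> = \<bar>t\<^sup>2 * Av w - t\<^sup>2 * Aw v\<bar>"
      by (simp add: right_diff_distrib[symmetric] abs_mult)
    ultimately have "t\<^sup>2 * \<bar>Av w - Aw v\<bar> \<le> t\<^sup>2 * (2 * \<epsilon>)" by (simp add: mult_ac)
    then show ?thesis using t(1) by simp
  qed
  from this[of "\<bar>Av w - Aw v\<bar> / 4"] show ?thesis by (cases "Av w = Aw v") auto
qed

lemma bounded_linear_matrix_apply: "bounded_linear (\<lambda>H :: real ^ 'n::finite ^ 'm::finite. H *v h)"
proof -
  have "linear (\<lambda>H :: real ^ 'n ^ 'm. H *v h)"
    by (rule linearI) (simp_all add: matrix_vector_mult_add_rdistrib scaleR_matrix_vector_assoc)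
  then show ?thesis by (simp add: linear_linear)
qed

section \<open>The mirror step\<close>

locale mirror_map =
  fixes X U :: "(real ^ 'n::finite) set" and \<phi> :: "real ^ 'n \<Rightarrow> real" and \<sigma> :: real
  assumes X_ne: "X \<noteq> {}" and X_compact: "compact X" and X_convex: "convex X"
    and U_open: "open U" and XU: "X \<subseteq> U" and C3: "C3_on U \<phi>"
    and \<sigma>_pos: "0 < \<sigma>" and sconv: "strongly_convex_on X \<sigma> \<phi>"
begin

lemma \<phi>_deriv: "y \<in> U \<Longrightarrow> (\<phi> has_derivative (\<lambda>h. grad \<phi> y \<bullet> h)) (at y)"
proof -
  assume "y \<in> U"
  then have d: "(\<phi> has_derivative frechet_derivative \<phi> (at y)) (at y)"
    using C3 unfolding C3_on_def by (simp add: frechet_derivative_works)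
  interpret D: bounded_linear "frechet_derivative \<phi> (at y)"
    using d by (rule has_derivative_bounded_linear)
  have "frechet_derivative \<phi> (at y) h = grad \<phi> y \<bullet> h" for h
  proof -
    have "frechet_derivative \<phi> (at y) h = frechet_derivative \<phi> (at y) (\<Sum>k\<in>UNIV. h $ k *\<^sub>R axis k 1)"
      by (simp add: basis_expansion scalar_mult_eq_scaleR[symmetric])
    also have "\<dots> = (\<Sum>k\<in>UNIV. h $ k * frechet_derivative \<phi> (at y) (axis k 1))"
      by (simp add: D.sum D.scaleR)
    finally show ?thesis by (simp add: grad_def inner_vec_def mult.commute)
  qed
  then have "frechet_derivative \<phi> (at y) = (\<lambda>h. grad \<phi> y \<bullet> h)" by auto
  with d show ?thesis by simp
qed

lemma grad_deriv: "y \<in> U \<Longrightarrow> (grad \<phi> has_derivative (\<lambda>h. hess \<phi> y *v h)) (at y)"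
  using C3 unfolding C3_on_def hess_def by (simp add: jacobian_works)

lemma hess_has_deriv: "y \<in> U \<Longrightarrow> (hess \<phi> has_derivative hess_deriv \<phi> y) (at y)"
  using C3 unfolding C3_on_def hess_deriv_def
  by (simp add: frechet_derivative_works[symmetric] eta_contract_eq)

lemma grad_continuous: "continuous_on X (grad \<phi>)"
  by (intro continuous_at_imp_continuous_on ballI has_derivative_continuous[OF grad_deriv]) (use XU in auto)

lemma \<phi>_continuous: "continuous_on X \<phi>"
  by (intro continuous_at_imp_continuous_on ballI has_derivative_continuous[OF \<phi>_deriv]) (use XU in auto)

lemma segment_in: "u \<in> X \<Longrightarrow> v \<in> X \<Longrightarrow> 0 \<le> s \<Longrightarrow> s \<le> 1 \<Longrightarrow> v + s *\<^sub>R (u - v) \<in> X"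
  using convexD_alt[OF X_convex, of v u s] by (simp add: algebra_simps)

lemma \<phi>_along:
  assumes "v + s *\<^sub>R w \<in> U"
  shows "((\<lambda>s. \<phi> (v + s *\<^sub>R w)) has_real_derivative grad \<phi> (v + s *\<^sub>R w) \<bullet> w) (at s)"
proof -
  have "((\<lambda>s. v + s *\<^sub>R w) has_derivative (\<lambda>h. h *\<^sub>R w)) (at s)"
    by (auto intro!: derivative_eq_intros)
  note chain = has_derivative_compose[OF this \<phi>_deriv[OF assms]]
  have "(\<lambda>h. grad \<phi> (v + s *\<^sub>R w) \<bullet> (h *\<^sub>R w)) = (*) (grad \<phi> (v + s *\<^sub>R w) \<bullet> w)"
    by (rule ext) simp
  with chain show ?thesis unfolding has_field_derivative_def by (simp only:)
qed

lemma grad_along: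
  assumes "v + s *\<^sub>R w \<in> U"
  shows "((\<lambda>s. grad \<phi> (v + s *\<^sub>R w)) has_vector_derivative hess \<phi> (v + s *\<^sub>R w) *v w) (at s)"
proof -
  have "((\<lambda>s. v + s *\<^sub>R w) has_derivative (\<lambda>h. h *\<^sub>R w)) (at s)"
    by (auto intro!: derivative_eq_intros)
  from has_derivative_compose[OF this grad_deriv[OF assms]] show ?thesis
    unfolding has_vector_derivative_def by (simp add: matrix_vector_mult_scaleR)
qed

lemma hess_along:
  assumes "v + s *\<^sub>R w \<in> U"
  shows "((\<lambda>s. hess \<phi> (v + s *\<^sub>R w)) has_vector_derivative hess_deriv \<phi> (v + s *\<^sub>R w) w) (at s)"
proof -
  have "((\<lambda>s. v + s *\<^sub>R w) has_derivative (\<lambda>h. h *\<^sub>R w)) (at s)"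
    by (auto intro!: derivative_eq_intros)
  note c = has_derivative_compose[OF this hess_has_deriv[OF assms]]
  interpret D: bounded_linear "hess_deriv \<phi> (v + s *\<^sub>R w)"
    using hess_has_deriv[OF assms] by (rule has_derivative_bounded_linear)
  show ?thesis using c unfolding has_vector_derivative_def by (simp add: D.scaleR)
qed

lemma bregman_lower:
  assumes u: "u \<in> X" and v: "v \<in> X"
  shows "\<sigma> / 2 * (norm (u - v))\<^sup>2 \<le> bregman \<phi> u v"
proof -
  let ?w = "u - v"
  define p where "p s = \<phi> (v + s *\<^sub>R ?w) - s * (\<phi> u - \<phi> v) + \<sigma> * s * (1 - s) / 2 * (norm ?w)\<^sup>2" for s
  have "v \<in> U" using v XU by auto
  then have "(p has_real_derivative grad \<phi> v \<bullet> ?w - (\<phi> u - \<phi> v) + \<sigma> / 2 * (norm ?w)\<^sup>2) (at 0)"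
    unfolding p_def by (auto intro!: derivative_eq_intros \<phi>_along[of v 0 ?w, simplified])
  moreover have "p s \<le> p 0" if "0 < s" "s \<le> 1" for s
  proof -
    have "\<phi> (s *\<^sub>R u + (1 - s) *\<^sub>R v) \<le> s * \<phi> u + (1 - s) * \<phi> v - \<sigma> * s * (1 - s) / 2 * (norm ?w)\<^sup>2"
      using sconv u v that unfolding strongly_convex_on_def by auto
    moreover have "s *\<^sub>R u + (1 - s) *\<^sub>R v = v + s *\<^sub>R ?w" by (simp add: algebra_simps)
    ultimately show ?thesis unfolding p_def by (simp add: algebra_simps)
  qed
  ultimately have "grad \<phi> v \<bullet> ?w - (\<phi> u - \<phi> v) + \<sigma> / 2 * (norm ?w)\<^sup>2 \<le> 0"
    by (rule derivative_nonpos_if_max_at_left_end)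
  then show ?thesis unfolding bregman_def by simp
qed

lemma bregman_nonneg:
  assumes "u \<in> X" "v \<in> X"
  shows "0 \<le> bregman \<phi> u v"
proof -
  have "0 \<le> \<sigma> / 2 * (norm (u - v))\<^sup>2" using \<sigma>_pos by simp
  with bregman_lower[OF assms] show ?thesis by linarith
qed

lemma grad_strongly_monotone:
  assumes "u \<in> X" "v \<in> X"
  shows "\<sigma> * (norm (u - v))\<^sup>2 \<le> (grad \<phi> u - grad \<phi> v) \<bullet> (u - v)"
proof -
  have "norm (v - u) = norm (u - v)" by (rule norm_minus_commute)
  then show ?thesis
    using bregman_lower[OF assms] bregman_lower[OF assms(2,1)]
    unfolding bregman_def by (simp add: inner_diff)
qed

text \<open>
  The variational inequality of minimizing \<open>\<langle>c, \<cdot>\<rangle> + \<phi>\<close> over \<open>X\<close>. The mirror step from \<open>y\<close> along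
  \<open>\<alpha> g\<close> is the case \<open>c = \<alpha> g - \<nabla>\<phi>(y)\<close>. With a single linear parameter the step becomes a Lipschitz
  function of \<open>c\<close>; this gives uniqueness, the bound on the displacement and measurability.
\<close>

definition prox :: "real ^ 'n \<Rightarrow> real ^ 'n \<Rightarrow> bool" where
  "prox c p \<longleftrightarrow> p \<in> X \<and> (\<forall>u\<in>X. 0 \<le> (c + grad \<phi> p) \<bullet> (u - p))"

lemma prox_of_argmin:
  assumes "is_arg_min (\<lambda>u. a * (g \<bullet> u) + bregman \<phi> u y) (\<lambda>u. u \<in> X) p"
  shows "prox (a *\<^sub>R g - grad \<phi> y) p"
proof -
  have p: "p \<in> X" and min: "\<And>u. u \<in> X \<Longrightarrow> a * (g \<bullet> p) + bregman \<phi> p y \<le> a * (g \<bullet> u) + bregman \<phi> u y"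
    using assms unfolding is_arg_min_def by (auto simp: not_less)
  have "0 \<le> (a *\<^sub>R g - grad \<phi> y + grad \<phi> p) \<bullet> (u - p)" if u: "u \<in> X" for u
  proof -
    define q where "q s = - (a * (g \<bullet> (p + s *\<^sub>R (u - p)))) - \<phi> (p + s *\<^sub>R (u - p)) + grad \<phi> y \<bullet> (p + s *\<^sub>R (u - p))" for s
    have "p \<in> U" using p XU by auto
    have "(q has_real_derivative - (a * (g \<bullet> (u - p))) - grad \<phi> p \<bullet> (u - p) + grad \<phi> y \<bullet> (u - p)) (at 0)"
      unfolding q_def inner_add_right inner_scaleR_right
      using \<phi>_along[of p 0 "u - p"] \<open>p \<in> U\<close> by (auto intro!: derivative_eq_intros)
    moreover have "q s \<le> q 0" if "0 < s" "s \<le> 1" for s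
      using min[OF segment_in[OF u p, of s]] that unfolding q_def bregman_def by (simp add: inner_diff)
    ultimately have "- (a * (g \<bullet> (u - p))) - grad \<phi> p \<bullet> (u - p) + grad \<phi> y \<bullet> (u - p) \<le> 0"
      by (rule derivative_nonpos_if_max_at_left_end)
    then show ?thesis by (simp add: inner_add_left inner_diff_left)
  qed
  with p show ?thesis unfolding prox_def by auto
qed

lemma prox_lipschitz:
  assumes "prox c p" "prox c' p'"
  shows "\<sigma> * norm (p - p') \<le> norm (c - c')"
proof -
  have X: "p \<in> X" "p' \<in> X" using assms unfolding prox_def by auto
  have "0 \<le> (c + grad \<phi> p) \<bullet> (p' - p)" "0 \<le> (c' + grad \<phi> p') \<bullet> (p - p')"
    using assms X unfolding prox_def by auto
  then have "(grad \<phi> p - grad \<phi> p') \<bullet> (p - p') \<le> - ((c - c') \<bullet> (p - p'))"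
    by (simp add: inner_diff inner_add_left algebra_simps)
  with grad_strongly_monotone[OF X] have "\<sigma> * (norm (p - p'))\<^sup>2 \<le> - ((c - c') \<bullet> (p - p'))" by linarith
  also have "\<dots> \<le> norm (c - c') * norm (p - p')"
    using Cauchy_Schwarz_ineq2[of "c - c'" "p - p'"] by linarith
  finally have "\<sigma> * norm (p - p') * norm (p - p') \<le> norm (c - c') * norm (p - p')"
    by (simp add: power2_eq_square mult.assoc)
  then show ?thesis by (cases "p = p'") auto
qed

text \<open>
  For \<open>y \<in> X\<close>, a minimizer of \<open>\<langle>c, \<cdot>\<rangle> + \<phi>\<close> is a mirror step from \<open>y\<close> along \<open>c + \<nabla>\<phi>(y)\<close> with stepsize one.
\<close>

lemma prox_exists: "\<exists>p. prox c p"
proof -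
  have "continuous_on X (\<lambda>u. c \<bullet> u + \<phi> u)" by (intro continuous_intros \<phi>_continuous)
  then obtain p where p: "p \<in> X" "\<And>u. u \<in> X \<Longrightarrow> c \<bullet> p + \<phi> p \<le> c \<bullet> u + \<phi> u"
    using continuous_attains_inf[OF X_compact X_ne] by blast
  obtain y where y: "y \<in> X" using X_ne by auto
  have "is_arg_min (\<lambda>u. 1 * ((c + grad \<phi> y) \<bullet> u) + bregman \<phi> u y) (\<lambda>u. u \<in> X) p"
    unfolding is_arg_min_def bregman_def using p by (auto simp: inner_diff inner_add_left not_less)
  from prox_of_argmin[OF this] show ?thesis by auto
qed

definition prox_map :: "real ^ 'n \<Rightarrow> real ^ 'n" where
  "prox_map c = (SOME p. prox c p)"

lemma prox_map: "prox c (prox_map c)"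
  unfolding prox_map_def using prox_exists by (rule someI_ex)

lemma prox_unique: "prox c p \<Longrightarrow> p = prox_map c"
  using prox_lipschitz[of c p c "prox_map c"] prox_map \<sigma>_pos
  by (auto simp: zero_less_mult_iff mult_le_0_iff)

lemma prox_map_continuous: "continuous_on UNIV prox_map"
proof -
  have "(1 / \<sigma>)-lipschitz_on UNIV prox_map"
  proof (rule lipschitz_onI)
    fix c c' :: "real ^ 'n"
    show "dist (prox_map c) (prox_map c') \<le> 1 / \<sigma> * dist c c'"
      using prox_lipschitz[OF prox_map prox_map, of c c'] \<sigma>_pos by (simp add: dist_norm field_simps)
  qed (use \<sigma>_pos in simp)
  then show ?thesis by (rule lipschitz_on_continuous_on)
qed

text \<open>
  The point \<open>y\<close> is itself the step for \<open>g = 0\<close>.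
\<close>

lemma mirror_step_displacement:
  assumes p: "prox (a *\<^sub>R g - grad \<phi> y) p" and y: "y \<in> X" and a: "0 \<le> a"
  shows "norm (p - y) \<le> a * norm g / \<sigma>"
proof -
  have "prox (- grad \<phi> y) y" using y unfolding prox_def by simp
  from prox_lipschitz[OF p this] show ?thesis using a \<sigma>_pos by (simp add: field_simps)
qed

text \<open>
  The variational inequality bounds \<open>\<langle>g, p - u\<rangle>\<close> by three divergences; the remaining \<open>\<langle>g, y - p\<rangle>\<close> is absorbed by \<open>D(p, y) \<ge> \<sigma>/2 |p - y|\<^sup>2\<close> and the arithmetic-geometric mean inequality.
\<close>

lemma mirror_step_progress:
  assumes p: "prox (a *\<^sub>R g - grad \<phi> y) p" and y: "y \<in> X" and u: "u \<in> X"
  shows "a * (g \<bullet> (y - u)) \<le> bregman \<phi> u y - bregman \<phi> u p + a\<^sup>2 * (norm g)\<^sup>2 / (2 * \<sigma>)"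
proof -
  have pX: "p \<in> X" and "0 \<le> (a *\<^sub>R g - grad \<phi> y + grad \<phi> p) \<bullet> (u - p)"
    using p u unfolding prox_def by auto
  then have 1: "a * (g \<bullet> (p - u)) \<le> bregman \<phi> u y - bregman \<phi> u p - bregman \<phi> p y"
    unfolding bregman_def by (simp add: inner_diff inner_add_left algebra_simps)
  let ?r = "norm (p - y)"
  have "g \<bullet> (y - p) \<le> norm g * ?r"
    using norm_cauchy_schwarz[of g "y - p"] by (simp add: norm_minus_commute)
  moreover have "- (g \<bullet> (y - p)) \<le> norm g * ?r"
    using norm_cauchy_schwarz[of "- g" "y - p"] by (simp add: norm_minus_commute)
  ultimately have "\<bar>a * (g \<bullet> (y - p))\<bar> \<le> \<bar>a\<bar> * (norm g * ?r)"
    unfolding abs_mult by (intro mult_left_mono) auto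
  moreover have "\<bar>a\<bar> * (norm g * ?r) \<le> \<sigma> / 2 * ?r\<^sup>2 + a\<^sup>2 * (norm g)\<^sup>2 / (2 * \<sigma>)"
  proof -
    have "0 \<le> (\<sigma> * ?r - \<bar>a\<bar> * norm g)\<^sup>2 / (2 * \<sigma>)" using \<sigma>_pos by simp
    also have "\<dots> = \<sigma> / 2 * ?r\<^sup>2 - \<bar>a\<bar> * (norm g * ?r) + a\<^sup>2 * (norm g)\<^sup>2 / (2 * \<sigma>)"
      using \<sigma>_pos by (simp add: power2_diff power_mult_distrib) (simp add: power2_eq_square field_simps)
    finally show ?thesis by simp
  qed
  moreover have "\<sigma> / 2 * ?r\<^sup>2 \<le> bregman \<phi> p y" by (rule bregman_lower[OF pX y])
  moreover have "g \<bullet> (y - u) = g \<bullet> (p - u) + g \<bullet> (y - p)" by (simp add: inner_diff)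
  ultimately show ?thesis using 1 by (simp add: distrib_left)
qed

section \<open>Convexity of the Bregman divergence in its second argument\<close>

lemma hess_form_deriv:
  assumes y: "y \<in> U"
  shows "((\<lambda>z. e \<bullet> (hess \<phi> z *v h)) has_derivative (\<lambda>k. e \<bullet> (hess_deriv \<phi> y k *v h))) (at y)"
proof -
  have "((\<lambda>z. hess \<phi> z *v h) has_derivative (\<lambda>k. hess_deriv \<phi> y k *v h)) (at y)"
    by (rule bounded_linear.has_derivative[OF bounded_linear_matrix_apply hess_has_deriv[OF y]])
  then show ?thesis by (rule has_derivative_inner_right)
qed

lemma hess_symmetric:
  assumes y: "y \<in> U"
  shows "v \<bullet> (hess \<phi> y *v w) = w \<bullet> (hess \<phi> y *v v)"
proof -
  have "((\<lambda>z. grad \<phi> z \<bullet> h) has_derivative (\<lambda>k. (hess \<phi> y *v k) \<bullet> h)) (at y)" for h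
    by (rule has_derivative_inner_left[OF grad_deriv[OF y]])
  from second_derivative_symmetric[OF U_open y \<phi>_deriv this this, of w v] show ?thesis
    by (simp add: inner_commute)
qed

lemma hess_deriv_symmetric:
  assumes y: "y \<in> U"
  shows "e \<bullet> (hess_deriv \<phi> y v *v w) = e \<bullet> (hess_deriv \<phi> y w *v v)"
proof -
  have "((\<lambda>z. e \<bullet> grad \<phi> z) has_derivative (\<lambda>h. e \<bullet> (hess \<phi> z *v h))) (at z)" if "z \<in> U" for z
    by (intro has_derivative_inner_right grad_deriv that)
  from second_derivative_symmetric[OF U_open y this hess_form_deriv[OF y] hess_form_deriv[OF y], of w v]
  show ?thesis by simp
qed

lemma hess_deriv_symmetric_form:
  assumes y: "y \<in> U"
  shows "e \<bullet> (hess_deriv \<phi> y v *v w) = w \<bullet> (hess_deriv \<phi> y v *v e)"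
proof -
  have "((\<lambda>z. e \<bullet> (hess \<phi> z *v w)) has_derivative (\<lambda>k. w \<bullet> (hess_deriv \<phi> y k *v e))) (at y)"
    by (rule has_derivative_transform_within_open[OF hess_form_deriv[OF y] U_open y hess_symmetric])
  from has_derivative_unique[OF hess_form_deriv[OF y] this] show ?thesis by meson
qed

text \<open>
  Along a segment with direction \<open>w\<close>, the second derivative of \<open>D(u, \<cdot>)\<close> at \<open>y\<close> is
  \<open>\<langle>w, H(y) w\<rangle> + \<langle>y - u, \<nabla>H(y)(w) w\<rangle>\<close>. As the third derivative is symmetric in all its arguments, this
  equals \<open>\<langle>w, (H(y) + \<nabla>H(y)(y - u)) w\<rangle>\<close>.
\<close>

lemma bregman_convex:
  assumes psd: "\<And>u v. u \<in> X \<Longrightarrow> v \<in> X \<Longrightarrow> psd (hess \<phi> v + hess_deriv \<phi> v (v - u))"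
    and u: "u \<in> X"
  shows "convex_on X (bregman \<phi> u)"
proof (rule convex_onI[OF _ X_convex])
  fix t :: real and a b
  assume t: "0 < t" "t < 1" and a: "a \<in> X" and b: "b \<in> X"
  let ?w = "b - a"
  let ?z = "\<lambda>s::real. a + s *\<^sub>R ?w"
  define F where "F s = bregman \<phi> u (?z s)" for s
  define F' where "F' s = - ((hess \<phi> (?z s) *v ?w) \<bullet> (u - ?z s))" for s
  define F'' where "F'' s = - ((hess_deriv \<phi> (?z s) ?w *v ?w) \<bullet> (u - ?z s)) + (hess \<phi> (?z s) *v ?w) \<bullet> ?w" for s
  have inX: "?z s \<in> X" if "s \<in> {0..1}" for s using segment_in[OF b a, of s] that by auto
  then have inU: "?z s \<in> U" if "s \<in> {0..1}" for s using that XU by auto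
  have z': "((\<lambda>s. u - ?z s) has_vector_derivative - ?w) (at s)" for s
    by (auto intro!: derivative_eq_intros)
  have "convex_on {0..1} F"
  proof (rule f''_ge0_imp_convex)
    fix s :: real assume s: "s \<in> {0..1}"
    have "((\<lambda>s. grad \<phi> (?z s) \<bullet> (u - ?z s)) has_real_derivative
        - (grad \<phi> (?z s) \<bullet> ?w) + (hess \<phi> (?z s) *v ?w) \<bullet> (u - ?z s)) (at s)"
      using bounded_bilinear.has_vector_derivative[OF bounded_bilinear_inner grad_along[OF inU[OF s]] z']
      unfolding has_real_derivative_iff_has_vector_derivative by (simp only: inner_minus_right)
    then show "(F has_real_derivative F' s) (at s)"
      unfolding F_def F'_def bregman_def
      by (auto intro!: derivative_eq_intros \<phi>_along[OF inU[OF s]])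
    have "((\<lambda>s. hess \<phi> (?z s) *v ?w) has_vector_derivative hess_deriv \<phi> (?z s) ?w *v ?w) (at s)"
      by (rule bounded_linear.has_vector_derivative[OF bounded_linear_matrix_apply hess_along[OF inU[OF s]]])
    from bounded_bilinear.has_vector_derivative[OF bounded_bilinear_inner this z']
    have "((\<lambda>s. (hess \<phi> (?z s) *v ?w) \<bullet> (u - ?z s)) has_real_derivative
        - ((hess \<phi> (?z s) *v ?w) \<bullet> ?w) + (hess_deriv \<phi> (?z s) ?w *v ?w) \<bullet> (u - ?z s)) (at s)"
      unfolding has_real_derivative_iff_has_vector_derivative by (simp only: inner_minus_right)
    then show "(F' has_real_derivative F'' s) (at s)"
      unfolding F'_def F''_def by (auto intro!: derivative_eq_intros)
    show "0 \<le> F'' s"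
    proof -
      let ?y = "?z s" and ?K = "hess_deriv \<phi> (?z s)"
      have "0 \<le> ?w \<bullet> ((hess \<phi> ?y + ?K (?y - u)) *v ?w)"
        using psd[OF u inX[OF s]] unfolding psd_def by blast
      also have "\<dots> = ?w \<bullet> (hess \<phi> ?y *v ?w) + ?w \<bullet> (?K (?y - u) *v ?w)"
        by (simp add: matrix_vector_mult_add_rdistrib inner_add_right)
      also have "?w \<bullet> (?K (?y - u) *v ?w) = (?y - u) \<bullet> (?K ?w *v ?w)"
        using hess_deriv_symmetric[OF inU[OF s], of ?w "?y - u" ?w]
          hess_deriv_symmetric_form[OF inU[OF s], of ?w ?w "?y - u"] by simp
      finally show ?thesis
        unfolding F''_def by (simp add: inner_commute inner_diff_left inner_diff_right algebra_simps)
    qed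
  qed auto
  from convex_onD[OF this, of t 0 1] t have "F t \<le> (1 - t) * F 0 + t * F 1" by simp
  moreover have "?z t = (1 - t) *\<^sub>R a + t *\<^sub>R b" by (simp add: algebra_simps)
  ultimately show "bregman \<phi> u ((1 - t) *\<^sub>R a + t *\<^sub>R b) \<le> (1 - t) * bregman \<phi> u a + t * bregman \<phi> u b"
    unfolding F_def by simp
qed

end

section \<open>Gaussian smoothing\<close>

definition gauss_density :: "real ^ 'n::finite \<Rightarrow> real" where
  "gauss_density z = (\<Prod>k\<in>UNIV. std_normal_density (z $ k))"

definition gauss :: "(real ^ 'n::finite) measure" where
  "gauss = density lborel (\<lambda>z. ennreal (gauss_density z))"

lemma gauss_density_measurable [measurable]: "gauss_density \<in> borel_measurable borel"
  unfolding gauss_density_def by measurable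

lemma gauss_density_pos: "0 < gauss_density z"
  unfolding gauss_density_def by (intro prod_pos) (auto simp: normal_density_pos)

lemma gauss_density_nonneg [simp]: "0 \<le> gauss_density z"
  using gauss_density_pos[of z] by simp

lemma sets_gauss [simp, measurable_cong]: "sets gauss = sets borel"
  unfolding gauss_def by simp

lemma space_gauss [simp]: "space gauss = UNIV"
  unfolding gauss_def by simp

lemma prod_Basis_axis:
  "(\<Prod>b\<in>(Basis :: (real ^ 'n::finite) set). F b) = (\<Prod>k\<in>UNIV. F (axis k 1))"
proof -
  have "(Basis :: (real ^ 'n) set) = range (\<lambda>k. axis k 1)" by (auto simp: Basis_vec_def)
  moreover have "inj (\<lambda>k :: 'n. axis k (1::real))" by (auto intro!: injI simp: axis_eq_axis)
  ultimately show ?thesis using prod.reindex[of "\<lambda>k :: 'n. axis k (1::real)" UNIV F] by (simp only: o_def)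
qed

text \<open>
  Fubini's theorem for a product in which the factor at \<open>k\<close> carries the event and all others integrate to one. Moments of the coordinates then come from dimension one.
\<close>

lemma gauss_coordinate:
  fixes k :: "'n::finite"
  shows "distr gauss borel (\<lambda>z :: real ^ 'n. z $ k) = density lborel std_normal_density"
proof (rule measure_eqI)
  fix A :: "real set" assume "A \<in> sets (distr gauss borel (\<lambda>z :: real ^ 'n. z $ k))"
  then have A [measurable]: "A \<in> sets borel" by simp
  define F where "F b x = ennreal (std_normal_density x) * (if b = axis k 1 then indicator A x else 1)"
    for b :: "real ^ 'n" and x
  have [measurable]: "F b \<in> borel_measurable borel" for b unfolding F_def by measurable
  have one: "(\<integral>\<^sup>+x. ennreal (std_normal_density x) \<partial>lborel) = 1"
    by (subst nn_integral_eq_integral) (auto intro: integrable_std_normal_moment[of 0, simplified])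
  have "emeasure (distr gauss borel (\<lambda>z :: real ^ 'n. z $ k)) A
      = (\<integral>\<^sup>+z. indicator A (z $ k) \<partial>(gauss :: (real ^ 'n) measure))"
    using nn_integral_distr[of "\<lambda>z. z $ k" "gauss :: (real ^ 'n) measure" borel "indicator A"] by simp
  also have "\<dots> = (\<integral>\<^sup>+z. ennreal (gauss_density z) * indicator A (z $ k) \<partial>(lborel :: (real ^ 'n) measure))"
    unfolding gauss_def by (subst nn_integral_density) auto
  also have "\<dots> = (\<integral>\<^sup>+z. (\<Prod>b\<in>Basis. F b (z \<bullet> b)) \<partial>(lborel :: (real ^ 'n) measure))"
  proof (intro nn_integral_cong)
    fix z :: "real ^ 'n"
    have "(\<Prod>b\<in>Basis. F b (z \<bullet> b)) = (\<Prod>j\<in>UNIV. ennreal (std_normal_density (z $ j)) * (if j = k then indicator A (z $ j) else 1))"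
      unfolding prod_Basis_axis F_def by (intro prod.cong refl) (auto simp: inner_axis axis_eq_axis)
    also have "\<dots> = ennreal (gauss_density z) * indicator A (z $ k)"
      unfolding prod.distrib gauss_density_def by (simp add: prod_ennreal prod.delta)
    finally show "ennreal (gauss_density z) * indicator A (z $ k) = (\<Prod>b\<in>Basis. F b (z \<bullet> b))" by simp
  qed
  also have "\<dots> = (\<Prod>b\<in>Basis. (\<integral>\<^sup>+x. F b x \<partial>lborel))"
    by (rule nn_integral_lborel_prod) auto
  also have "\<dots> = (\<Prod>j\<in>UNIV. if j = k then (\<integral>\<^sup>+x. ennreal (std_normal_density x) * indicator A x \<partial>lborel) else 1)"
    unfolding prod_Basis_axis F_def by (intro prod.cong refl) (auto simp: axis_eq_axis one)
  also have "\<dots> = emeasure (density lborel std_normal_density) A"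
    by (simp add: emeasure_density prod.delta)
  finally show "emeasure (distr gauss borel (\<lambda>z :: real ^ 'n. z $ k)) A = emeasure (density lborel std_normal_density) A" .
qed simp

lemma prob_space_gauss: "prob_space (gauss :: (real ^ 'n::finite) measure)"
proof
  have "emeasure (gauss :: (real ^ 'n) measure) (space gauss)
      = emeasure (distr (gauss :: (real ^ 'n) measure) borel (\<lambda>z. z $ undefined)) UNIV"
    by (subst emeasure_distr) auto
  also have "\<dots> = 1"
    unfolding gauss_coordinate using prob_space.emeasure_space_1[OF prob_space_normal_density[of 1 0]] by simp
  finally show "emeasure (gauss :: (real ^ 'n) measure) (space gauss) = 1" .
qed

interpretation gauss: prob_space gauss by (rule prob_space_gauss)

lemma gauss_even_moment:
  shows "integrable gauss (\<lambda>z. (z $ k) ^ (2 * m))"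
    and "(\<integral>z. (z $ k) ^ (2 * m) \<partial>gauss) = fact (2 * m) / (2 ^ m * fact m)"
proof -
  have d: "has_bochner_integral (density lborel std_normal_density) (\<lambda>x. x ^ (2 * m)) (fact (2 * m) / (2 ^ m * fact m))"
    using std_normal_moment_even[of m]
    by (intro has_bochner_integral_density) (auto simp: has_bochner_integral_iff)
  then have "has_bochner_integral (distr gauss borel (\<lambda>z. z $ k)) (\<lambda>x. x ^ (2 * m)) (fact (2 * m) / (2 ^ m * fact m))"
    unfolding gauss_coordinate .
  then have "integrable (distr gauss borel (\<lambda>z. z $ k)) (\<lambda>x. x ^ (2 * m))"
     "(\<integral>x. x ^ (2 * m) \<partial>distr gauss borel (\<lambda>z. z $ k)) = fact (2 * m) / (2 ^ m * fact m)"
    by (auto simp: has_bochner_integral_iff)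
  then show "integrable gauss (\<lambda>z. (z $ k) ^ (2 * m))"
    "(\<integral>z. (z $ k) ^ (2 * m) \<partial>gauss) = fact (2 * m) / (2 ^ m * fact m)"
    by (auto simp: integrable_distr_eq integral_distr)
qed

lemma norm_sq_vec: "(norm (z :: real ^ 'n::finite))\<^sup>2 = (\<Sum>k\<in>UNIV. (z $ k)\<^sup>2)"
  unfolding norm_vec_def L2_set_def by (simp add: sum_nonneg)

lemma norm_pow4_vec_le: "(norm (z :: real ^ 'n::finite)) ^ 4 \<le> real CARD('n) * (\<Sum>k\<in>UNIV. (z $ k) ^ 4)"
proof -
  have "(norm z) ^ 4 = ((norm z)\<^sup>2)\<^sup>2" by simp
  also have "\<dots> \<le> real CARD('n) * (\<Sum>k\<in>UNIV. ((z $ k)\<^sup>2)\<^sup>2)"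
    unfolding norm_sq_vec using sum_squared_le_sum_of_squares[of "\<lambda>k. (z $ k)\<^sup>2" UNIV] by (simp add: mult.commute)
  finally show ?thesis by simp
qed

lemma gauss_norm_sq:
  shows "integrable gauss (\<lambda>z :: real ^ 'n::finite. (norm z)\<^sup>2)"
    and "(\<integral>z. (norm z)\<^sup>2 \<partial>(gauss :: (real ^ 'n) measure)) = real CARD('n)"
  unfolding norm_sq_vec using gauss_even_moment[where m = 1 and 'a = 'n] by (auto simp: fact_numeral)

lemma gauss_norm_pow4:
  shows "integrable gauss (\<lambda>z :: real ^ 'n::finite. (norm z) ^ 4)"
    and "(\<integral>z. (norm z) ^ 4 \<partial>(gauss :: (real ^ 'n) measure)) \<le> 3 * (real CARD('n))\<^sup>2"
proof -
  have m: "integrable gauss (\<lambda>z :: real ^ 'n. (z $ k) ^ 4)" "(\<integral>z. (z $ k) ^ 4 \<partial>(gauss :: (real ^ 'n) measure)) = 3" for k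
    using gauss_even_moment[where m = 2 and k = k] by (auto simp: fact_numeral)
  have i: "integrable gauss (\<lambda>z :: real ^ 'n. real CARD('n) * (\<Sum>k\<in>UNIV. (z $ k) ^ 4))"
    by (auto intro: m)
  show *: "integrable gauss (\<lambda>z :: real ^ 'n::finite. (norm z) ^ 4)"
    by (rule Bochner_Integration.integrable_bound[OF i]) (auto intro!: AE_I2 order_trans[OF norm_pow4_vec_le])
  have "(\<integral>z. (norm z) ^ 4 \<partial>(gauss :: (real ^ 'n) measure)) \<le> (\<integral>z. real CARD('n) * (\<Sum>k\<in>UNIV. (z $ k) ^ 4) \<partial>(gauss :: (real ^ 'n) measure))"
    by (intro integral_mono * i norm_pow4_vec_le)
  also have "\<dots> = 3 * (real CARD('n))\<^sup>2"
    by (simp add: m power2_eq_square Bochner_Integration.integral_sum)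
  finally show "(\<integral>z. (norm z) ^ 4 \<partial>(gauss :: (real ^ 'n) measure)) \<le> 3 * (real CARD('n))\<^sup>2" .
qed

lemma gauss_integrable_quadratic_growth:
  fixes g :: "real ^ 'n::finite \<Rightarrow> real"
  assumes [measurable]: "g \<in> borel_measurable borel" and "\<And>z. \<bar>g z\<bar> \<le> a + b * norm z + c * (norm z)\<^sup>2"
    and "0 \<le> b"
  shows "integrable gauss g"
proof (rule Bochner_Integration.integrable_bound)
  show "integrable gauss (\<lambda>z :: real ^ 'n. (a + b) + (b + c) * (norm z)\<^sup>2)"
    using gauss_norm_sq(1) by auto
  have "\<bar>g z\<bar> \<le> (a + b) + (b + c) * (norm z)\<^sup>2" for z
  proof -
    have "0 \<le> (norm z - 1 / 2)\<^sup>2" by simp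
    then have "norm z \<le> 1 + (norm z)\<^sup>2" by (simp add: power2_diff power_divide)
    from mult_left_mono[OF this \<open>0 \<le> b\<close>] show ?thesis using assms(2)[of z] by (simp add: algebra_simps)
  qed
  then show "AE z in gauss. norm (g z) \<le> norm ((a + b) + (b + c) * (norm z)\<^sup>2)"
    unfolding real_norm_def by (intro AE_I2 order_trans[OF _ abs_ge_self])
qed simp

text \<open>
  Linearize the square root at \<open>n\<close>: \<open>|z| \<le> |z|\<^sup>2 / (2 sqrt n) + sqrt n / 2\<close>, and the second moment of \<open>|z|\<close> is \<open>n\<close>.
\<close>

lemma gauss_norm_expectation:
  shows "integrable gauss (\<lambda>z :: real ^ 'n::finite. norm z)"
    and "(\<integral>z. norm z \<partial>(gauss :: (real ^ 'n) measure)) \<le> sqrt (real CARD('n))"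
proof -
  let ?r = "sqrt (real CARD('n))"
  have r: "0 < ?r" by simp
  show i: "integrable gauss (\<lambda>z :: real ^ 'n. norm z)"
    by (rule gauss_integrable_quadratic_growth[where a = 0 and b = 1 and c = 0]) auto
  have "norm z \<le> (norm z)\<^sup>2 / (2 * ?r) + ?r / 2" for z :: "real ^ 'n"
  proof -
    have "0 \<le> (norm z - ?r)\<^sup>2 / (2 * ?r)" using r by (intro divide_nonneg_pos) auto
    also have "\<dots> = (norm z)\<^sup>2 / (2 * ?r) + ?r / 2 - norm z"
      using r by (simp add: power2_diff add_divide_distrib diff_divide_distrib) (simp add: real_div_sqrt)
    finally show ?thesis by simp
  qed
  then have "(\<integral>z. norm z \<partial>(gauss :: (real ^ 'n) measure)) \<le> (\<integral>z. (norm z)\<^sup>2 / (2 * ?r) + ?r / 2 \<partial>(gauss :: (real ^ 'n) measure))"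
    using gauss_norm_sq(1)[where 'n = 'n] by (intro integral_mono i) auto
  also have "\<dots> = real CARD('n) / (2 * ?r) + ?r / 2"
    using gauss_norm_sq[where 'n = 'n] by (simp add: gauss.prob_space[simplified])
  also have "\<dots> = (real CARD('n) / ?r) / 2 + ?r / 2" by simp
  also have "\<dots> = ?r" by (subst real_div_sqrt) auto
  finally show "(\<integral>z. norm z \<partial>(gauss :: (real ^ 'n) measure)) \<le> ?r" .
qed

lemma gauss_integral_lborel:
  fixes g :: "real ^ 'n::finite \<Rightarrow> real"
  assumes [measurable]: "g \<in> borel_measurable borel"
  shows "(\<integral>z. g z \<partial>gauss) = (\<integral>z. gauss_density z * g z \<partial>lborel)"
    and "integrable gauss g \<longleftrightarrow> integrable lborel (\<lambda>z. gauss_density z * g z)"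
  unfolding gauss_def by (simp_all add: integral_density integrable_density)

lemma gauss_symmetric:
  fixes g :: "real ^ 'n::finite \<Rightarrow> real"
  assumes [measurable]: "g \<in> borel_measurable borel"
  shows "(\<integral>z. g (- z) \<partial>gauss) = (\<integral>z. g z \<partial>gauss)"
proof -
  have "(lborel :: (real ^ 'n) measure) = distr lborel borel uminus"
    by (subst lborel_affine[of "-1" 0]) (auto simp: density_1)
  then have "(\<integral>z. gauss_density z * g z \<partial>lborel) = (\<integral>z. gauss_density z * g z \<partial>distr lborel borel uminus)"
    by simp
  also have "\<dots> = (\<integral>z. gauss_density (- z) * g (- z) \<partial>lborel)"
    by (rule integral_distr) auto
  also have "\<dots> = (\<integral>z. gauss_density z * g (- z) \<partial>lborel)"
    by (simp add: gauss_density_def normal_density_def)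
  finally show ?thesis by (simp add: gauss_integral_lborel)
qed

lemma gauss_density_shift:
  "gauss_density (z + v) = gauss_density z * exp (- (z \<bullet> v) - (norm v)\<^sup>2 / 2)"
proof -
  have "gauss_density (z + v) = (\<Prod>k\<in>UNIV. std_normal_density (z $ k) * exp (- (z $ k * v $ k) - (v $ k)\<^sup>2 / 2))"
    unfolding gauss_density_def
    by (intro prod.cong refl) (simp add: normal_density_def exp_add[symmetric] power2_eq_square field_simps)
  also have "\<dots> = gauss_density z * exp (\<Sum>k\<in>UNIV. - (z $ k * v $ k) - (v $ k)\<^sup>2 / 2)"
    unfolding gauss_density_def by (simp add: prod.distrib exp_sum)
  also have "(\<Sum>k\<in>UNIV. - (z $ k * v $ k) - (v $ k)\<^sup>2 / 2) = - (z \<bullet> v) - (norm v)\<^sup>2 / 2"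
    unfolding norm_sq_vec inner_vec_def by (simp add: sum_subtractf sum_negf sum_divide_distrib)
  finally show ?thesis .
qed

lemma gauss_shift:
  fixes g :: "real ^ 'n::finite \<Rightarrow> real"
  assumes [measurable]: "g \<in> borel_measurable borel"
  shows "(\<integral>z. g (z - v) \<partial>gauss) = (\<integral>z. g z * exp (- (z \<bullet> v) - (norm v)\<^sup>2 / 2) \<partial>gauss)"
    and "integrable gauss (\<lambda>z. g (z - v)) \<longleftrightarrow> integrable gauss (\<lambda>z. g z * exp (- (z \<bullet> v) - (norm v)\<^sup>2 / 2))"
proof -
  let ?F = "\<lambda>z. gauss_density z * g (z - v)"
  have d: "(lborel :: (real ^ 'n) measure) = distr lborel borel ((+) v)" by (rule lborel_distr_plus[symmetric])
  have F: "?F (v + z) = gauss_density z * (g z * exp (- (z \<bullet> v) - (norm v)\<^sup>2 / 2))" for z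
    using gauss_density_shift[of z v] by (simp add: add.commute)
  have "(\<integral>z. ?F z \<partial>lborel) = (\<integral>z. ?F (v + z) \<partial>lborel)"
    by (subst d, subst integral_distr) auto
  then show "(\<integral>z. g (z - v) \<partial>gauss) = (\<integral>z. g z * exp (- (z \<bullet> v) - (norm v)\<^sup>2 / 2) \<partial>gauss)"
    unfolding F by (simp add: gauss_integral_lborel)
  have "integrable lborel ?F \<longleftrightarrow> integrable lborel (\<lambda>z. ?F (v + z))"
    by (subst d, subst integrable_distr_eq) auto
  then show "integrable gauss (\<lambda>z. g (z - v)) \<longleftrightarrow> integrable gauss (\<lambda>z. g z * exp (- (z \<bullet> v) - (norm v)\<^sup>2 / 2))"
    unfolding F by (simp add: gauss_integral_lborel)
qed

lemma gauss_linear: "integrable gauss (\<lambda>z. z \<bullet> w)" "(\<integral>z. z \<bullet> w \<partial>gauss) = 0"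
proof -
  show "integrable gauss (\<lambda>z. z \<bullet> w)"
    by (rule gauss_integrable_quadratic_growth[where a = 0 and b = "norm w" and c = 0])
      (auto simp: mult.commute[of "norm w"] Cauchy_Schwarz_ineq2)
  show "(\<integral>z. z \<bullet> w \<partial>gauss) = 0"
    using gauss_symmetric[of "\<lambda>z. z \<bullet> w"] by simp
qed

lemma lipschitz_bound:
  fixes h :: "real ^ 'n::finite \<Rightarrow> real"
  assumes "L-lipschitz_on UNIV h"
  shows "\<bar>h z - h v\<bar> \<le> L * norm (z - v)"
  using lipschitz_onD[OF assms, of z v] by (simp add: dist_norm)

lemma lipschitz_measurable:
  fixes h :: "real ^ 'n::finite \<Rightarrow> real"
  assumes "L-lipschitz_on UNIV h"
  shows "h \<in> borel_measurable borel"
  using lipschitz_on_continuous_on[OF assms] by (rule borel_measurable_continuous_onI)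

lemma lipschitz_gauss_integrable:
  fixes h :: "real ^ 'n::finite \<Rightarrow> real"
  assumes h: "L-lipschitz_on UNIV h"
  shows "integrable gauss (\<lambda>z. h (z - v))" and "integrable gauss (\<lambda>z. h z * (z \<bullet> w))"
proof -
  note [measurable] = lipschitz_measurable[OF h]
  have L: "0 \<le> L" using h by (rule lipschitz_on_nonneg)
  have bound1: "\<bar>h (z - v)\<bar> \<le> (\<bar>h 0\<bar> + L * norm v) + L * norm z + 0 * (norm z)\<^sup>2" for z
  proof -
    have "\<bar>h (z - v)\<bar> \<le> \<bar>h 0\<bar> + L * norm (z - v)" using lipschitz_bound[OF h, of "z - v" 0] by simp
    also have "L * norm (z - v) \<le> L * (norm z + norm v)" by (intro mult_left_mono norm_triangle_ineq4 L)
    finally show ?thesis by (simp add: algebra_simps)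
  qed
  show "integrable gauss (\<lambda>z. h (z - v))"
    by (rule gauss_integrable_quadratic_growth[OF _ bound1 L]) measurable
  have bound2: "\<bar>h z * (z \<bullet> w)\<bar> \<le> 0 + (\<bar>h 0\<bar> * norm w) * norm z + (L * norm w) * (norm z)\<^sup>2" for z
  proof -
    have "\<bar>h z\<bar> \<le> \<bar>h 0\<bar> + L * norm z" using lipschitz_bound[OF h, of z 0] by simp
    then have "\<bar>h z\<bar> * \<bar>z \<bullet> w\<bar> \<le> (\<bar>h 0\<bar> + L * norm z) * (norm z * norm w)"
      using L by (intro mult_mono Cauchy_Schwarz_ineq2) auto
    then show ?thesis by (simp add: abs_mult algebra_simps power2_eq_square)
  qed
  show "integrable gauss (\<lambda>z. h z * (z \<bullet> w))"
    by (rule gauss_integrable_quadratic_growth[OF _ bound2]) auto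
qed

text \<open>
  Integration by parts for a nonsmooth integrand, as an inequality. Convexity bounds the difference
  for the full shift \<open>w\<close> by \<open>1/s\<close> times the difference for the shift \<open>s w\<close>. The small shift
  changes the density by the factor \<open>exp (- t)\<close> with \<open>t = s \<langle>z, w\<rangle> + s\<^sup>2 |w|\<^sup>2 / 2\<close>; since \<open>h\<close> is
  nonnegative, \<open>1 - exp (- t) \<le> t\<close> can be integrated against \<open>h\<close>.
  Finally \<open>s\<close> tends to zero.
\<close>

lemma gauss_gradient_inequality_nonneg:
  fixes h :: "real ^ 'n::finite \<Rightarrow> real"
  assumes cvx: "convex_on UNIV h" and h: "L-lipschitz_on UNIV h" and nonneg: "\<And>z. 0 \<le> h z"
  shows "(\<integral>z. h z \<partial>gauss) - (\<integral>z. h (z - w) \<partial>gauss) \<le> (\<integral>z. h z * (z \<bullet> w) \<partial>gauss)"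
proof -
  note [measurable] = lipschitz_measurable[OF h]
  note int = lipschitz_gauss_integrable[OF h]
  have int0: "integrable gauss h" using int(1)[of 0] by simp
  let ?R = "(\<integral>z. h z \<partial>gauss) - (\<integral>z. h (z - w) \<partial>gauss)"
  let ?A = "\<integral>z. h z * (z \<bullet> w) \<partial>gauss" and ?c = "(norm w)\<^sup>2 / 2 * (\<integral>z. h z \<partial>gauss)"
  have "?R \<le> ?A + s * ?c" if s: "0 < s" "s \<le> 1" for s
  proof -
    have "h (z - s *\<^sub>R w) \<le> (1 - s) * h z + s * h (z - w)" for z
      using convex_onD[OF cvx, of s z "z - w"] s by (simp add: algebra_simps)
    then have "(\<integral>z. h (z - s *\<^sub>R w) \<partial>gauss) \<le> (\<integral>z. (1 - s) * h z + s * h (z - w) \<partial>gauss)"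
      by (intro integral_mono int Bochner_Integration.integrable_add integrable_mult_right int0)
    then have "s * ?R \<le> (\<integral>z. h z \<partial>gauss) - (\<integral>z. h (z - s *\<^sub>R w) \<partial>gauss)"
      by (simp add: int int0 algebra_simps)
    also have "\<dots> = (\<integral>z. h z - h z * exp (- (z \<bullet> (s *\<^sub>R w)) - (norm (s *\<^sub>R w))\<^sup>2 / 2) \<partial>gauss)"
      using int(1)[of "s *\<^sub>R w"] gauss_shift[of h "s *\<^sub>R w"] by (simp add: int0)
    also have "\<dots> \<le> (\<integral>z. s * (h z * (z \<bullet> w)) + s\<^sup>2 * ((norm w)\<^sup>2 / 2 * h z) \<partial>gauss)"
    proof (intro integral_mono)
      show "integrable gauss (\<lambda>z. h z - h z * exp (- (z \<bullet> (s *\<^sub>R w)) - (norm (s *\<^sub>R w))\<^sup>2 / 2))"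
        using int(1)[of "s *\<^sub>R w"] gauss_shift(2)[of h "s *\<^sub>R w"] by (simp add: int0)
      show "integrable gauss (\<lambda>z. s * (h z * (z \<bullet> w)) + s\<^sup>2 * ((norm w)\<^sup>2 / 2 * h z))"
        by (intro Bochner_Integration.integrable_add integrable_mult_right int int0)
      fix z
      let ?t = "s * (z \<bullet> w) + s\<^sup>2 * ((norm w)\<^sup>2 / 2)"
      have e: "- (z \<bullet> (s *\<^sub>R w)) - (norm (s *\<^sub>R w))\<^sup>2 / 2 = - ?t" by (simp add: power_mult_distrib)
      have "1 - exp (- ?t) \<le> ?t" using exp_ge_add_one_self[of "- ?t"] by linarith
      from mult_left_mono[OF this nonneg[of z]]
      show "h z - h z * exp (- (z \<bullet> (s *\<^sub>R w)) - (norm (s *\<^sub>R w))\<^sup>2 / 2)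
          \<le> s * (h z * (z \<bullet> w)) + s\<^sup>2 * ((norm w)\<^sup>2 / 2 * h z)"
        unfolding e by (simp add: algebra_simps)
    qed
    also have "\<dots> = s * (?A + s * ?c)"
      by (simp add: int int0 algebra_simps power2_eq_square)
    finally show ?thesis using s by simp
  qed
  then have ev: "\<forall>\<^sub>F s in at_right 0. ?R \<le> ?A + s * ?c"
    unfolding eventually_at_right_field by (intro exI[of _ 1]) auto
  have "((\<lambda>s. ?A + s * ?c) \<longlongrightarrow> ?A + 0 * ?c) (at_right 0)" by (intro tendsto_intros)
  then show ?thesis using tendsto_lowerbound[OF _ ev, of "?A"] by simp
qed

text \<open>
  Truncate \<open>h\<close> from below at \<open>- K\<close> and add \<open>K\<close>; the added constant contributes nothing on either side, and the truncations converge to \<open>h\<close> with dominating function \<open>|h|\<close>.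
\<close>

lemma gauss_gradient_inequality:
  fixes h :: "real ^ 'n::finite \<Rightarrow> real"
  assumes cvx: "convex_on UNIV h" and h: "L-lipschitz_on UNIV h"
  shows "(\<integral>z. h z \<partial>gauss) - (\<integral>z. h (z - w) \<partial>gauss) \<le> (\<integral>z. h z * (z \<bullet> w) \<partial>gauss)"
proof -
  note [measurable] = lipschitz_measurable[OF h]
  note int = lipschitz_gauss_integrable[OF h]
  define m where "m K z = max (h z) (- real K)" for K z
  have m_meas [measurable]: "m K \<in> borel_measurable borel" for K unfolding m_def by measurable
  have L: "0 \<le> L" using h by (rule lipschitz_on_nonneg)
  have m_lip: "L-lipschitz_on UNIV (\<lambda>z. m K z + real K)" for K
  proof (rule lipschitz_onI[OF _ L])
    fix a b
    have "\<bar>m K a - m K b\<bar> \<le> \<bar>h a - h b\<bar>" unfolding m_def by (auto simp: max_def)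
    also have "\<dots> \<le> L * norm (a - b)" by (rule lipschitz_bound[OF h])
    finally show "dist (m K a + real K) (m K b + real K) \<le> L * dist a b" by (simp add: dist_norm)
  qed
  have m_lip0: "L-lipschitz_on UNIV (m K)" for K
    using m_lip[of K] unfolding lipschitz_on_def by (simp add: dist_norm)
  note m_int = lipschitz_gauss_integrable[OF m_lip0]
  have m_int0: "integrable gauss (m K)" for K using m_int(1)[of K 0] by simp
  have m_cvx: "convex_on UNIV (\<lambda>z. m K z + real K)" for K
  proof (rule convex_onI)
    fix t :: real and a b :: "real ^ 'n" assume t: "0 < t" "t < 1"
    have "h ((1 - t) *\<^sub>R a + t *\<^sub>R b) \<le> (1 - t) * h a + t * h b"
      using convex_onD[OF cvx, of t a b] t by simp
    also have "\<dots> \<le> (1 - t) * m K a + t * m K b"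
      using t unfolding m_def by (intro add_mono mult_left_mono) auto
    finally have 1: "h ((1 - t) *\<^sub>R a + t *\<^sub>R b) \<le> (1 - t) * m K a + t * m K b" .
    have "(1 - t) * (- real K) + t * (- real K) \<le> (1 - t) * m K a + t * m K b"
      using t unfolding m_def by (intro add_mono mult_left_mono) auto
    then have "- real K \<le> (1 - t) * m K a + t * m K b" by (simp add: algebra_simps)
    with 1 have "m K ((1 - t) *\<^sub>R a + t *\<^sub>R b) \<le> (1 - t) * m K a + t * m K b"
      unfolding m_def[of K "(1 - t) *\<^sub>R a + t *\<^sub>R b"] by simp
    then show "m K ((1 - t) *\<^sub>R a + t *\<^sub>R b) + real K \<le> (1 - t) * (m K a + real K) + t * (m K b + real K)"
      by (simp add: algebra_simps)
  qed simp
  have ineq: "(\<integral>z. m K z \<partial>gauss) - (\<integral>z. m K (z - w) \<partial>gauss) \<le> (\<integral>z. m K z * (z \<bullet> w) \<partial>gauss)" for K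
  proof -
    have "0 \<le> m K z + real K" for z unfolding m_def by simp
    from gauss_gradient_inequality_nonneg[OF m_cvx m_lip this, of w]
    show ?thesis
      by (simp add: m_int m_int0 gauss_linear distrib_right)
  qed
  have lim: "(\<lambda>K. m K z) \<longlonglongrightarrow> h z" for z
  proof (rule tendsto_eventually)
    obtain K0 :: nat where "- h z \<le> real K0" using real_arch_simple by blast
    then have "m K z = h z" if "K0 \<le> K" for K using that unfolding m_def by simp
    then show "\<forall>\<^sub>F K in sequentially. m K z = h z" using eventually_sequentially by blast
  qed
  have m_le: "\<bar>m K z\<bar> \<le> \<bar>h z\<bar>" for K z unfolding m_def by (auto simp: max_def)
  have "(\<lambda>K. \<integral>z. m K (z - v) \<partial>gauss) \<longlonglongrightarrow> (\<integral>z. h (z - v) \<partial>gauss)" for v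
    by (rule integral_dominated_convergence[where w = "\<lambda>z. \<bar>h (z - v)\<bar>"])
      (auto intro!: AE_I2 lim m_le integrable_abs int)
  from this[of 0] this[of w]
  have "(\<lambda>K. (\<integral>z. m K z \<partial>gauss) - (\<integral>z. m K (z - w) \<partial>gauss)) \<longlonglongrightarrow> (\<integral>z. h z \<partial>gauss) - (\<integral>z. h (z - w) \<partial>gauss)"
    by (intro tendsto_diff) simp_all
  moreover have "(\<lambda>K. \<integral>z. m K z * (z \<bullet> w) \<partial>gauss) \<longlonglongrightarrow> (\<integral>z. h z * (z \<bullet> w) \<partial>gauss)"
    using integrable_abs[OF int(2)[of w]]
    by (intro integral_dominated_convergence[where w = "\<lambda>z. \<bar>h z * (z \<bullet> w)\<bar>"])
      (auto intro!: AE_I2 lim m_le integrable_abs int tendsto_mult_right mult_right_mono simp: abs_mult)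
  ultimately show ?thesis by (rule LIMSEQ_le) (use ineq in auto)
qed

lemma norm_oracle_grad_le:
  assumes f: "L-lipschitz_on UNIV f" and "0 < m"
  shows "norm (oracle_grad f m z y) \<le> L * (norm z)\<^sup>2"
proof -
  have "\<bar>f (y + m *\<^sub>R z) - f y\<bar> \<le> L * (m * norm z)"
    using lipschitz_bound[OF f, of "y + m *\<^sub>R z" y] \<open>0 < m\<close> by simp
  then have "\<bar>f (y + m *\<^sub>R z) - f y\<bar> / m \<le> L * norm z"
    using \<open>0 < m\<close> by (simp add: divide_le_eq mult_ac)
  then have "\<bar>f (y + m *\<^sub>R z) - f y\<bar> / m * norm z \<le> L * norm z * norm z"
    by (rule mult_right_mono) simp
  then show ?thesis using \<open>0 < m\<close> unfolding oracle_grad_def by (simp add: power2_eq_square mult.assoc)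
qed

text \<open>
  With \<open>h(z) = f (y + m z)\<close> and \<open>w = (y - u) / m\<close>, the inner product is \<open>(h(z) - h(0)) \<langle>z, w\<rangle>\<close> and
  the shifted function is \<open>h(z - w) = f (u + m z)\<close>. Symmetry of the Gaussian and convexity give
  \<open>\<integral> h \<ge> f y\<close>, so the Lipschitz error enters only once, at \<open>u\<close>.
\<close>

lemma oracle_grad_expected_progress:
  fixes f :: "real ^ 'n::finite \<Rightarrow> real"
  assumes cvx: "convex_on UNIV f" and f: "L-lipschitz_on UNIV f" and m: "0 < m"
  shows "f y - f u - m * L * sqrt (real CARD('n)) \<le> (\<integral>z. oracle_grad f m z y \<bullet> (y - u) \<partial>gauss)"
proof -
  define h where "h z = f (y + m *\<^sub>R z)" for z
  define w where "w = (1 / m) *\<^sub>R (y - u)"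
  have L: "0 \<le> L" using f by (rule lipschitz_on_nonneg)
  have h_lip: "(m * L)-lipschitz_on UNIV h"
  proof (rule lipschitz_onI)
    fix a b
    show "dist (h a) (h b) \<le> m * L * dist a b"
      using lipschitz_bound[OF f, of "y + m *\<^sub>R a" "y + m *\<^sub>R b"] m
      unfolding h_def by (simp add: dist_norm scaleR_diff_right[symmetric] mult_ac)
  qed (use m L in simp)
  have h_cvx: "convex_on UNIV h"
  proof (rule convex_onI)
    fix t :: real and a b :: "real ^ 'n" assume t: "0 < t" "t < 1"
    have "y + m *\<^sub>R ((1 - t) *\<^sub>R a + t *\<^sub>R b) = (1 - t) *\<^sub>R (y + m *\<^sub>R a) + t *\<^sub>R (y + m *\<^sub>R b)"
      by (simp add: algebra_simps)
    then show "h ((1 - t) *\<^sub>R a + t *\<^sub>R b) \<le> (1 - t) * h a + t * h b"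
      unfolding h_def using convex_onD[OF cvx, of t "y + m *\<^sub>R a" "y + m *\<^sub>R b"] t by simp
  qed simp
  note [measurable] = lipschitz_measurable[OF h_lip]
  note int = lipschitz_gauss_integrable[OF h_lip]
  have int0: "integrable gauss h" using int(1)[of 0] by simp
  have g_eq: "oracle_grad f m z y \<bullet> (y - u) = h z * (z \<bullet> w) - h 0 * (z \<bullet> w)" for z
    unfolding oracle_grad_def h_def w_def inner_scaleR_left inner_scaleR_right
    using m by (simp add: left_diff_distrib diff_divide_distrib)
  have "f y \<le> (\<integral>z. h z \<partial>gauss)"
  proof -
    have neg: "integrable gauss (\<lambda>z. h (- z))"
    proof -
      have "(m * L)-lipschitz_on UNIV (\<lambda>z. h (- z))"
        using h_lip unfolding lipschitz_on_def by (metis UNIV_I dist_minus)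
      from lipschitz_gauss_integrable(1)[OF this, of 0] show ?thesis by simp
    qed
    have "2 * f y \<le> h z + h (- z)" for z
      using convex_onD[OF h_cvx, of "1/2" z "- z"] unfolding h_def by simp
    then have "(\<integral>z. 2 * f y \<partial>(gauss :: (real ^ 'n) measure)) \<le> (\<integral>z. h z + h (- z) \<partial>gauss)"
      by (intro integral_mono) (auto simp: int0 neg)
    also have "\<dots> = 2 * (\<integral>z. h z \<partial>gauss)"
      using gauss_symmetric[of h] by (simp add: int0 neg)
    finally show ?thesis by (simp add: gauss.prob_space[simplified])
  qed
  moreover have "(\<integral>z. h (z - w) \<partial>gauss) \<le> f u + m * L * sqrt (real CARD('n))"
  proof -
    have "h (z - w) \<le> f u + m * L * norm z" for z
    proof -
      have "y + m *\<^sub>R (z - w) = u + m *\<^sub>R z" unfolding w_def using m by (simp add: algebra_simps)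
      then show ?thesis using lipschitz_bound[OF f, of "u + m *\<^sub>R z" u] m unfolding h_def by (simp add: mult_ac)
    qed
    then have "(\<integral>z. h (z - w) \<partial>gauss) \<le> (\<integral>z. f u + m * L * norm z \<partial>(gauss :: (real ^ 'n) measure))"
      using gauss_norm_expectation(1) by (intro integral_mono int) auto
    also have "\<dots> = f u + m * L * (\<integral>z. norm z \<partial>(gauss :: (real ^ 'n) measure))"
      using gauss_norm_expectation(1)[where 'n = 'n] by (simp add: gauss.prob_space[simplified])
    also have "\<dots> \<le> f u + m * L * sqrt (real CARD('n))"
      using m L by (intro add_left_mono mult_left_mono gauss_norm_expectation) auto
    finally show ?thesis .
  qed
  moreover have "(\<integral>z. oracle_grad f m z y \<bullet> (y - u) \<partial>gauss) = (\<integral>z. h z * (z \<bullet> w) \<partial>gauss)"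
    unfolding g_eq by (simp add: int gauss_linear)
  ultimately show ?thesis using gauss_gradient_inequality[OF h_cvx h_lip, of w] by linarith
qed

section \<open>Regret and consensus along one realization\<close>

lemma weighted_telescope_le:
  fixes c \<Delta> :: "nat \<Rightarrow> real"
  assumes "\<And>s t. s \<le> t \<Longrightarrow> c s \<le> c t" and "\<And>t. 0 \<le> c t" and "\<And>t. \<Delta> t \<le> D" and "\<And>t. 0 \<le> \<Delta> t"
  shows "(\<Sum>t=1..T. c t * (\<Delta> t - \<Delta> (Suc t))) \<le> c T * D"
proof -
  have "(\<Sum>t=1..T. c t * (\<Delta> t - \<Delta> (Suc t))) \<le> c T * (D - \<Delta> (Suc T))"
  proof (induction T)
    case 0
    then show ?case using assms by simp
  next
    case (Suc T)
    have "c T * (D - \<Delta> (Suc T)) \<le> c (Suc T) * (D - \<Delta> (Suc T))"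
      using assms(1)[of T "Suc T"] assms(3)[of "Suc T"] by (intro mult_right_mono) auto
    then show ?case using Suc.IH by (simp add: algebra_simps)
  qed
  also have "\<dots> \<le> c T * D" using assms(2,4) by (intro mult_left_mono) auto
  finally show ?thesis .
qed

lemma sum_inverse_sqrt_le: "(\<Sum>t<T. 1 / sqrt (real t + 1)) \<le> 2 * sqrt (real T)"
proof (induction T)
  case (Suc T)
  let ?a = "sqrt (real T + 1)" and ?b = "sqrt (real T)"
  have "1 = ?a\<^sup>2 - ?b\<^sup>2" by simp
  also have "\<dots> = (?a - ?b) * (?a + ?b)" by (simp add: power2_eq_square algebra_simps)
  also have "\<dots> \<le> (?a - ?b) * (2 * ?a)" by (intro mult_left_mono) auto
  finally have "1 \<le> (2 * (?a - ?b)) * ?a" by (simp only: mult_ac)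
  then have "1 / ?a \<le> 2 * (?a - ?b)" by (subst pos_divide_le_eq) auto
  then show ?case using Suc.IH by (simp add: add.commute)
qed simp

locale drgfmd_setting = mirror_map X U \<phi> \<sigma>
  for X U :: "(real ^ 'n::finite) set" and \<phi> :: "real ^ 'n \<Rightarrow> real" and \<sigma> :: real +
  fixes E :: "nat \<Rightarrow> ('v::finite \<times> 'v) set" and P :: "nat \<Rightarrow> real ^ 'v ^ 'v" and B :: nat and \<zeta> :: real
    and f :: "'v \<Rightarrow> real ^ 'n \<Rightarrow> real" and L \<mu> :: "'v \<Rightarrow> real" and d \<eta> :: real
  assumes net: "network E P B \<zeta>" and zero_in: "0 \<in> X"
    and f_convex: "\<And>i. convex_on UNIV (f i)" and f_lip: "\<And>i. (L i)-lipschitz_on UNIV (f i)"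
    and psd: "\<And>u v. u \<in> X \<Longrightarrow> v \<in> X \<Longrightarrow> psd (hess \<phi> v + hess_deriv \<phi> v (v - u))"
    and bregman_le: "\<And>u v. u \<in> X \<Longrightarrow> v \<in> X \<Longrightarrow> bregman \<phi> u v \<le> d\<^sup>2"
    and \<mu>_pos: "\<And>i. 0 < \<mu> i" and \<eta>_pos: "0 < \<eta>"
begin

definition \<alpha> :: "nat \<Rightarrow> real" where "\<alpha> t = \<eta> / sqrt (real t + 1)"

definition Lip :: real where "Lip = Max (range L)"

lemma \<alpha>_pos: "0 < \<alpha> t" unfolding \<alpha>_def using \<eta>_pos by simp

lemma L_nonneg: "0 \<le> L i" using f_lip lipschitz_on_nonneg by blast

lemma L_le_Lip: "L i \<le> Lip" unfolding Lip_def by simp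

lemma Lip_nonneg: "0 \<le> Lip" using L_nonneg L_le_Lip order_trans by blast

lemma ds: "doubly_stochastic (P t)" by (rule networkD(1)[OF net])

lemma mix_in:
  assumes "\<And>i. v i \<in> X"
  shows "mix (P t) v i \<in> X"
  unfolding mix_def using ds[of t] assms
  by (intro convex_sum X_convex) (auto simp: doubly_stochastic_def)

lemma f_bounded: "\<exists>C. \<forall>u\<in>X. \<bar>f i u\<bar> \<le> C"
proof -
  have "continuous_on X (f i)"
    using lipschitz_on_continuous_on[OF f_lip] continuous_on_subset by blast
  then have "bounded (f i ` X)" by (intro compact_imp_bounded compact_continuous_image X_compact)
  then show ?thesis unfolding bounded_real by auto
qed

context
  fixes z x y :: "'v \<Rightarrow> nat \<Rightarrow> real ^ 'n"
  assumes run: "drgfmd X \<phi> P f \<mu> \<alpha> z x y"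
begin

abbreviation "g i t \<equiv> oracle_grad (f i) (\<mu> i) (z i t) (y i t)"

lemma run_x0: "x i 0 = 0" and run_y: "y i t = mix (P t) (\<lambda>i. x i t) i"
  and run_step: "prox (\<alpha> t *\<^sub>R g i t - grad \<phi> (y i t)) (x i (Suc t))"
  using run prox_of_argmin unfolding drgfmd_def mix_def by blast+

lemma x_in: "x i t \<in> X"
proof (cases t)
  case 0
  then show ?thesis by (simp add: run_x0 zero_in)
next
  case (Suc s)
  then show ?thesis using run_step[of s i] unfolding prox_def by simp
qed

lemma y_in: "y i t \<in> X"
  unfolding run_y by (rule mix_in) (rule x_in)

lemma norm_g_le: "norm (g i t) \<le> Lip * (norm (z i t))\<^sup>2"
proof -
  have "norm (g i t) \<le> L i * (norm (z i t))\<^sup>2" by (rule norm_oracle_grad_le[OF f_lip \<mu>_pos])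
  also have "\<dots> \<le> Lip * (norm (z i t))\<^sup>2" by (intro mult_right_mono L_le_Lip) simp
  finally show ?thesis .
qed

text \<open>
  Dividing by the decreasing stepsizes gives increasing weights, so the telescoping sum of divergences is at most the last weight times the largest divergence.
\<close>

lemma regret_bound:
  assumes u: "u \<in> X"
  shows "(\<Sum>t=1..T. \<Sum>i\<in>UNIV. g i t \<bullet> (y i t - u))
    \<le> real CARD('v) * d\<^sup>2 / \<alpha> T + (\<Sum>t=1..T. \<Sum>i\<in>UNIV. \<alpha> t * (Lip\<^sup>2 * norm (z i t) ^ 4) / (2 * \<sigma>))"
proof -
  define \<Delta> where "\<Delta> t = (\<Sum>i\<in>UNIV. bregman \<phi> u (x i t))" for t
  have \<Delta>: "0 \<le> \<Delta> t" "\<Delta> t \<le> real CARD('v) * d\<^sup>2" for t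
  proof -
    show "0 \<le> \<Delta> t" unfolding \<Delta>_def by (intro sum_nonneg bregman_nonneg u x_in)
    have "\<Delta> t \<le> (\<Sum>i\<in>(UNIV :: 'v set). d\<^sup>2)" unfolding \<Delta>_def by (intro sum_mono bregman_le u x_in)
    then show "\<Delta> t \<le> real CARD('v) * d\<^sup>2" by simp
  qed
  have averaging: "(\<Sum>i\<in>UNIV. bregman \<phi> u (y i t)) \<le> \<Delta> t" for t
    unfolding \<Delta>_def
  proof (rule sum_mix_le[OF ds[of t]])
    fix i
    have "bregman \<phi> u (\<Sum>j\<in>UNIV. P t $ i $ j *\<^sub>R x j t) \<le> (\<Sum>j\<in>UNIV. P t $ i $ j * bregman \<phi> u (x j t))"
      using ds[of t] by (intro convex_on_sum[OF _ _ bregman_convex[OF psd u]] x_in)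
        (auto simp: doubly_stochastic_def)
    then show "bregman \<phi> u (y i t) \<le> mix (P t) (\<lambda>j. bregman \<phi> u (x j t)) i"
      unfolding run_y mix_def by simp
  qed
  have one: "(\<Sum>i\<in>UNIV. g i t \<bullet> (y i t - u))
      \<le> (1 / \<alpha> t) * (\<Delta> t - \<Delta> (Suc t)) + (\<Sum>i\<in>UNIV. \<alpha> t * (Lip\<^sup>2 * norm (z i t) ^ 4) / (2 * \<sigma>))" for t
  proof -
    have single: "\<alpha> t * (g i t \<bullet> (y i t - u))
        \<le> bregman \<phi> u (y i t) - bregman \<phi> u (x i (Suc t)) + (\<alpha> t)\<^sup>2 * (Lip\<^sup>2 * norm (z i t) ^ 4) / (2 * \<sigma>)" for i
    proof -
      have "(norm (g i t))\<^sup>2 \<le> (Lip * (norm (z i t))\<^sup>2)\<^sup>2" by (intro power_mono norm_g_le) auto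
      then have "(norm (g i t))\<^sup>2 \<le> Lip\<^sup>2 * norm (z i t) ^ 4" by (simp add: power_mult_distrib)
      then have "(\<alpha> t)\<^sup>2 * (norm (g i t))\<^sup>2 / (2 * \<sigma>) \<le> (\<alpha> t)\<^sup>2 * (Lip\<^sup>2 * norm (z i t) ^ 4) / (2 * \<sigma>)"
        using \<sigma>_pos by (intro divide_right_mono mult_left_mono) auto
      with mirror_step_progress[OF run_step y_in u, of t i] show ?thesis by linarith
    qed
    have "\<alpha> t * (\<Sum>i\<in>UNIV. g i t \<bullet> (y i t - u)) \<le> (\<Sum>i\<in>UNIV. bregman \<phi> u (y i t) - bregman \<phi> u (x i (Suc t))
        + (\<alpha> t)\<^sup>2 * (Lip\<^sup>2 * norm (z i t) ^ 4) / (2 * \<sigma>))"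
      unfolding sum_distrib_left by (intro sum_mono single)
    also have "\<dots> = (\<Sum>i\<in>UNIV. bregman \<phi> u (y i t)) - \<Delta> (Suc t) + (\<Sum>i\<in>UNIV. (\<alpha> t)\<^sup>2 * (Lip\<^sup>2 * norm (z i t) ^ 4) / (2 * \<sigma>))"
      by (simp add: sum.distrib sum_subtractf \<Delta>_def)
    also have "\<dots> \<le> \<Delta> t - \<Delta> (Suc t) + (\<Sum>i\<in>UNIV. (\<alpha> t)\<^sup>2 * (Lip\<^sup>2 * norm (z i t) ^ 4) / (2 * \<sigma>))"
      using averaging[of t] by simp
    also have "(\<Sum>i\<in>UNIV. (\<alpha> t)\<^sup>2 * (Lip\<^sup>2 * norm (z i t) ^ 4) / (2 * \<sigma>))
        = \<alpha> t * (\<Sum>i\<in>UNIV. \<alpha> t * (Lip\<^sup>2 * norm (z i t) ^ 4) / (2 * \<sigma>))"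
      by (simp add: sum_distrib_left power2_eq_square mult_ac)
    finally show ?thesis using \<alpha>_pos[of t] by (simp add: field_simps)
  qed
  have "(\<Sum>t=1..T. (1 / \<alpha> t) * (\<Delta> t - \<Delta> (Suc t))) \<le> (1 / \<alpha> T) * (real CARD('v) * d\<^sup>2)"
  proof (rule weighted_telescope_le[OF _ _ \<Delta>(2,1)])
    show "1 / \<alpha> s \<le> 1 / \<alpha> t" if "s \<le> t" for s t
      unfolding \<alpha>_def using \<eta>_pos that by (simp add: divide_right_mono)
    show "0 \<le> 1 / \<alpha> t" for t using \<alpha>_pos[of t] by simp
  qed
  moreover have "(\<Sum>t=1..T. \<Sum>i\<in>UNIV. g i t \<bullet> (y i t - u)) \<le> (\<Sum>t=1..T. (1 / \<alpha> t) * (\<Delta> t - \<Delta> (Suc t))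
      + (\<Sum>i\<in>UNIV. \<alpha> t * (Lip\<^sup>2 * norm (z i t) ^ 4) / (2 * \<sigma>)))"
    by (intro sum_mono one)
  ultimately show ?thesis by (simp add: sum.distrib)
qed

text \<open>
  The mirror steps act as perturbations of the averaging process.
\<close>

lemma dispersion_bound:
  "\<zeta> / (4 * (real CARD('v))\<^sup>2) * (\<Sum>t=1..T. dispersion (\<lambda>i. x i t))
    \<le> real B * (\<Sum>s<T. \<Sum>i\<in>UNIV. \<alpha> s * (Lip * (norm (z i s))\<^sup>2) / \<sigma>)"
proof -
  define e where "e t i = x i (Suc t) - y i t" for t i
  have e_le: "norm (e t i) \<le> \<alpha> t * (Lip * (norm (z i t))\<^sup>2) / \<sigma>" for t i
  proof -
    have "norm (e t i) \<le> \<alpha> t * norm (g i t) / \<sigma>"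
      unfolding e_def using \<alpha>_pos[of t] by (intro mirror_step_displacement[OF run_step y_in]) auto
    also have "\<dots> \<le> \<alpha> t * (Lip * (norm (z i t))\<^sup>2) / \<sigma>"
      using \<alpha>_pos[of t] \<sigma>_pos by (intro divide_right_mono mult_left_mono norm_g_le) auto
    finally show ?thesis .
  qed
  have z: "0 < \<zeta>" by (rule networkD(4)[OF net])
  have "\<zeta> / (4 * (real CARD('v))\<^sup>2) * (\<Sum>t=1..T. dispersion (\<lambda>i. x i t)) \<le> \<zeta> / (4 * (real CARD('v))\<^sup>2) * (\<Sum>t\<le>T. dispersion (\<lambda>i. x i t))"
    using z by (intro mult_left_mono sum_mono2) (auto simp: dispersion_nonneg)
  also have "\<dots> \<le> real B * (\<Sum>s<T. dispersion (e s))"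
    by (rule sum_dispersion_le[OF net]) (auto simp: e_def run_y run_x0)
  also have "\<dots> \<le> real B * (\<Sum>s<T. \<Sum>i\<in>UNIV. \<alpha> s * (Lip * (norm (z i s))\<^sup>2) / \<sigma>)"
    by (intro mult_left_mono sum_mono order_trans[OF dispersion_le_sum] e_le) auto
  finally show ?thesis .
qed

lemma agent_value_le:
  "avg_fun f (x l t) \<le> (1 / real CARD('v)) * (\<Sum>i\<in>UNIV. f i (y i t)) + 2 * Lip * dispersion (\<lambda>i. x i t)"
proof -
  let ?W = "dispersion (\<lambda>i. x i t)" and ?m = "mean (\<lambda>i. x i t)"
  have "f i (x l t) \<le> f i (y i t) + Lip * (?W + norm (y i t - ?m))" for i
  proof -
    have "norm (x l t - y i t) \<le> norm (x l t - ?m) + norm (y i t - ?m)"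
      using norm_triangle_ineq4[of "x l t - ?m" "y i t - ?m"] by simp
    also have "\<dots> \<le> ?W + norm (y i t - ?m)"
      using norm_centred_le_dispersion[of "\<lambda>i. x i t" l] by simp
    finally have "L i * norm (x l t - y i t) \<le> Lip * (?W + norm (y i t - ?m))"
      using Lip_nonneg by (intro mult_mono L_le_Lip) auto
    with lipschitz_bound[OF f_lip, of i "x l t" "y i t"] show ?thesis by linarith
  qed
  then have "(\<Sum>i\<in>UNIV. f i (x l t)) \<le> (\<Sum>i\<in>UNIV. f i (y i t) + Lip * (?W + norm (y i t - ?m)))"
    by (intro sum_mono)
  also have "\<dots> = (\<Sum>i\<in>UNIV. f i (y i t)) + Lip * (real CARD('v) * ?W + (\<Sum>i\<in>UNIV. norm (y i t - ?m)))"
    by (simp add: sum.distrib sum_distrib_left[symmetric])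
  also have "(\<Sum>i\<in>UNIV. norm (y i t - ?m)) \<le> (\<Sum>i\<in>UNIV. norm (x i t - ?m))"
  proof (rule sum_mix_le[OF ds[of t]])
    fix i
    have "y i t - ?m = mix (P t) (\<lambda>j. x j t - ?m) i"
      using mix_diff[of "P t" "\<lambda>j. x j t" "\<lambda>_. ?m" i] mix_const[OF ds, of t ?m i] by (simp add: run_y)
    also have "norm \<dots> \<le> mix (P t) (\<lambda>j. norm (x j t - ?m)) i"
      unfolding mix_def using doubly_stochasticD(1)[OF ds[of t]] by (intro order_trans[OF norm_sum]) simp
    finally show "norm (y i t - ?m) \<le> mix (P t) (\<lambda>j. norm (x j t - ?m)) i" .
  qed
  also have "(\<Sum>i\<in>UNIV. norm (x i t - ?m)) \<le> (\<Sum>i\<in>(UNIV :: 'v set). ?W)"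
    by (intro sum_mono) (rule norm_centred_le_dispersion[of "\<lambda>i. x i t"])
  finally have "(\<Sum>i\<in>UNIV. f i (x l t)) \<le> (\<Sum>i\<in>UNIV. f i (y i t)) + Lip * (real CARD('v) * ?W + real CARD('v) * ?W)"
    using Lip_nonneg by (simp add: mult_left_mono)
  then have "(1 / real CARD('v)) * (\<Sum>i\<in>UNIV. f i (x l t)) \<le> (1 / real CARD('v)) * ((\<Sum>i\<in>UNIV. f i (y i t)) + Lip * (real CARD('v) * ?W + real CARD('v) * ?W))"
    by (intro mult_left_mono) auto
  then show ?thesis unfolding avg_fun_def by (simp add: field_simps)
qed

end

section \<open>Iterates as functions of the random directions\<close>

text \<open>
  The gradient is continuous on \<open>X\<close>, where all iterates stay; cutting it off outside makes it measurable on the whole space.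
\<close>

definition gradX :: "real ^ 'n \<Rightarrow> real ^ 'n" where
  "gradX v = (if v \<in> X then grad \<phi> v else 0)"

lemma gradX_measurable [measurable]: "gradX \<in> borel_measurable borel"
  unfolding gradX_def
  by (rule borel_measurable_continuous_on_if) (auto intro: grad_continuous borel_closed compact_imp_closed X_compact)

lemma prox_map_measurable [measurable]: "prox_map \<in> borel_measurable borel"
  by (rule borel_measurable_continuous_onI[OF prox_map_continuous])

lemma f_measurable [measurable]: "f i \<in> borel_measurable borel"
  by (rule lipschitz_measurable[OF f_lip])

text \<open>
  The iterates as explicit functions of the whole family of directions. Uniqueness of the mirror step
  identifies them with the given sequences (\<open>run_eq_iter\<close>), and \<open>iter t\<close> reads only directions with
  time index below \<open>t\<close> (\<open>iter_cong\<close>): this gives measurability and independence.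
\<close>

primrec iter :: "nat \<Rightarrow> ('v \<times> nat \<Rightarrow> real ^ 'n) \<Rightarrow> 'v \<Rightarrow> real ^ 'n" where
  "iter 0 z = (\<lambda>_. 0)"
| "iter (Suc t) z = (\<lambda>i. let v = mix (P t) (iter t z) i in
     prox_map (\<alpha> t *\<^sub>R oracle_grad (f i) (\<mu> i) (z (i, t)) v - gradX v))"

lemma run_eq_iter:
  assumes run: "drgfmd X \<phi> P f \<mu> \<alpha> z x y"
  shows "(\<lambda>i. x i t) = iter t (\<lambda>(i, s). z i s)"
proof (induction t)
  case 0
  then show ?case using run_x0[OF run] by auto
next
  case (Suc t)
  show ?case
  proof
    fix i
    have "gradX (y i t) = grad \<phi> (y i t)" unfolding gradX_def using y_in[OF run] by simp
    then show "x i (Suc t) = iter (Suc t) (\<lambda>(i, s). z i s) i"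
      using prox_unique[OF run_step[OF run, of t i]] by (simp add: Suc[symmetric] run_y[OF run] Let_def)
  qed
qed

lemma iter_cong:
  assumes "\<And>i s. s < t \<Longrightarrow> z (i, s) = z' (i, s)"
  shows "iter t z = iter t z'"
  using assms by (induction t) (auto simp: Let_def)

lemma iter_measurable:
  assumes "UNIV \<times> {..<t} \<subseteq> A"
  shows "(\<lambda>z. iter t z i) \<in> borel_measurable (PiM A (\<lambda>_. borel))"
  using assms
proof (induction t arbitrary: i)
  case (Suc t)
  have [measurable]: "(\<lambda>z. iter t z j) \<in> borel_measurable (PiM A (\<lambda>_. borel))" for j
    using Suc.prems by (intro Suc.IH) auto
  have [measurable]: "(\<lambda>z. z (i, t)) \<in> borel_measurable (PiM A (\<lambda>_. borel))"
    using Suc.prems by (intro measurable_component_singleton) auto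
  show ?case unfolding iter.simps Let_def oracle_grad_def mix_def by measurable
qed simp

end

text \<open>
  By independence the joint law of \<open>(Y, Z)\<close> is a product, and the bound for a fixed point is integrated over the law of \<open>Y\<close>.
\<close>

lemma (in prob_space) expected_oracle_progress:
  fixes h :: "real ^ 'n::finite \<Rightarrow> real"
  assumes ind: "indep_var borel Y borel Z" and Z: "distr M borel Z = gauss"
    and cvx: "convex_on UNIV h" and lip: "l-lipschitz_on UNIV h" and m: "0 < m"
    and intY: "integrable M (\<lambda>\<omega>. h (Y \<omega>))"
    and intG: "integrable M (\<lambda>\<omega>. oracle_grad h m (Z \<omega>) (Y \<omega>) \<bullet> (Y \<omega> - u))"
  shows "expectation (\<lambda>\<omega>. h (Y \<omega>)) - h u - m * l * sqrt (real CARD('n))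
    \<le> expectation (\<lambda>\<omega>. oracle_grad h m (Z \<omega>) (Y \<omega>) \<bullet> (Y \<omega> - u))"
proof -
  note [measurable] = lipschitz_measurable[OF lip]
  have [measurable]: "random_variable borel Y" "random_variable borel Z"
    using indep_var_rv1[OF ind] indep_var_rv2[OF ind] by auto
  let ?G = "\<lambda>(v, z). oracle_grad h m z v \<bullet> (v - u)"
  have [measurable]: "?G \<in> borel_measurable (borel \<Otimes>\<^sub>M borel)"
    unfolding oracle_grad_def by measurable
  let ?Q = "distr M borel Y"
  interpret Q: prob_space ?Q by (rule prob_space_distr) simp
  interpret QG: pair_sigma_finite ?Q gauss ..
  have joint: "distr M (borel \<Otimes>\<^sub>M borel) (\<lambda>\<omega>. (Y \<omega>, Z \<omega>)) = ?Q \<Otimes>\<^sub>M gauss"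
    using ind unfolding indep_var_distribution_eq Z by simp
  have "integrable (distr M (borel \<Otimes>\<^sub>M borel) (\<lambda>\<omega>. (Y \<omega>, Z \<omega>))) ?G"
    using intG by (subst integrable_distr_eq) auto
  then have int: "integrable (?Q \<Otimes>\<^sub>M gauss) ?G" unfolding joint .
  have "expectation (\<lambda>\<omega>. h (Y \<omega>)) - h u - m * l * sqrt (real CARD('n))
      = (\<integral>v. h v - h u - m * l * sqrt (real CARD('n)) \<partial>?Q)"
    using intY Q.prob_space by (simp add: integrable_distr_eq integral_distr)
  also have "\<dots> \<le> (\<integral>v. (\<integral>z. oracle_grad h m z v \<bullet> (v - u) \<partial>gauss) \<partial>?Q)"
    using intY QG.integrable_fst[OF int]
    by (intro integral_mono oracle_grad_expected_progress[OF cvx lip m]) (auto simp: integrable_distr_eq)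
  also have "\<dots> = (\<integral>p. ?G p \<partial>(?Q \<Otimes>\<^sub>M gauss))"
    using QG.integral_fst[OF int] by simp
  also have "\<dots> = expectation (\<lambda>\<omega>. oracle_grad h m (Z \<omega>) (Y \<omega>) \<bullet> (Y \<omega> - u))"
    unfolding joint[symmetric] by (subst integral_distr) auto
  finally show ?thesis .
qed

lemma std_gaussian_distr: "std_gaussian M Z \<Longrightarrow> distr M borel Z = gauss"
proof -
  assume "std_gaussian M Z"
  then have "distr M lborel Z = gauss"
    unfolding std_gaussian_def distributed_def gauss_def gauss_density_def by simp
  moreover have "distr M lborel Z = distr M borel Z" by (rule distr_cong) auto
  ultimately show ?thesis by simp
qed

locale drgfmd_random = drgfmd_setting X U \<phi> \<sigma> E P B \<zeta> f L \<mu> d \<eta> + prob_space M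
  for X U :: "(real ^ 'n::finite) set" and \<phi> \<sigma>
    and E :: "nat \<Rightarrow> ('v::finite \<times> 'v) set" and P B \<zeta> f L \<mu> d \<eta> and M :: "'w measure" +
  fixes \<xi> x y :: "'v \<Rightarrow> nat \<Rightarrow> 'w \<Rightarrow> real ^ 'n"
  assumes indep: "indep_vars (\<lambda>_. borel) (\<lambda>(i, t). \<xi> i t) UNIV"
    and gaussian: "\<And>i t. std_gaussian M (\<xi> i t)"
    and runs: "\<And>\<omega>. \<omega> \<in> space M \<Longrightarrow> drgfmd X \<phi> P f \<mu> \<alpha> (\<lambda>i t. \<xi> i t \<omega>) (\<lambda>i t. x i t \<omega>) (\<lambda>i t. y i t \<omega>)"
begin

lemma \<xi>_measurable [measurable]: "random_variable borel (\<xi> i t)"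
  using indep_vars_def[of "\<lambda>_. borel" "\<lambda>(i, t). \<xi> i t" UNIV] indep by auto

lemma \<xi>_distr: "distr M borel (\<xi> i t) = gauss"
  by (rule std_gaussian_distr[OF gaussian])

lemma x_iter: "\<omega> \<in> space M \<Longrightarrow> x i t \<omega> = iter t (\<lambda>(i, s). \<xi> i s \<omega>) i"
  using fun_cong[OF run_eq_iter[OF runs, of \<omega> t], of i] by simp

lemma y_iter: "\<omega> \<in> space M \<Longrightarrow> y i t \<omega> = mix (P t) (iter t (\<lambda>(i, s). \<xi> i s \<omega>)) i"
  using run_y[OF runs, of \<omega> i t] run_eq_iter[OF runs, of \<omega> t] by simp

lemma x_measurable [measurable]: "random_variable borel (x i t)"
proof -
  have "(\<lambda>\<omega>. iter t (\<lambda>(i, s). \<xi> i s \<omega>) i) \<in> borel_measurable M"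
    by (rule measurable_compose[OF _ iter_measurable[of t UNIV]]) (auto intro!: measurable_PiM_single')
  then show ?thesis by (subst measurable_cong[OF x_iter]) auto
qed

lemma y_measurable [measurable]: "random_variable borel (y i t)"
proof -
  have "(\<lambda>\<omega>. mix (P t) (\<lambda>i. x i t \<omega>) i) \<in> borel_measurable M" unfolding mix_def by measurable
  then show ?thesis by (subst measurable_cong[OF run_y[OF runs]]) auto
qed

text \<open>
  The restriction of the family to times below \<open>t\<close> is independent of its member at \<open>(i, t)\<close>.
\<close>

lemma y_indep_\<xi>: "indep_var borel (y i t) borel (\<xi> i t)"
proof -
  define A where "A = (UNIV :: 'v set) \<times> {..<t}"
  define H where "H z = mix (P t) (iter t z) i" for z
  let ?R = "\<lambda>A \<omega>. restrict (\<lambda>p. (\<lambda>(i, t). \<xi> i t) p \<omega>) A"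
  have H: "H \<in> borel_measurable (PiM A (\<lambda>_. borel))"
  proof -
    have [measurable]: "(\<lambda>z. iter t z j) \<in> borel_measurable (PiM A (\<lambda>_. borel))" for j
      unfolding A_def by (rule iter_measurable) simp
    show ?thesis unfolding H_def[abs_def] mix_def by measurable
  qed
  have "indep_var (PiM A (\<lambda>_. borel)) (?R A) (PiM {(i, t)} (\<lambda>_. borel)) (?R {(i, t)})"
    by (rule indep_var_restrict[OF indep]) (auto simp: A_def)
  from indep_var_compose[OF this H, of "\<lambda>z. z (i, t)" borel]
  have "indep_var borel (H \<circ> ?R A) borel ((\<lambda>z. z (i, t)) \<circ> ?R {(i, t)})" by simp
  then have ind: "indep_var borel (\<lambda>\<omega>. H (?R A \<omega>)) borel (\<xi> i t)" by (simp add: o_def)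
  have eq: "H (?R A \<omega>) = y i t \<omega>" if "\<omega> \<in> space M" for \<omega>
  proof -
    have "iter t (?R A \<omega>) = iter t (\<lambda>(i, s). \<xi> i s \<omega>)" by (rule iter_cong) (auto simp: A_def)
    then show ?thesis using y_iter[OF that] unfolding H_def by simp
  qed
  have "distr M borel (\<lambda>\<omega>. H (?R A \<omega>)) = distr M borel (y i t)"
    "distr M (borel \<Otimes>\<^sub>M borel) (\<lambda>\<omega>. (H (?R A \<omega>), \<xi> i t \<omega>)) = distr M (borel \<Otimes>\<^sub>M borel) (\<lambda>\<omega>. (y i t \<omega>, \<xi> i t \<omega>))"
    by (intro distr_cong refl, simp add: eq)+
  with ind show ?thesis unfolding indep_var_distribution_eq by simp
qed

end

section \<open>The expected optimality gap\<close>

lemma divide_gap_by_horizon: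
  fixes F v b a c T :: real
  assumes T: "0 < T" and le: "T * F \<le> T * (v + b) + a * sqrt T + c * sqrt T"
  shows "F - v \<le> b + (a + c) / sqrt T"
proof -
  have r: "T = sqrt T * sqrt T" "0 < sqrt T" using T by simp_all
  have "T * (F - v - b) \<le> sqrt T * (a + c)" using le by (simp add: algebra_simps)
  then have "sqrt T * (sqrt T * (F - v - b)) \<le> sqrt T * (a + c)"
    using r(1) by (metis mult.assoc)
  then have "sqrt T * (F - v - b) \<le> a + c" using r(2) by (simp only: mult_le_cancel_left_pos)
  then have "F - v - b \<le> (a + c) / sqrt T" using r(2) by (simp add: pos_le_divide_eq mult.commute)
  then show ?thesis by simp
qed

context drgfmd_random
begin

lemma \<xi>_moments:
  shows "integrable M (\<lambda>\<omega>. (norm (\<xi> i t \<omega>))\<^sup>2)" "expectation (\<lambda>\<omega>. (norm (\<xi> i t \<omega>))\<^sup>2) = real CARD('n)"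
    and "integrable M (\<lambda>\<omega>. norm (\<xi> i t \<omega>) ^ 4)" "expectation (\<lambda>\<omega>. norm (\<xi> i t \<omega>) ^ 4) \<le> 3 * (real CARD('n))\<^sup>2"
proof -
  note sq = gauss_norm_sq[where 'n = 'n, unfolded \<xi>_distr[of i t, symmetric]]
  note p4 = gauss_norm_pow4[where 'n = 'n, unfolded \<xi>_distr[of i t, symmetric]]
  show "integrable M (\<lambda>\<omega>. (norm (\<xi> i t \<omega>))\<^sup>2)" using sq(1) by (subst (asm) integrable_distr_eq) auto
  show "expectation (\<lambda>\<omega>. (norm (\<xi> i t \<omega>))\<^sup>2) = real CARD('n)" using sq(2) by (subst (asm) integral_distr) auto
  show "integrable M (\<lambda>\<omega>. norm (\<xi> i t \<omega>) ^ 4)" using p4(1) by (subst (asm) integrable_distr_eq) auto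
  show "expectation (\<lambda>\<omega>. norm (\<xi> i t \<omega>) ^ 4) \<le> 3 * (real CARD('n))\<^sup>2" using p4(2) by (subst (asm) integral_distr) auto
qed

definition first_order_gap :: "real ^ 'n \<Rightarrow> 'v \<Rightarrow> nat \<Rightarrow> 'w \<Rightarrow> real" where
  "first_order_gap u i t \<omega> = oracle_grad (f i) (\<mu> i) (\<xi> i t \<omega>) (y i t \<omega>) \<bullet> (y i t \<omega> - u)"

lemma f_y_integrable: "integrable M (\<lambda>\<omega>. f i (y i t \<omega>))"
proof -
  obtain C where "\<forall>u\<in>X. \<bar>f i u\<bar> \<le> C" using f_bounded by blast
  then have "AE \<omega> in M. norm (f i (y i t \<omega>)) \<le> C"
    using y_in[OF runs] by (intro AE_I2) simp
  then show ?thesis by (rule integrable_const_bound) measurable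
qed

lemma first_order_gap_integrable:
  assumes u: "u \<in> X"
  shows "integrable M (first_order_gap u i t)"
proof -
  obtain D where D: "\<And>v. v \<in> X \<Longrightarrow> norm v \<le> D"
    using compact_imp_bounded[OF X_compact] unfolding bounded_iff by blast
  have "integrable M (\<lambda>\<omega>. (Lip * (2 * D)) * (norm (\<xi> i t \<omega>))\<^sup>2)"
    by (intro integrable_mult_right \<xi>_moments)
  moreover have "first_order_gap u i t \<in> borel_measurable M"
    unfolding first_order_gap_def[abs_def] oracle_grad_def by measurable
  moreover have "AE \<omega> in M. norm (first_order_gap u i t \<omega>) \<le> norm ((Lip * (2 * D)) * (norm (\<xi> i t \<omega>))\<^sup>2)"
  proof (rule AE_I2)
    fix \<omega> assume w: "\<omega> \<in> space M"
    have "norm (y i t \<omega> - u) \<le> 2 * D"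
      using norm_triangle_ineq4[of "y i t \<omega>" u] D[OF y_in[OF runs[OF w]]] D[OF u] by (smt (verit))
    then have "norm (first_order_gap u i t \<omega>) \<le> (Lip * (norm (\<xi> i t \<omega>))\<^sup>2) * (2 * D)"
      unfolding first_order_gap_def real_norm_def
      by (intro order_trans[OF Cauchy_Schwarz_ineq2] mult_mono norm_g_le[OF runs[OF w]]) (auto simp: Lip_nonneg)
    then show "norm (first_order_gap u i t \<omega>) \<le> norm ((Lip * (2 * D)) * (norm (\<xi> i t \<omega>))\<^sup>2)"
      by (simp add: mult_ac)
  qed
  ultimately show ?thesis by (rule Bochner_Integration.integrable_bound)
qed

lemma expected_value_le:
  assumes u: "u \<in> X"
  shows "expectation (\<lambda>\<omega>. f i (y i t \<omega>)) \<le> f i u + \<mu> i * Lip * sqrt (real CARD('n)) + expectation (first_order_gap u i t)"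
proof -
  have "expectation (\<lambda>\<omega>. f i (y i t \<omega>)) - f i u - \<mu> i * L i * sqrt (real CARD('n)) \<le> expectation (first_order_gap u i t)"
    unfolding first_order_gap_def[abs_def]
    by (rule expected_oracle_progress[OF y_indep_\<xi> \<xi>_distr f_convex f_lip \<mu>_pos f_y_integrable])
      (use first_order_gap_integrable[OF u, of i t] in \<open>simp add: first_order_gap_def[abs_def]\<close>)
  moreover have "\<mu> i * L i * sqrt (real CARD('n)) \<le> \<mu> i * Lip * sqrt (real CARD('n))"
    using \<mu>_pos[of i] by (intro mult_right_mono mult_left_mono L_le_Lip) auto
  ultimately show ?thesis by linarith
qed

lemma sum_\<alpha>_le: "(\<Sum>t<T. \<alpha> t) \<le> 2 * \<eta> * sqrt (real T)" "(\<Sum>t=1..T. \<alpha> t) \<le> 2 * \<eta> * sqrt (real T)"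
proof -
  have "(\<Sum>t<T. \<alpha> t) = \<eta> * (\<Sum>t<T. 1 / sqrt (real t + 1))"
    unfolding \<alpha>_def by (simp add: sum_distrib_left)
  also have "\<dots> \<le> \<eta> * (2 * sqrt (real T))" using \<eta>_pos by (intro mult_left_mono sum_inverse_sqrt_le) auto
  finally show 1: "(\<Sum>t<T. \<alpha> t) \<le> 2 * \<eta> * sqrt (real T)" by (simp add: mult_ac)
  have "(\<Sum>t=1..T. \<alpha> t) = (\<Sum>t<T. \<alpha> (Suc t))" by (simp add: sum.atLeast1_atMost_eq)
  also have "\<dots> \<le> (\<Sum>t<T. \<alpha> t)"
    unfolding \<alpha>_def using \<eta>_pos by (intro sum_mono divide_left_mono) auto
  finally show "(\<Sum>t=1..T. \<alpha> t) \<le> 2 * \<eta> * sqrt (real T)" using 1 by simp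
qed

lemma expected_regret_le:
  assumes u: "u \<in> X" and T: "1 \<le> T"
  shows "(\<Sum>t=1..T. \<Sum>i\<in>UNIV. expectation (first_order_gap u i t))
    \<le> real CARD('v) * (sqrt 2 * d\<^sup>2 / \<eta> + 3 * (real CARD('n))\<^sup>2 * Lip\<^sup>2 * \<eta> / \<sigma>) * sqrt (real T)"
proof -
  let ?R = "\<lambda>\<omega>. real CARD('v) * d\<^sup>2 / \<alpha> T + (\<Sum>t=1..T. \<Sum>i\<in>UNIV. \<alpha> t * (Lip\<^sup>2 * norm (\<xi> i t \<omega>) ^ 4) / (2 * \<sigma>))"
  note int = first_order_gap_integrable[OF u] \<xi>_moments(3)
  have "(\<Sum>t=1..T. \<Sum>i\<in>UNIV. expectation (first_order_gap u i t)) = expectation (\<lambda>\<omega>. \<Sum>t=1..T. \<Sum>i\<in>UNIV. first_order_gap u i t \<omega>)"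
    by (simp add: int)
  also have "\<dots> \<le> expectation ?R"
    using regret_bound[OF runs u] by (intro integral_mono_AE AE_I2) (auto simp: first_order_gap_def[symmetric] int)
  also have "\<dots> = real CARD('v) * d\<^sup>2 / \<alpha> T + (\<Sum>t=1..T. \<Sum>i\<in>(UNIV :: 'v set). \<alpha> t * (Lip\<^sup>2 * expectation (\<lambda>\<omega>. norm (\<xi> i t \<omega>) ^ 4)) / (2 * \<sigma>))"
    by (simp add: int prob_space)
  also have "\<dots> \<le> real CARD('v) * d\<^sup>2 / \<alpha> T + (\<Sum>t=1..T. \<Sum>i\<in>(UNIV :: 'v set). \<alpha> t * (Lip\<^sup>2 * (3 * (real CARD('n))\<^sup>2)) / (2 * \<sigma>))"
    using \<sigma>_pos \<alpha>_pos by (intro add_left_mono sum_mono divide_right_mono mult_left_mono \<xi>_moments) (auto intro: less_imp_le)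
  also have "\<dots> = real CARD('v) * d\<^sup>2 / \<alpha> T + real CARD('v) * (Lip\<^sup>2 * (3 * (real CARD('n))\<^sup>2) / (2 * \<sigma>)) * (\<Sum>t=1..T. \<alpha> t)"
    unfolding sum_distrib_left by (intro arg_cong2[where f = "(+)"] sum.cong refl) (simp add: mult_ac)
  also have "\<dots> \<le> real CARD('v) * (sqrt 2 * d\<^sup>2 / \<eta>) * sqrt (real T) + real CARD('v) * (Lip\<^sup>2 * (3 * (real CARD('n))\<^sup>2) / (2 * \<sigma>)) * (2 * \<eta> * sqrt (real T))"
  proof (intro add_mono mult_left_mono sum_\<alpha>_le)
    have "sqrt (real T + 1) \<le> sqrt 2 * sqrt (real T)"
      using T by (simp add: real_sqrt_mult[symmetric])
    then have "real CARD('v) * d\<^sup>2 / \<eta> * sqrt (real T + 1) \<le> real CARD('v) * d\<^sup>2 / \<eta> * (sqrt 2 * sqrt (real T))"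
      using \<eta>_pos by (intro mult_left_mono) auto
    then show "real CARD('v) * d\<^sup>2 / \<alpha> T \<le> real CARD('v) * (sqrt 2 * d\<^sup>2 / \<eta>) * sqrt (real T)"
      unfolding \<alpha>_def by (simp add: mult_ac)
  qed (use \<sigma>_pos in auto)
  also have "\<dots> = real CARD('v) * (sqrt 2 * d\<^sup>2 / \<eta> + 3 * (real CARD('n))\<^sup>2 * Lip\<^sup>2 * \<eta> / \<sigma>) * sqrt (real T)"
    by (simp add: algebra_simps)
  finally show ?thesis .
qed

text \<open>
  An upper bound for the total length of all mirror steps before time \<open>T\<close>.
\<close>

definition displacement_bound :: "nat \<Rightarrow> 'w \<Rightarrow> real" where
  "displacement_bound T \<omega> = (\<Sum>s<T. \<Sum>i\<in>UNIV. \<alpha> s * (Lip * (norm (\<xi> i s \<omega>))\<^sup>2) / \<sigma>)"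

lemma displacement_bound_expectation:
  shows "integrable M (displacement_bound T)"
    and "expectation (displacement_bound T) \<le> 2 * real CARD('v) * real CARD('n) * Lip * \<eta> / \<sigma> * sqrt (real T)"
proof -
  show "integrable M (displacement_bound T)" unfolding displacement_bound_def[abs_def] by (simp add: \<xi>_moments(1))
  have "expectation (displacement_bound T) = (\<Sum>s<T. \<Sum>i\<in>(UNIV :: 'v set). \<alpha> s * (Lip * real CARD('n)) / \<sigma>)"
    unfolding displacement_bound_def[abs_def] by (simp add: \<xi>_moments)
  also have "\<dots> = real CARD('v) * (Lip * real CARD('n)) / \<sigma> * (\<Sum>s<T. \<alpha> s)"
    unfolding sum_distrib_left by (intro sum.cong refl) (simp add: mult_ac)
  also have "\<dots> \<le> real CARD('v) * (Lip * real CARD('n)) / \<sigma> * (2 * \<eta> * sqrt (real T))"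
    using \<sigma>_pos Lip_nonneg by (intro mult_left_mono sum_\<alpha>_le) auto
  finally show "expectation (displacement_bound T) \<le> 2 * real CARD('v) * real CARD('n) * Lip * \<eta> / \<sigma> * sqrt (real T)" by (simp add: mult_ac)
qed

lemma average_value_le:
  assumes w: "\<omega> \<in> space M" and T: "1 \<le> T"
  shows "real T * avg_fun f ((1 / real T) *\<^sub>R (\<Sum>t=1..T. x l t \<omega>))
    \<le> (1 / real CARD('v)) * (\<Sum>t=1..T. \<Sum>i\<in>UNIV. f i (y i t \<omega>)) + 2 * Lip * (4 * (real CARD('v))\<^sup>2 * real B / \<zeta> * displacement_bound T \<omega>)"
proof -
  note run = runs[OF w]
  have z: "0 < \<zeta>" by (rule networkD(4)[OF net])
  have cvx: "convex_on UNIV (f i)" for i by (rule f_convex)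
  have "f i ((1 / real T) *\<^sub>R (\<Sum>t=1..T. x l t \<omega>)) \<le> (1 / real T) * (\<Sum>t=1..T. f i (x l t \<omega>))" for i
    using convex_on_sum[of "{1..T}" UNIV "f i" "\<lambda>_. 1 / real T" "\<lambda>t. x l t \<omega>"] T cvx
    by (simp add: scaleR_sum_right sum_distrib_left)
  then have "real T * f i ((1 / real T) *\<^sub>R (\<Sum>t=1..T. x l t \<omega>)) \<le> (\<Sum>t=1..T. f i (x l t \<omega>))" for i
    using T by (simp add: pos_le_divide_eq mult.commute)
  then have "(1 / real CARD('v)) * (\<Sum>i\<in>UNIV. real T * f i ((1 / real T) *\<^sub>R (\<Sum>t=1..T. x l t \<omega>))) \<le> (1 / real CARD('v)) * (\<Sum>i\<in>UNIV. \<Sum>t=1..T. f i (x l t \<omega>))"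
    by (intro mult_left_mono sum_mono) auto
  also have "\<dots> = (\<Sum>t=1..T. avg_fun f (x l t \<omega>))"
    unfolding avg_fun_def by (subst sum.swap) (simp add: sum_distrib_left)
  also have "\<dots> \<le> (\<Sum>t=1..T. (1 / real CARD('v)) * (\<Sum>i\<in>UNIV. f i (y i t \<omega>)) + 2 * Lip * dispersion (\<lambda>i. x i t \<omega>))"
    by (intro sum_mono agent_value_le[OF run])
  also have "\<dots> = (1 / real CARD('v)) * (\<Sum>t=1..T. \<Sum>i\<in>UNIV. f i (y i t \<omega>)) + 2 * Lip * (\<Sum>t=1..T. dispersion (\<lambda>i. x i t \<omega>))"
    by (simp add: sum.distrib sum_distrib_left)
  also have "\<dots> \<le> (1 / real CARD('v)) * (\<Sum>t=1..T. \<Sum>i\<in>UNIV. f i (y i t \<omega>))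
      + 2 * Lip * (4 * (real CARD('v))\<^sup>2 * real B / \<zeta> * displacement_bound T \<omega>)"
  proof (intro add_left_mono mult_left_mono)
    show "(\<Sum>t=1..T. dispersion (\<lambda>i. x i t \<omega>)) \<le> 4 * (real CARD('v))\<^sup>2 * real B / \<zeta> * displacement_bound T \<omega>"
      using dispersion_bound[OF run, of T] z unfolding displacement_bound_def[symmetric] by (simp add: field_simps)
  qed (simp add: Lip_nonneg)
  finally show ?thesis unfolding avg_fun_def by (simp only: sum_distrib_left mult_ac)
qed

text \<open>
  The factor \<open>3 n\<^sup>2\<close> bounds the fourth moment of a direction, on which the squared estimates in the regret depend; the factor \<open>n\<close> is its second moment, on which the consensus error depends.
\<close>

theorem expected_gap_le:
  assumes u: "u \<in> X" and T: "1 \<le> T"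
  defines "q \<equiv> 1 - \<zeta> / (4 * (real CARD('v))\<^sup>2)"
  shows "expectation (\<lambda>\<omega>. avg_fun f ((1 / real T) *\<^sub>R (\<Sum>t=1..T. x l t \<omega>))) - avg_fun f u
    \<le> sqrt (real CARD('n)) * Lip * ((1 / real CARD('v)) * (\<Sum>i\<in>UNIV. \<mu> i))
      + (sqrt 2 * d\<^sup>2 / \<eta> + 3 * (real CARD('n))\<^sup>2 * Lip\<^sup>2 * \<eta> / \<sigma>
         + 4 * real CARD('v) * real CARD('n) * (q powi (-2)) * Lip\<^sup>2 * \<eta> / (\<sigma> * (1 - q powr (1 / real B)))) / sqrt (real T)"
proof -
  let ?F = "\<lambda>\<omega>. avg_fun f ((1 / real T) *\<^sub>R (\<Sum>t=1..T. x l t \<omega>))"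
  let ?bias = "sqrt (real CARD('n)) * Lip * ((1 / real CARD('v)) * (\<Sum>i\<in>UNIV. \<mu> i))"
  let ?a = "sqrt 2 * d\<^sup>2 / \<eta> + 3 * (real CARD('n))\<^sup>2 * Lip\<^sup>2 * \<eta> / \<sigma>"
  let ?b = "q powi (-2) / (1 - q powr (1 / real B))"
  let ?r = "sqrt (real T)"
  have N: "1 \<le> real CARD('v)" by (simp add: Suc_leI)
  have z: "0 < \<zeta>" "\<zeta> < 1" and B: "1 \<le> B" by (rule networkD[OF net])+
  have "\<zeta> < 4 * (real CARD('v))\<^sup>2" using z(2) one_le_power[OF N, of 2] by linarith
  then have q: "0 < q" "q < 1" unfolding q_def using z N by auto
  have rate: "4 * (real CARD('v))\<^sup>2 * real B / \<zeta> \<le> ?b"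
  proof -
    have "4 * (real CARD('v))\<^sup>2 * real B / \<zeta> = real B / (1 - q)" unfolding q_def using z N by (simp add: field_simps)
    also have "\<dots> \<le> ?b" by (rule geometric_constant_bound(2)[OF q B])
    finally show ?thesis .
  qed
  have intF: "integrable M ?F"
  proof -
    obtain C where C: "\<And>i u. u \<in> X \<Longrightarrow> \<bar>f i u\<bar> \<le> C i" using f_bounded by metis
    have "norm (?F \<omega>) \<le> (1 / real CARD('v)) * (\<Sum>i\<in>UNIV. C i)" if w: "\<omega> \<in> space M" for \<omega>
    proof -
      have "(1 / real T) *\<^sub>R (\<Sum>t=1..T. x l t \<omega>) \<in> X"
        unfolding scaleR_sum_right using T by (intro convex_sum X_convex x_in[OF runs[OF w]]) auto
      then have "\<bar>\<Sum>i\<in>UNIV. f i ((1 / real T) *\<^sub>R (\<Sum>t=1..T. x l t \<omega>))\<bar> \<le> (\<Sum>i\<in>UNIV. C i)"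
        by (intro order_trans[OF sum_abs] sum_mono C)
      then show ?thesis unfolding avg_fun_def by (simp add: abs_mult divide_right_mono)
    qed
    then show ?thesis
      unfolding avg_fun_def
      by (intro integrable_const_bound[where B = "(1 / real CARD('v)) * (\<Sum>i\<in>UNIV. C i)"]) (auto intro!: AE_I2)
  qed
  have "real T * expectation ?F = expectation (\<lambda>\<omega>. real T * ?F \<omega>)" by simp
  also have "\<dots> \<le> expectation (\<lambda>\<omega>. (1 / real CARD('v)) * (\<Sum>t=1..T. \<Sum>i\<in>UNIV. f i (y i t \<omega>)) + 2 * Lip * (4 * (real CARD('v))\<^sup>2 * real B / \<zeta> * displacement_bound T \<omega>))"
    by (intro integral_mono_AE AE_I2 average_value_le[OF _ T] integrable_mult_right intF
        Bochner_Integration.integrable_add Bochner_Integration.integrable_sum f_y_integrable displacement_bound_expectation)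
  also have "\<dots> = (1 / real CARD('v)) * (\<Sum>t=1..T. \<Sum>i\<in>UNIV. expectation (\<lambda>\<omega>. f i (y i t \<omega>)))
      + 2 * Lip * (4 * (real CARD('v))\<^sup>2 * real B / \<zeta> * expectation (displacement_bound T))"
    by (simp add: f_y_integrable displacement_bound_expectation del: times_divide_eq_left)
  also have "\<dots> \<le> (1 / real CARD('v)) * (\<Sum>t=1..T. \<Sum>i\<in>UNIV. f i u + \<mu> i * Lip * sqrt (real CARD('n)) + expectation (first_order_gap u i t))
      + 2 * Lip * (?b * (2 * real CARD('v) * real CARD('n) * Lip * \<eta> / \<sigma> * ?r))"
  proof (intro add_mono mult_left_mono sum_mono expected_value_le u)
    have "0 \<le> 2 * real CARD('v) * real CARD('n) * Lip * \<eta> / \<sigma> * ?r" using Lip_nonneg \<eta>_pos \<sigma>_pos by simp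
    moreover have "0 \<le> 4 * (real CARD('v))\<^sup>2 * real B / \<zeta>" using z by simp
    ultimately show "4 * (real CARD('v))\<^sup>2 * real B / \<zeta> * expectation (displacement_bound T) \<le> ?b * (2 * real CARD('v) * real CARD('n) * Lip * \<eta> / \<sigma> * ?r)"
      using rate displacement_bound_expectation(2)[of T] by (meson mult_left_mono mult_right_mono order_trans)
  qed (use Lip_nonneg in auto)
  also have "(\<Sum>t=1..T. \<Sum>i\<in>UNIV. f i u + \<mu> i * Lip * sqrt (real CARD('n)) + expectation (first_order_gap u i t))
      = real T * ((\<Sum>i\<in>UNIV. f i u) + sqrt (real CARD('n)) * Lip * (\<Sum>i\<in>UNIV. \<mu> i)) + (\<Sum>t=1..T. \<Sum>i\<in>UNIV. expectation (first_order_gap u i t))"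
    by (simp add: sum.distrib sum_distrib_left sum_distrib_right mult_ac distrib_left)
  also have "(1 / real CARD('v)) * (\<dots>) \<le> (1 / real CARD('v)) * (real T * ((\<Sum>i\<in>UNIV. f i u) + sqrt (real CARD('n)) * Lip * (\<Sum>i\<in>UNIV. \<mu> i)) + real CARD('v) * ?a * ?r)"
    by (intro mult_left_mono add_left_mono expected_regret_le[OF u T]) auto
  also have "\<dots> = real T * (avg_fun f u + ?bias) + ?a * ?r"
    using N unfolding avg_fun_def by (simp add: field_simps)
  finally have main: "real T * expectation ?F \<le> real T * (avg_fun f u + ?bias) + ?a * ?r
      + 2 * Lip * (?b * (2 * real CARD('v) * real CARD('n) * Lip * \<eta> / \<sigma> * ?r))" by simp
  let ?c = "4 * real CARD('v) * real CARD('n) * (q powi (-2)) * Lip\<^sup>2 * \<eta> / (\<sigma> * (1 - q powr (1 / real B)))"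
  have "2 * Lip * (?b * (2 * real CARD('v) * real CARD('n) * Lip * \<eta> / \<sigma> * ?r)) = ?c * ?r"
    by (simp add: power2_eq_square mult_ac)
  with main have "real T * expectation ?F \<le> real T * (avg_fun f u + ?bias) + ?a * ?r + ?c * ?r"
    by (simp only:)
  then show ?thesis using T by (intro divide_gap_by_horizon) auto
qed

end

theorem theorem3:
  fixes E :: "nat \<Rightarrow> ('v::finite \<times> 'v) set"
    and P :: "nat \<Rightarrow> real ^ 'v ^ 'v"
    and B :: nat
    and \<zeta> \<Gamma> \<gamma> N n :: real
    and X U :: "(real ^ 'n) set"
    and f :: "'v \<Rightarrow> real ^ 'n \<Rightarrow> real"
    and L \<mu> :: "'v \<Rightarrow> real"
    and Lmax \<sigma> d \<eta> C1 :: real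
    and \<phi> :: "real ^ 'n \<Rightarrow> real"
    and M :: "'w measure"
    and \<xi> x y :: "'v \<Rightarrow> nat \<Rightarrow> 'w \<Rightarrow> real ^ 'n"
    and l :: 'v
    and xstar :: "real ^ 'n"
    and T :: nat
  defines "N \<equiv> real CARD('v)"
    and "n \<equiv> real CARD('n)"
    and "\<Gamma> \<equiv> (1 - \<zeta> / (4 * N\<^sup>2)) powi (-2)"
    and "\<gamma> \<equiv> (1 - \<zeta> / (4 * N\<^sup>2)) powr (1 / real B)"
    and "Lmax \<equiv> Max (range L)"
    and "C1 \<equiv> sqrt 2 * d\<^sup>2 / \<eta>
              + 9 * sqrt 2 * (n + 4)\<^sup>2 * Lmax\<^sup>2 * \<eta> / \<sigma>
              + 4 * sqrt 2 * N * (n + 4)\<^sup>2 * \<Gamma> * Lmax\<^sup>2 * \<eta> / (\<sigma> * (1 - \<gamma>))"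
  assumes "network E P B \<zeta>"
    and "X \<noteq> {}" "compact X" "convex X" "0 \<in> X"
    and "\<And>i. convex_on UNIV (f i)"
    and "\<And>i. (L i)-lipschitz_on UNIV (f i)"
    and "open U" "X \<subseteq> U" "C3_on U \<phi>"
    and "0 < \<sigma>" "strongly_convex_on X \<sigma> \<phi>"
    and "\<And>u. u \<in> X \<Longrightarrow> psd (hess \<phi> u)"
    and "\<And>u v. u \<in> X \<Longrightarrow> v \<in> X \<Longrightarrow> psd (hess \<phi> v + hess_deriv \<phi> v (v - u))"
    and "\<And>u v. u \<in> X \<Longrightarrow> v \<in> X \<Longrightarrow> bregman \<phi> u v \<le> d\<^sup>2"
    and "prob_space M"
    and "prob_space.indep_vars M (\<lambda>_. borel) (\<lambda>(i, t). \<xi> i t) UNIV"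
    and "\<And>i t. std_gaussian M (\<xi> i t)"
    and "\<And>i. 0 < \<mu> i"
    and "0 < \<eta>"
    and "\<And>\<omega>. \<omega> \<in> space M \<Longrightarrow>
           drgfmd X \<phi> P f \<mu> (\<lambda>t. \<eta> / sqrt (real t + 1))
             (\<lambda>i t. \<xi> i t \<omega>) (\<lambda>i t. x i t \<omega>) (\<lambda>i t. y i t \<omega>)"
    and "is_arg_min (avg_fun f) (\<lambda>u. u \<in> X) xstar"
    and "1 \<le> T"
  shows "prob_space.expectation M
           (\<lambda>\<omega>. avg_fun f ((1 / real T) *\<^sub>R (\<Sum>t=1..T. x l t \<omega>))) - avg_fun f xstar
         \<le> sqrt n * Lmax * ((1 / N) * (\<Sum>i\<in>UNIV. \<mu> i)) + C1 / sqrt (real T)"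
proof -
  note asm = assms(7-)
  have net: "network E P B \<zeta>" by fact
  interpret drgfmd_setting X U \<phi> \<sigma> E P B \<zeta> f L \<mu> d \<eta>
    by unfold_locales (fact asm)+
  interpret drgfmd_random X U \<phi> \<sigma> E P B \<zeta> f L \<mu> d \<eta> M \<xi> x y
  proof -
    interpret prob_space M by fact
    show "drgfmd_random X U \<phi> \<sigma> E P B \<zeta> f L \<mu> d \<eta> M \<xi> x y"
      by unfold_locales (unfold \<alpha>_def, (fact asm)+)
  qed
  define q where "q = 1 - \<zeta> / (4 * N\<^sup>2)"
  have N: "1 \<le> N" unfolding N_def by (simp add: Suc_leI)
  have n: "1 \<le> n" unfolding n_def by (simp add: Suc_leI)
  have "0 < \<zeta>" "\<zeta> < 1" and B: "1 \<le> B" by (rule networkD[OF net])+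
  moreover from this have "\<zeta> < 4 * N\<^sup>2" using one_le_power[OF N, of 2] by linarith
  ultimately have q: "0 < q" "q < 1" unfolding q_def using N by auto
  have \<gamma>: "\<gamma> = q powr (1 / real B)" and \<Gamma>: "\<Gamma> = q powi (-2)"
    unfolding q_def \<gamma>_def \<Gamma>_def by simp_all
  have "\<gamma> < 1" unfolding \<gamma> by (rule geometric_constant_bound(1)[OF q B])
  have "0 \<le> \<Gamma>" unfolding \<Gamma> using q by simp
  have "xstar \<in> X" using \<open>is_arg_min (avg_fun f) (\<lambda>u. u \<in> X) xstar\<close> unfolding is_arg_min_def by simp
  note gap = expected_gap_le[OF this \<open>1 \<le> T\<close>, of l, folded N_def n_def, folded q_def, folded \<gamma> \<Gamma>,
      unfolded Lip_def, folded Lmax_def]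
  \<comment> \<open>The bound just obtained has the smaller moments \<open>3 n\<^sup>2\<close> and \<open>n\<close> in place of \<open>(n + 4)\<^sup>2\<close>.\<close>
  have "n\<^sup>2 \<le> (n + 4)\<^sup>2" using n by (intro power_mono) auto
  have s2: "1 \<le> sqrt 2" by simp
  have "3 * n\<^sup>2 \<le> 9 * sqrt 2 * (n + 4)\<^sup>2"
    using s2 \<open>n\<^sup>2 \<le> (n + 4)\<^sup>2\<close> by (intro mult_mono) (linarith | simp)+
  then have "3 * n\<^sup>2 * (Lmax\<^sup>2 * \<eta> / \<sigma>) \<le> 9 * sqrt 2 * (n + 4)\<^sup>2 * (Lmax\<^sup>2 * \<eta> / \<sigma>)"
    using \<open>0 < \<eta>\<close> \<open>0 < \<sigma>\<close> by (intro mult_right_mono) auto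
  moreover have "n \<le> sqrt 2 * (n + 4)\<^sup>2"
  proof -
    have "1 * n \<le> sqrt 2 * n\<^sup>2" using n by (intro mult_mono) (auto simp: power2_eq_square)
    also have "\<dots> \<le> sqrt 2 * (n + 4)\<^sup>2" using \<open>n\<^sup>2 \<le> (n + 4)\<^sup>2\<close> by simp
    finally show ?thesis by simp
  qed
  then have "n * (4 * N * \<Gamma> * Lmax\<^sup>2 * \<eta> / (\<sigma> * (1 - \<gamma>))) \<le> sqrt 2 * (n + 4)\<^sup>2 * (4 * N * \<Gamma> * Lmax\<^sup>2 * \<eta> / (\<sigma> * (1 - \<gamma>)))"
    using N \<open>0 \<le> \<Gamma>\<close> \<open>\<gamma> < 1\<close> \<open>0 < \<eta>\<close> \<open>0 < \<sigma>\<close> by (intro mult_right_mono) auto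
  ultimately have "sqrt 2 * d\<^sup>2 / \<eta> + 3 * n\<^sup>2 * Lmax\<^sup>2 * \<eta> / \<sigma> + 4 * N * n * \<Gamma> * Lmax\<^sup>2 * \<eta> / (\<sigma> * (1 - \<gamma>)) \<le> C1"
    unfolding C1_def by (simp add: mult_ac)
  then have "(sqrt 2 * d\<^sup>2 / \<eta> + 3 * n\<^sup>2 * Lmax\<^sup>2 * \<eta> / \<sigma> + 4 * N * n * \<Gamma> * Lmax\<^sup>2 * \<eta> / (\<sigma> * (1 - \<gamma>))) / sqrt (real T)
      \<le> C1 / sqrt (real T)"
    by (intro divide_right_mono) auto
  with gap show ?thesis by linarith
qed

end
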